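(* Let $n\ge 2$, let $\omega(k)=\sum_{j=2}^n\omega_jk^j$ be a polynomial with real coefficients and $\omega_n\neq0$, and let $q_o\in L^2(\mathbb R)\cap L^1(\mathbb R,(1+|x|)^\ell\,dx)$. If $$\ell\ge\frac{n+2}{2(n-1)},$$ then the $L^2$ solution of the initial value problem $iq_t-\omega(-i\partial_x)q=0$, $q(x,0)=q_o(x)$, is classical for $t>0$.
   Context: The $L^2$ solution is $q(x,t)=\frac1{2\pi}\int_{\mathbb R}e^{ikx-i\omega(k)t}\hat q_o(k)\,dk$ (inverse Fourier transform in the $L^2(\mathbb R)$ sense), where $\hat q_o(k)=\int_{\mathbb R}e^{-ikx}q_o(x)\,dx$; as usual it may be modified, for each $t$, on a null set of $x$. A function is a classical solution of the PDE in an open region $\Omega\subset\mathbb R^2$ if all derivatives present in the PDE exist at every $(x,t)\in\Omega$ and the PDE is satisfied pointwise there. "Classical for $t>0$" means classical in $\Omega=\mathbb R\times(0,\infty)$. *)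

theory Defs
  imports "HOL-Analysis.Analysis" "HOL-Computational_Algebra.Polynomial"
begin

definition square_integrable :: "(real \<Rightarrow> complex) \<Rightarrow> bool" where
  "square_integrable f \<longleftrightarrow>
     f \<in> borel_measurable lebesgue \<and> integrable lebesgue (\<lambda>x. (norm (f x))\<^sup>2)"

definition weighted_integrable :: "real \<Rightarrow> (real \<Rightarrow> complex) \<Rightarrow> bool" where
  "weighted_integrable l f \<longleftrightarrow>
     f \<in> borel_measurable lebesgue \<and> integrable lebesgue (\<lambda>x. (1 + \<bar>x\<bar>) powr l * norm (f x))"

definition fourier :: "(real \<Rightarrow> complex) \<Rightarrow> real \<Rightarrow> complex" where
  "fourier f k = (LINT x|lebesgue. exp (- \<i> * of_real (k * x)) * f x)"

definition truncated_inverse_fourier :: "real \<Rightarrow> (real \<Rightarrow> complex) \<Rightarrow> real \<Rightarrow> complex" where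
  "truncated_inverse_fourier R g x =
     1 / (2 * of_real pi) * (LINT k:{-R..R}|lebesgue. exp (\<i> * of_real (k * x)) * g k)"

text \<open>The inverse Fourier transform in the \<open>L\<^sup>2\<close> sense: \<open>f\<close> is a representative of the \<open>L\<^sup>2\<close> limit
  of the truncated inversion integrals of \<open>g\<close>; it is determined only up to a null set.  The squared
  distance is a nonnegative (extended real) integral, so that convergence to 0 cannot hold merely
  because a divergent integral is assigned the default value 0.\<close>

definition L2_inverse_fourier :: "(real \<Rightarrow> complex) \<Rightarrow> (real \<Rightarrow> complex) \<Rightarrow> bool" where
  "L2_inverse_fourier g f \<longleftrightarrow>
     square_integrable g \<and> square_integrable f \<and>
     ((\<lambda>R. \<integral>\<^sup>+ x. ennreal ((norm (truncated_inverse_fourier R g x - f x))\<^sup>2) \<partial>lebesgue)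
        \<longlongrightarrow> 0) at_top"

text \<open>A representative \<open>q\<close> of the \<open>L\<^sup>2\<close> solution, i.e. one choice for each \<open>t\<close> of \<open>q(\<cdot>, t)\<close> within
  its class modulo null sets.\<close>

definition L2_solution :: "real poly \<Rightarrow> (real \<Rightarrow> complex) \<Rightarrow> (real \<Rightarrow> real \<Rightarrow> complex) \<Rightarrow> bool" where
  "L2_solution \<omega> q\<^sub>o q \<longleftrightarrow>
     (\<forall>t. L2_inverse_fourier (\<lambda>k. exp (- \<i> * of_real (poly \<omega> k * t)) * fourier q\<^sub>o k) (\<lambda>x. q x t))"

definition dx :: "(real \<Rightarrow> real \<Rightarrow> complex) \<Rightarrow> real \<Rightarrow> real \<Rightarrow> complex" where
  "dx q = (\<lambda>x t. vector_derivative (\<lambda>y. q y t) (at x))"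

definition dt :: "(real \<Rightarrow> real \<Rightarrow> complex) \<Rightarrow> real \<Rightarrow> real \<Rightarrow> complex" where
  "dt q = (\<lambda>x t. vector_derivative (\<lambda>s. q x s) (at t))"

text \<open>The operator \<open>\<omega>(-i\<partial>\<^sub>x)\<close>.\<close>

definition dispersion_op :: "real poly \<Rightarrow> (real \<Rightarrow> real \<Rightarrow> complex) \<Rightarrow> real \<Rightarrow> real \<Rightarrow> complex" where
  "dispersion_op \<omega> q x t =
     (\<Sum>j\<le>degree \<omega>. of_real (coeff \<omega> j) * (- \<i>) ^ j * (dx ^^ j) q x t)"

text \<open>All \<open>x\<close>-derivatives up to the order \<open>degree \<omega>\<close> are required to exist on \<open>\<Omega>\<close>.  Those of lower
  order must exist near any point of \<open>\<Omega>\<close> where the one of top order exists, even if their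
  coefficient in \<open>\<omega>\<close> vanishes.\<close>

definition classical_solution ::
    "real poly \<Rightarrow> (real \<Rightarrow> real \<Rightarrow> complex) \<Rightarrow> (real \<times> real) set \<Rightarrow> bool" where
  "classical_solution \<omega> q \<Omega> \<longleftrightarrow>
     open \<Omega> \<and>
     (\<forall>(x, t) \<in> \<Omega>.
        (\<lambda>s. q x s) differentiable (at t) \<and>
        (\<forall>j<degree \<omega>. (\<lambda>y. (dx ^^ j) q y t) differentiable (at x)) \<and>
        \<i> * dt q x t - dispersion_op \<omega> q x t = 0)"

end

theory Submission
  imports Defs "HOL-Probability.Characteristic_Functions"
begin

text \<open>Formally \<open>q(\<cdot>, t)\<close> is the convolution of \<open>q\<^sub>o\<close> with the kernel
  \<open>K(z, t) = 1/(2\<pi>) \<integral> exp (i k z - i \<omega>(k) t) dk\<close>.  Stationary phase bounds the \<open>x\<close>-derivatives of \<open>K\<close>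
  up to the order \<open>n\<close> by a multiple of \<open>(1 + \<bar>z\<bar>) powr ((n + 2) / (2 * (n - 1)))\<close>, locally uniformly in
  \<open>t > 0\<close>, which is exactly the weight that \<open>q\<^sub>o\<close> can absorb.  To avoid conditionally convergent
  integrals, the frequencies are cut off smoothly at \<open>\<bar>k\<bar> = R\<close>: the cut-off kernels obey these bounds
  uniformly in \<open>R\<close> and converge locally uniformly as \<open>R \<rightarrow> \<infinity>\<close>, hence so do the cut-off solutions together
  with all derivatives in the equation.  By Plancherel's inequality and Fatou's lemma their limit is
  a representative of the \<open>L\<^sup>2\<close> solution.\<close>

section \<open>Oscillatory integrals\<close>

text \<open>The borderline case is the derivative of order n. There the amplitude, of order
  \<open>k ^ n\<close>, outgrows the phase derivative, of order \<open>k ^ (n - 1)\<close>, so a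
  single integration by parts leaves an integrand that does not decay; this is why the tail is
  integrated by parts twice, with an explicit boundary term at its lower end. Around the stationary
  point the estimate needs a second phase derivative of constant sign. Lower order terms of \<omega>
  spoil this for small k, and for odd n the leading term of the second derivative changes sign at
  the origin. Hence the two half-lines are treated separately, and on each a fixed interval [0, B]
  is estimated trivially. \<open>L2_solution\<close> also asks for a representative at times t \<le>
  0, for which no kernel estimates are made; there an almost everywhere convergent sequence of
  sharply truncated integrals supplies one, as in the Riesz-Fischer theorem.\<close>

lemma has_vector_derivative_cis:
  assumes "(f has_real_derivative d) (at x)"
  shows "((\<lambda>x. cis (f x)) has_vector_derivative \<i> * of_real d * cis (f x)) (at x)"
  unfolding cis_conv_exp
  using field_vector_diff_chain_at[of "\<lambda>k. \<i> * of_real (f k)" "\<i> * of_real d" x exp "exp (\<i> * of_real (f x))"]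
    has_vector_derivative_mult_right[OF has_vector_derivative_of_real[OF assms], of \<i>]
  by (auto simp: o_def mult_ac DERIV_exp)

text \<open>Integration by parts in the form of an exact derivative: a choice of \<open>u\<close>
  for which \<open>\<i> * p * u\<close> approximates the amplitude turns the integral into boundary
  terms plus an error governed by \<open>u'\<close>.\<close>

lemma oscillatory_by_parts:
  fixes \<phi> p :: "real \<Rightarrow> real" and u u' :: "real \<Rightarrow> complex"
  assumes "a \<le> b"
    and \<phi>: "\<And>k. k \<in> {a..b} \<Longrightarrow> (\<phi> has_real_derivative p k) (at k)"
    and u: "\<And>k. k \<in> {a..b} \<Longrightarrow> (u has_vector_derivative u' k) (at k)"
  shows "((\<lambda>k. (\<i> * of_real (p k) * u k + u' k) * cis (\<phi> k)) has_integral
           (u b * cis (\<phi> b) - u a * cis (\<phi> a))) {a..b}"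
proof (rule fundamental_theorem_of_calculus[OF \<open>a \<le> b\<close>])
  fix k assume k: "k \<in> {a..b}"
  from has_vector_derivative_mult[OF u[OF k] has_vector_derivative_cis[OF \<phi>[OF k]]]
  show "((\<lambda>k. u k * cis (\<phi> k)) has_vector_derivative
      (\<i> * of_real (p k) * u k + u' k) * cis (\<phi> k)) (at k within {a..b})"
    by (rule has_vector_derivative_at_within[THEN has_vector_derivative_eq_rhs])
      (simp add: algebra_simps)
qed

text \<open>The weight \<open>p / (p\<^sup>2 + c)\<close> regularises \<open>1 / p\<close>, so that one integration by parts
  covers the stationary point as well, and the error terms are bounded by the derivative of
  \<open>arctan (p / sqrt c) / sqrt c\<close>.\<close>

lemma van_der_Corput_second:
  fixes \<phi> p p' :: "real \<Rightarrow> real"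
  assumes "a \<le> b" "0 < c"
    and \<phi>: "\<And>k. k \<in> {a..b} \<Longrightarrow> (\<phi> has_real_derivative p k) (at k)"
    and p: "\<And>k. k \<in> {a..b} \<Longrightarrow> (p has_real_derivative p' k) (at k)"
    and c: "\<And>k. k \<in> {a..b} \<Longrightarrow> c \<le> p' k"
  shows "norm (integral {a..b} (\<lambda>k. cis (\<phi> k))) \<le> (1 + 2 * pi) / sqrt c"
proof -
  define D where "D k = (p k)\<^sup>2 + c" for k
  have D: "D k > 0" for k unfolding D_def using \<open>0 < c\<close> by (simp add: add_nonneg_pos)
  define u where "u k = p k / D k" for k
  define u' where "u' k = p' k * (c - (p k)\<^sup>2) / (D k)\<^sup>2" for k
  have u: "(u has_real_derivative u' k) (at k)" if "k \<in> {a..b}" for k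
    unfolding u_def u'_def D_def using p[OF that] D[of k]
    by (auto intro!: derivative_eq_intros simp: D_def power2_eq_square field_simps)
  have u_le: "\<bar>u k\<bar> \<le> 1 / (2 * sqrt c)" for k
  proof -
    have "0 \<le> (\<bar>p k\<bar> - sqrt c)\<^sup>2" by simp
    then have "2 * sqrt c * \<bar>p k\<bar> \<le> D k"
      using \<open>0 < c\<close> by (simp add: power2_diff D_def algebra_simps)
    then show ?thesis unfolding u_def using D[of k] \<open>0 < c\<close> by (simp add: field_simps abs_mult)
  qed
  define H where "H k = (\<i> * of_real (p k) * of_real (u k) + of_real (u' k)) * cis (\<phi> k)" for k
  have H: "(H has_integral (of_real (u b) * cis (\<phi> b) - of_real (u a) * cis (\<phi> a))) {a..b}"
    unfolding H_def
    by (rule oscillatory_by_parts[OF \<open>a \<le> b\<close> \<phi>])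
      (auto intro!: has_vector_derivative_of_real u simp: has_real_derivative_iff_has_vector_derivative[symmetric])
  have arctan: "((\<lambda>k. p' k / D k) has_integral
      (arctan (p b / sqrt c) / sqrt c - arctan (p a / sqrt c) / sqrt c)) {a..b}"
  proof (rule fundamental_theorem_of_calculus[OF \<open>a \<le> b\<close>])
    fix k assume k: "k \<in> {a..b}"
    have "((\<lambda>k. arctan (p k / sqrt c) / sqrt c) has_real_derivative p' k / D k) (at k)"
    proof -
      define r where "r = sqrt c"
      have r: "r > 0" "c = r\<^sup>2" using \<open>0 < c\<close> by (auto simp: r_def)
      have "1 + (p k / r)\<^sup>2 = D k / r\<^sup>2" using r by (simp add: D_def power_divide add_divide_distrib)
      then have "p' k / r / (1 + (p k / r)\<^sup>2) / r = p' k / D k"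
        using r by (simp add: power2_eq_square)
      moreover have "((\<lambda>k. arctan (p k / r) / r) has_real_derivative
          p' k / r / (1 + (p k / r)\<^sup>2) / r) (at k)"
        by (rule DERIV_cong[OF DERIV_cdivide[OF DERIV_chain2[OF DERIV_arctan DERIV_cdivide[OF p[OF k]]]]])
          (simp add: divide_inverse mult_ac)
      ultimately show ?thesis by (metis r_def)
    qed
    then show "((\<lambda>k. arctan (p k / sqrt c) / sqrt c) has_vector_derivative p' k / D k)
        (at k within {a..b})"
      by (simp add: has_real_derivative_iff_has_vector_derivative has_vector_derivative_at_within)
  qed
  have le: "arctan (p b / sqrt c) / sqrt c - arctan (p a / sqrt c) / sqrt c \<le> pi / sqrt c"
    using arctan_bounded[of "p b / sqrt c"] arctan_bounded[of "p a / sqrt c"] \<open>0 < c\<close>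
    by (simp add: diff_divide_distrib[symmetric] divide_right_mono)
  have cont: "continuous_on {a..b} (\<lambda>k. cis (\<phi> k))"
    by (intro continuous_intros continuous_at_imp_continuous_on ballI DERIV_isCont[OF \<phi>])
  \<comment> \<open>Since \<open>p k * u k = 1 - c / D k\<close>, adding \<open>\<i> * H k\<close>
    cancels the main part of the integrand. What remains has coefficient
    \<open>c / D k + \<i> * u' k\<close>, and both terms are at most \<open>p' k / D k\<close>, the
    derivative of the arctangent above. This gives the \<open>2 * pi\<close> of the constant; the
    two boundary values of \<open>u\<close> give the 1.\<close>
  define V where "V k = cis (\<phi> k) + \<i> * H k" for k
  have V: "(V has_integral integral {a..b} (\<lambda>k. cis (\<phi> k)) +
      \<i> * (of_real (u b) * cis (\<phi> b) - of_real (u a) * cis (\<phi> a))) {a..b}"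
    unfolding V_def
    by (intro has_integral_add has_integral_mult_right H integrable_integral
        integrable_continuous_real cont)
  have "norm (V k) \<le> 2 * (p' k / D k)" if "k \<in> {a..b}" for k
  proof -
    have eq: "V k = (of_real (c / D k) + \<i> * of_real (u' k)) * cis (\<phi> k)"
    proof -
      have "p k * u k = 1 - c / D k" using D[of k] by (simp add: u_def D_def power2_eq_square field_simps)
      then have "of_real (p k) * of_real (u k) = (1 - of_real (c / D k) :: complex)"
        by (metis of_real_1 of_real_diff of_real_mult)
      moreover have "V k = (1 - of_real (p k) * of_real (u k) + \<i> * of_real (u' k)) * cis (\<phi> k)"
        by (simp add: V_def H_def algebra_simps)
      ultimately show ?thesis by simp
    qed
    have "\<bar>u' k\<bar> \<le> p' k / D k"
    proof -
      have "\<bar>c - (p k)\<^sup>2\<bar> \<le> D k" unfolding D_def using \<open>0 < c\<close> by (simp add: abs_le_iff)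
      then have "p' k * \<bar>c - (p k)\<^sup>2\<bar> / (D k)\<^sup>2 \<le> p' k * D k / (D k)\<^sup>2"
        using c[OF that] \<open>0 < c\<close> by (intro divide_right_mono mult_left_mono) auto
      then show ?thesis
        using D[of k] c[OF that] \<open>0 < c\<close> by (simp add: u'_def abs_mult power2_eq_square)
    qed
    moreover have "c / D k \<le> p' k / D k" using c[OF that] D[of k] by (simp add: divide_right_mono)
    moreover have "norm (V k) \<le> \<bar>c / D k\<bar> + \<bar>u' k\<bar>"
      unfolding eq norm_mult norm_cis
      by (metis mult.right_neutral norm_ii norm_mult norm_of_real norm_triangle_ineq mult_1)
    ultimately show ?thesis using D[of k] \<open>0 < c\<close> by simp
  qed
  then have "norm (integral {a..b} V) \<le> integral {a..b} (\<lambda>k. 2 * (p' k / D k))"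
    using has_integral_integrable[OF has_integral_mult_right[OF arctan, of 2]] V
    by (intro integral_norm_bound_integral) (blast intro: has_integral_integrable)+
  also have "\<dots> = 2 * (arctan (p b / sqrt c) / sqrt c - arctan (p a / sqrt c) / sqrt c)"
    using has_integral_mult_right[OF arctan, of 2] by (rule integral_unique)
  also have "\<dots> \<le> 2 * (pi / sqrt c)" using le by simp
  finally have 1: "norm (integral {a..b} V) \<le> 2 * (pi / sqrt c)" .
  have "integral {a..b} (\<lambda>k. cis (\<phi> k)) = integral {a..b} V
      - \<i> * (of_real (u b) * cis (\<phi> b)) + \<i> * (of_real (u a) * cis (\<phi> a))"
    using integral_unique[OF V] by (simp add: algebra_simps)
  also have "norm \<dots> \<le> norm (integral {a..b} V) + \<bar>u b\<bar> + \<bar>u a\<bar>"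
    by (intro norm_triangle_le norm_triangle_le_diff add_mono) (auto simp: norm_mult)
  also have "\<dots> \<le> 2 * (pi / sqrt c) + 1 / (2 * sqrt c) + 1 / (2 * sqrt c)"
    by (intro add_mono 1 u_le)
  also have "\<dots> = (1 + 2 * pi) / sqrt c" using \<open>0 < c\<close> by (simp add: field_simps)
  finally show ?thesis .
qed

text \<open>Complex conjugation reverses the sign of the phase. The disjunction is over the whole
  interval because the second derivative must not change sign.\<close>

lemma van_der_Corput_second_abs:
  fixes \<phi> p p' :: "real \<Rightarrow> real"
  assumes "a \<le> b" "0 < c"
    and \<phi>: "\<And>k. k \<in> {a..b} \<Longrightarrow> (\<phi> has_real_derivative p k) (at k)"
    and p: "\<And>k. k \<in> {a..b} \<Longrightarrow> (p has_real_derivative p' k) (at k)"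
    and c: "(\<forall>k\<in>{a..b}. c \<le> p' k) \<or> (\<forall>k\<in>{a..b}. c \<le> - p' k)"
  shows "norm (integral {a..b} (\<lambda>k. cis (\<phi> k))) \<le> (1 + 2 * pi) / sqrt c"
  using c
proof
  assume "\<forall>k\<in>{a..b}. c \<le> p' k"
  with van_der_Corput_second[OF assms(1,2) \<phi> p] show ?thesis by blast
next
  assume *: "\<forall>k\<in>{a..b}. c \<le> - p' k"
  have "norm (integral {a..b} (\<lambda>k. cis (- \<phi> k))) \<le> (1 + 2 * pi) / sqrt c"
    by (rule van_der_Corput_second[OF assms(1,2) DERIV_minus[OF \<phi>] DERIV_minus[OF p]]) (use * in auto)
  also have "integral {a..b} (\<lambda>k. cis (- \<phi> k)) = cnj (integral {a..b} (\<lambda>k. cis (\<phi> k)))"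
    by (simp add: integral_cnj cis_cnj)
  finally show ?thesis by simp
qed

text \<open>Integration by parts against the primitive \<open>E u = integral {u..m} (\<lambda>k. cis (\<phi> k))\<close>, for which
  the second derivative test on \<open>{u..m}\<close> gives a bound of order \<open>1 / sqrt (u ^ (n - 2))\<close>.\<close>

lemma oscillatory_head:
  fixes \<phi> p p' a a' :: "real \<Rightarrow> real"
  assumes "1 \<le> B" "B \<le> m" "2 \<le> n" "0 < c" "0 \<le> A"
    and \<phi>: "\<And>k. k \<in> {B..m} \<Longrightarrow> (\<phi> has_real_derivative p k) (at k)"
    and p: "\<And>k. k \<in> {B..m} \<Longrightarrow> (p has_real_derivative p' k) (at k)"
    and c: "(\<forall>k\<in>{B..m}. c * k ^ (n - 2) \<le> p' k) \<or> (\<forall>k\<in>{B..m}. c * k ^ (n - 2) \<le> - p' k)"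
    and a: "\<And>k. k \<in> {B..m} \<Longrightarrow> (a has_real_derivative a' k) (at k)"
    and a_le: "\<And>k. k \<in> {B..m} \<Longrightarrow> \<bar>a k\<bar> \<le> A * k ^ n"
    and a'_le: "\<And>k. k \<in> {B..m} \<Longrightarrow> \<bar>a' k\<bar> \<le> A * k ^ (n - 1)"
  shows "norm (integral {B..m} (\<lambda>k. of_real (a k) * cis (\<phi> k)))
           \<le> 2 * (1 + 2 * pi) * A / sqrt c * sqrt (m ^ (n + 2))"
proof -
  define L where "L = (1 + 2 * pi) / sqrt c"
  have L: "L \<ge> 0" using pi_gt_zero \<open>0 < c\<close> by (simp add: L_def)
  define E where "E u = integral {u..m} (\<lambda>k. cis (\<phi> k))" for u
  have E: "norm (E u) \<le> L / sqrt (u ^ (n - 2))" if u: "u \<in> {B..m}" for u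
  proof -
    have pw: "c * u ^ (n - 2) \<le> c * k ^ (n - 2)" if "k \<in> {u..m}" for k
      using that u assms(1,4) by (intro mult_left_mono power_mono) auto
    have "norm (E u) \<le> (1 + 2 * pi) / sqrt (c * u ^ (n - 2))"
      unfolding E_def
    proof (rule van_der_Corput_second_abs[of _ _ _ _ p p'])
      show "(\<forall>k\<in>{u..m}. c * u ^ (n - 2) \<le> p' k) \<or> (\<forall>k\<in>{u..m}. c * u ^ (n - 2) \<le> - p' k)"
        using c pw u by (meson atLeastAtMost_iff order_trans)
    qed (use u assms(1,4) \<phi> p in auto)
    then show ?thesis by (simp add: L_def real_sqrt_mult)
  qed
  have cont_cis: "continuous_on {B..m} (\<lambda>k. cis (\<phi> k))"
    by (intro continuous_intros continuous_at_imp_continuous_on ballI DERIV_isCont[OF \<phi>])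
  have cont_a: "continuous_on {B..m} a"
    by (intro continuous_at_imp_continuous_on ballI DERIV_isCont[OF a])
  \<comment> \<open>\<open>G\<close> is the derivative of \<open>a * E\<close>. As
    \<open>E m = 0\<close>, only the boundary term at \<open>B\<close> survives.\<close>
  define G where "G k = of_real (a' k) * E k - of_real (a k) * cis (\<phi> k)" for k
  have "(G has_integral (of_real (a m) * E m - of_real (a B) * E B)) {B..m}"
  proof (rule fundamental_theorem_of_calculus[OF \<open>B \<le> m\<close>])
    fix k assume k: "k \<in> {B..m}"
    have "(E has_vector_derivative - cis (\<phi> k)) (at k within {B..m})"
      unfolding E_def by (rule integral_has_vector_derivative'[OF cont_cis k])
    moreover have "((\<lambda>k. complex_of_real (a k)) has_vector_derivative of_real (a' k)) (at k within {B..m})"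
      using a[OF k] by (intro has_vector_derivative_of_real) (auto intro: has_field_derivative_at_within)
    ultimately show "((\<lambda>k. of_real (a k) * E k) has_vector_derivative G k) (at k within {B..m})"
      unfolding G_def by (auto intro!: has_vector_derivative_eq_rhs[OF has_vector_derivative_mult])
  qed
  moreover have "E m = 0" by (simp add: E_def)
  ultimately have G: "(G has_integral - (of_real (a B) * E B)) {B..m}" by simp
  have I: "((\<lambda>k. of_real (a k) * cis (\<phi> k)) has_integral
      integral {B..m} (\<lambda>k. of_real (a k) * cis (\<phi> k))) {B..m}"
    by (intro integrable_integral integrable_continuous_real continuous_intros cont_cis cont_a)
  have GI: "((\<lambda>k. of_real (a' k) * E k) has_integral
      - (of_real (a B) * E B) + integral {B..m} (\<lambda>k. of_real (a k) * cis (\<phi> k))) {B..m}"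
    using has_integral_add[OF G I] by (simp add: G_def)
  \<comment> \<open>These are the orders of \<open>a * E\<close> and of \<open>a' * E\<close>.
    Integrating the second over a length of at most \<open>m\<close> raises it to
    \<open>sqrt (m ^ (n + 2))\<close>, the order of the first.\<close>
  have sq: "k ^ n / sqrt (k ^ (n - 2)) = sqrt (k ^ (n + 2))"
    "k ^ (n - 1) / sqrt (k ^ (n - 2)) = sqrt (k ^ n)" if "k \<ge> 1" for k :: real
  proof -
    obtain j where n: "n = j + 2" using \<open>2 \<le> n\<close> by (metis add.commute le_Suc_ex)
    have s: "k ^ j / sqrt (k ^ j) = sqrt (k ^ j)" using that by (simp add: real_div_sqrt)
    have e: "k ^ n / sqrt (k ^ (n - 2)) = k * k * (k ^ j / sqrt (k ^ j))"
      "k ^ (n - 1) / sqrt (k ^ (n - 2)) = k * (k ^ j / sqrt (k ^ j))" by (simp_all add: n)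
    have "sqrt (k ^ (n + 2)) = k * k * sqrt (k ^ j)"
    proof -
      have "k ^ (n + 2) = (k * k)\<^sup>2 * k ^ j" by (simp add: n power_add eval_nat_numeral)
      then show ?thesis using that by (simp add: real_sqrt_mult)
    qed
    moreover have "sqrt (k ^ n) = k * sqrt (k ^ j)"
      using that by (simp add: n real_sqrt_mult power_add)
    ultimately show "k ^ n / sqrt (k ^ (n - 2)) = sqrt (k ^ (n + 2))"
      "k ^ (n - 1) / sqrt (k ^ (n - 2)) = sqrt (k ^ n)"
      unfolding e s by simp_all
  qed
  have bound1: "norm (of_real (a B) * E B) \<le> A * L * sqrt (m ^ (n + 2))"
  proof -
    have "norm (of_real (a B) * E B) \<le> (A * B ^ n) * (L / sqrt (B ^ (n - 2)))"
      unfolding norm_mult norm_of_real using a_le[of B] E[of B] assms(1,2,5)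
      by (intro mult_mono) auto
    also have "\<dots> = A * L * sqrt (B ^ (n + 2))" unfolding sq(1)[OF assms(1), symmetric] by simp
    also have "\<dots> \<le> A * L * sqrt (m ^ (n + 2))"
      using assms(1,2,5) L by (intro mult_left_mono real_sqrt_le_mono power_mono) auto
    finally show ?thesis .
  qed
  have bound2: "norm (- (of_real (a B) * E B) + integral {B..m} (\<lambda>k. of_real (a k) * cis (\<phi> k)))
      \<le> A * L * sqrt (m ^ n) * (m - B)"
  proof -
    have "norm (of_real (a' k) * E k) \<le> A * L * sqrt (m ^ n)" if k: "k \<in> {B..m}" for k
    proof -
      have k1: "k \<ge> 1" using k assms(1) by auto
      have "norm (of_real (a' k) * E k) \<le> (A * k ^ (n - 1)) * (L / sqrt (k ^ (n - 2)))"
        unfolding norm_mult norm_of_real using a'_le[OF k] E[OF k] k1 assms(5)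
        by (intro mult_mono) auto
      also have "\<dots> = A * L * sqrt (k ^ n)" unfolding sq(2)[OF k1, symmetric] by simp
      also have "\<dots> \<le> A * L * sqrt (m ^ n)"
        using k k1 assms(5) L by (intro mult_left_mono real_sqrt_le_mono power_mono) auto
      finally show ?thesis .
    qed
    then show ?thesis
      using has_integral_bound[OF _ GI[folded cbox_interval], of "A * L * sqrt (m ^ n)"] assms L by (auto simp: content_real)
  qed
  have "A * L * sqrt (m ^ n) * (m - B) \<le> A * L * sqrt (m ^ n) * m"
    using assms L by (intro mult_left_mono) auto
  also have "\<dots> = A * L * sqrt (m ^ (n + 2))"
    using assms(1,2) by (simp add: power_add real_sqrt_mult)
  finally have bound3: "A * L * sqrt (m ^ n) * (m - B) \<le> A * L * sqrt (m ^ (n + 2))" .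
  have "norm (integral {B..m} (\<lambda>k. of_real (a k) * cis (\<phi> k)))
      \<le> norm (- (of_real (a B) * E B) + integral {B..m} (\<lambda>k. of_real (a k) * cis (\<phi> k)))
        + norm (of_real (a B) * E B)"
    using norm_triangle_ineq[of "- (of_real (a B) * E B) + integral {B..m} (\<lambda>k. of_real (a k) * cis (\<phi> k))" "of_real (a B) * E B"]
    by simp
  also have "\<dots> \<le> A * L * sqrt (m ^ (n + 2)) + A * L * sqrt (m ^ (n + 2))"
    using bound1 bound2 bound3 by linarith
  finally show ?thesis by (simp add: L_def field_simps)
qed

text \<open>Two integrations by parts: an amplitude of order \<open>k ^ n\<close> against a phase derivative of order
  \<open>k ^ (n - 1)\<close> leaves an integrand of order \<open>1 / k ^ n\<close>.\<close>

lemma oscillatory_tail: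
  fixes \<phi> p p' p'' a a' a'' :: "real \<Rightarrow> real" and b :: complex
  assumes "1 \<le> N" "N \<le> R" "2 \<le> n" "0 < c" "0 \<le> A" "0 \<le> C"
    and \<phi>: "\<And>k. k \<in> {N..R} \<Longrightarrow> (\<phi> has_real_derivative p k) (at k)"
    and p: "\<And>k. k \<in> {N..R} \<Longrightarrow> (p has_real_derivative p' k) (at k)"
    and p': "\<And>k. k \<in> {N..R} \<Longrightarrow> (p' has_real_derivative p'' k) (at k)"
    and a: "\<And>k. k \<in> {N..R} \<Longrightarrow> (a has_real_derivative a' k) (at k)"
    and a': "\<And>k. k \<in> {N..R} \<Longrightarrow> (a' has_real_derivative a'' k) (at k)"
    and p_ge: "\<And>k. k \<in> {N..R} \<Longrightarrow> c * k ^ (n - 1) \<le> \<bar>p k\<bar>"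
    and p'_le: "\<And>k. k \<in> {N..R} \<Longrightarrow> \<bar>p' k\<bar> \<le> C * k ^ (n - 1) / k"
    and p''_le: "\<And>k. k \<in> {N..R} \<Longrightarrow> \<bar>p'' k\<bar> \<le> C * k ^ (n - 1) / k\<^sup>2"
    and a_le: "\<And>k. k \<in> {N..R} \<Longrightarrow> \<bar>a k\<bar> \<le> A * k ^ n"
    and a'_le: "\<And>k. k \<in> {N..R} \<Longrightarrow> \<bar>a' k\<bar> \<le> A * k ^ (n - 1)"
    and a''_le: "\<And>k. k \<in> {N..R} \<Longrightarrow> \<bar>a'' k\<bar> \<le> A * k ^ (n - 1) / k"
    and aR: "a R = 0" "a' R = 0"
    and b: "b = - \<i> * of_real (a N / p N) + of_real (a' N / (p N)\<^sup>2 - a N * p' N / (p N) ^ 3)"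
  shows "norm (integral {N..R} (\<lambda>k. of_real (a k) * cis (\<phi> k)) + b * cis (\<phi> N))
           \<le> (A / c\<^sup>2 + 4 * A * C / c ^ 3 + 3 * A * C\<^sup>2 / c ^ 4) / N"
proof -
  define M where "M = A / c\<^sup>2 + 4 * A * C / c ^ 3 + 3 * A * C\<^sup>2 / c ^ 4"
  have M: "M \<ge> 0" unfolding M_def using assms(4-6) by simp
  define q where "q k = inverse (p k)" for k
  have pos: "k > 0" "k \<ge> 1" if "k \<in> {N..R}" for k using that assms(1) by auto
  have pn0: "p k \<noteq> 0" if "k \<in> {N..R}" for k
    using p_ge[OF that] pos[OF that] \<open>0 < c\<close> by (metis abs_zero less_le_not_le mult_pos_pos zero_less_power)
  have q: "(q has_real_derivative - p' k * (q k)\<^sup>2) (at k)" if "k \<in> {N..R}" for k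
    unfolding q_def using p[OF that] pn0[OF that]
    by (auto intro!: derivative_eq_intros simp: power2_eq_square)
  \<comment> \<open>Both integrations by parts at once: \<open>- \<i> * a * q\<close> satisfies
    \<open>\<i> * p * u = a\<close> and leaves its own derivative as an error; the real part of
    \<open>u\<close> is chosen to cancel that error. The derivative \<open>w\<close> of this real
    part is all that remains.\<close>
  define u where "u k = - \<i> * of_real (a k * q k) + of_real (a' k * (q k)\<^sup>2 - a k * p' k * (q k) ^ 3)" for k
  define w where "w k = a'' k * (q k)\<^sup>2 - 3 * a' k * p' k * (q k) ^ 3 - a k * p'' k * (q k) ^ 3
      + 3 * a k * (p' k)\<^sup>2 * (q k) ^ 4" for k
  define u' where "u' k = - \<i> * of_real (a' k * q k - a k * p' k * (q k)\<^sup>2) + of_real (w k)" for k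
  have u: "(u has_vector_derivative u' k) (at k)" if k: "k \<in> {N..R}" for k
  proof -
    have 1: "((\<lambda>k. a k * q k) has_real_derivative (a' k * q k - a k * p' k * (q k)\<^sup>2)) (at k)"
      using a[OF k] q[OF k] by (auto intro!: derivative_eq_intros simp: algebra_simps)
    have 2: "((\<lambda>k. a' k * (q k)\<^sup>2 - a k * p' k * (q k) ^ 3) has_real_derivative w k) (at k)"
      using a[OF k] a'[OF k] p'[OF k] q[OF k] unfolding w_def
      by (auto intro!: derivative_eq_intros simp: algebra_simps power2_eq_square power3_eq_cube power4_eq_xxxx)
    show ?thesis unfolding u_def u'_def
      by (intro has_vector_derivative_add has_vector_derivative_mult_right has_vector_derivative_of_real 1 2)
  qed
  have eq: "\<i> * of_real (p k) * u k + u' k = of_real (a k + w k)" if k: "k \<in> {N..R}" for k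
  proof -
    have pq: "p k * q k = 1" using pn0[OF k] by (simp add: q_def)
    have e: "p k * (a k * q k) = a k" "p k * (a' k * (q k)\<^sup>2 - a k * p' k * (q k) ^ 3) = a' k * q k - a k * p' k * (q k)\<^sup>2"
      using pq by algebra+
    have "\<i> * of_real (p k) * u k = of_real (p k * (a k * q k)) + \<i> * of_real (p k * (a' k * (q k)\<^sup>2 - a k * p' k * (q k) ^ 3))"
      by (simp add: u_def algebra_simps)
    then show ?thesis unfolding e u'_def by simp
  qed
  have I1: "((\<lambda>k. of_real (a k + w k) * cis (\<phi> k)) has_integral (u R * cis (\<phi> R) - u N * cis (\<phi> N))) {N..R}"
    using oscillatory_by_parts[OF \<open>N \<le> R\<close> \<phi> u] by (rule has_integral_eq[rotated]) (simp_all add: eq)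
  have uR: "u R = 0" and uN: "u N = b"
    using aR by (simp_all add: u_def b q_def divide_inverse power_inverse)
  have I2: "((\<lambda>k. of_real (a k) * cis (\<phi> k)) has_integral
      integral {N..R} (\<lambda>k. of_real (a k) * cis (\<phi> k))) {N..R}"
    by (intro integrable_integral integrable_continuous_real continuous_intros
        continuous_at_imp_continuous_on ballI DERIV_isCont[OF \<phi>] DERIV_isCont[OF a])
  have I3: "((\<lambda>k. of_real (w k) * cis (\<phi> k)) has_integral
      - (integral {N..R} (\<lambda>k. of_real (a k) * cis (\<phi> k)) + b * cis (\<phi> N))) {N..R}"
    using has_integral_diff[OF I1 I2] by (simp add: uR uN algebra_simps)
  have w_le: "norm (of_real (w k) * cis (\<phi> k)) \<le> M * (1 / k\<^sup>2)" if k: "k \<in> {N..R}" for k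
  proof -
    define s where "s = k ^ (n - 1)"
    have s: "s > 0" using pos[OF k] by (simp add: s_def)
    have ks: "k * s = k ^ n" using \<open>2 \<le> n\<close> by (simp add: s_def flip: power_Suc)
    have q_le: "\<bar>q k\<bar> \<le> 1 / (c * s)"
      using p_ge[OF k] s \<open>0 < c\<close> pn0[OF k] by (simp add: q_def s_def divide_inverse le_imp_inverse_le flip: inverse_mult_distrib)
    note bd = a_le[OF k, folded ks] a'_le[OF k, folded s_def] a''_le[OF k, folded s_def]
      p'_le[OF k, folded s_def] p''_le[OF k, folded s_def]
    note nn = s pos[OF k] assms(4-6)
    have t1: "\<bar>a'' k\<bar> * \<bar>q k\<bar> ^ 2 \<le> (A * s / k) * (1 / (c * s)) ^ 2"
      using bd q_le nn by (intro mult_mono power_mono) auto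
    have t2: "\<bar>a' k\<bar> * \<bar>p' k\<bar> * \<bar>q k\<bar> ^ 3 \<le> (A * s) * (C * s / k) * (1 / (c * s)) ^ 3"
      using bd q_le nn by (intro mult_mono power_mono) auto
    have t3: "\<bar>a k\<bar> * \<bar>p'' k\<bar> * \<bar>q k\<bar> ^ 3 \<le> (A * (k * s)) * (C * s / k\<^sup>2) * (1 / (c * s)) ^ 3"
      using bd q_le nn by (intro mult_mono power_mono) auto
    have t4: "\<bar>a k\<bar> * \<bar>p' k\<bar>\<^sup>2 * \<bar>q k\<bar> ^ 4 \<le> (A * (k * s)) * (C * s / k)\<^sup>2 * (1 / (c * s)) ^ 4"
      using bd q_le nn by (intro mult_mono power_mono) auto
    have "\<bar>w k\<bar> \<le> \<bar>a'' k\<bar> * \<bar>q k\<bar> ^ 2 + 3 * (\<bar>a' k\<bar> * \<bar>p' k\<bar> * \<bar>q k\<bar> ^ 3) + \<bar>a k\<bar> * \<bar>p'' k\<bar> * \<bar>q k\<bar> ^ 3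
        + 3 * (\<bar>a k\<bar> * \<bar>p' k\<bar>\<^sup>2 * \<bar>q k\<bar> ^ 4)"
    proof -
      have tri: "\<bar>x - y - z + v\<bar> \<le> \<bar>x\<bar> + \<bar>y\<bar> + \<bar>z\<bar> + \<bar>v\<bar>" for x y z v :: real by linarith
      show ?thesis
        unfolding w_def by (rule order_trans[OF tri]) (simp add: abs_mult power_abs)
    qed
    also have "\<dots> \<le> (A * s / k) * (1 / (c * s)) ^ 2 + 3 * ((A * s) * (C * s / k) * (1 / (c * s)) ^ 3)
        + (A * (k * s)) * (C * s / k\<^sup>2) * (1 / (c * s)) ^ 3
        + 3 * ((A * (k * s)) * (C * s / k)\<^sup>2 * (1 / (c * s)) ^ 4)"
      using t1 t2 t3 t4 by (intro add_mono mult_left_mono) auto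
    \<comment> \<open>With \<open>s = k ^ (n - 1)\<close> all four terms have order
      \<open>1 / (k * s)\<close>. The coefficient 4 in \<open>M\<close> collects the terms with
      \<open>a' * p'\<close> (three times) and \<open>a * p''\<close> (once).\<close>
    also have "\<dots> = M * (1 / (k * s))"
      unfolding M_def using nn by (simp add: divide_simps) algebra
    also have "\<dots> \<le> M * (1 / k\<^sup>2)"
      unfolding ks using M pos[OF k] \<open>2 \<le> n\<close>
      by (intro mult_left_mono divide_left_mono power_increasing) auto
    finally show ?thesis by (simp add: norm_mult)
  qed
  have I4: "((\<lambda>k. M * (1 / k\<^sup>2)) has_integral M * (1 / N - 1 / R)) {N..R}"
  proof (rule has_integral_mult_right)
    have "((\<lambda>k. 1 / k\<^sup>2) has_integral (- (1 / R) - - (1 / N))) {N..R}"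
    proof (rule fundamental_theorem_of_calculus[OF \<open>N \<le> R\<close>])
      fix k assume k: "k \<in> {N..R}"
      then have "((\<lambda>k. - (1 / k)) has_real_derivative 1 / k\<^sup>2) (at k)"
        using pos[OF k] by (auto intro!: derivative_eq_intros simp: power2_eq_square)
      then show "((\<lambda>k. - (1 / k)) has_vector_derivative 1 / k\<^sup>2) (at k within {N..R})"
        by (simp add: has_real_derivative_iff_has_vector_derivative has_vector_derivative_at_within)
    qed
    then show "((\<lambda>k. 1 / k\<^sup>2) has_integral (1 / N - 1 / R)) {N..R}" by simp
  qed
  have "norm (integral {N..R} (\<lambda>k. of_real (w k) * cis (\<phi> k))) \<le> integral {N..R} (\<lambda>k. M * (1 / k\<^sup>2))"
    using w_le by (rule integral_norm_bound_integral[OF has_integral_integrable[OF I3] has_integral_integrable[OF I4]])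
  then have "norm (integral {N..R} (\<lambda>k. of_real (a k) * cis (\<phi> k)) + b * cis (\<phi> N)) \<le> M * (1 / N - 1 / R)"
    unfolding integral_unique[OF I3] integral_unique[OF I4] norm_minus_cancel .
  also have "\<dots> \<le> M * (1 / N)" using M assms(1,2) by (intro mult_left_mono) auto
  finally show ?thesis unfolding M_def by simp
qed

section \<open>Cutoff functions and growth of polynomials\<close>

text \<open>The double zero at \<open>\<bar>k\<bar> = R\<close> removes the boundary terms of two integrations by parts; with a
  sharp cutoff these diverge for \<open>j = n\<close>.\<close>

definition cutoff :: "real \<Rightarrow> nat \<Rightarrow> real \<Rightarrow> real" where
  "cutoff R j k = k ^ j * (1 - (k / R)\<^sup>2)\<^sup>2"

text \<open>The truncated exponent \<open>j - 1\<close> does no harm at \<open>j = 0\<close>,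
  because the factor \<open>real j\<close> vanishes there. Expanding into explicit monomials allows
  each term to be compared with a power of k separately.\<close>

definition cutoff' :: "real \<Rightarrow> nat \<Rightarrow> real \<Rightarrow> real" where
  "cutoff' R j k = real j * k ^ (j - 1) * (1 - (k / R)\<^sup>2)\<^sup>2 - 4 * (k ^ (j + 1) / R ^ 2) * (1 - (k / R)\<^sup>2)"

definition cutoff'' :: "real \<Rightarrow> nat \<Rightarrow> real \<Rightarrow> real" where
  "cutoff'' R j k = real j * real (j - 1) * k ^ (j - 2) * (1 - (k / R)\<^sup>2)\<^sup>2
     - 4 * (2 * real j + 1) * (k ^ j / R ^ 2) * (1 - (k / R)\<^sup>2) + 8 * (k ^ (j + 2) / R ^ 4)"

lemma DERIV_cutoff:
  assumes "R > 0"
  shows "(cutoff R j has_real_derivative cutoff' R j k) (at k)"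
  unfolding cutoff_def[abs_def] cutoff'_def using assms
  by (auto intro!: derivative_eq_intros simp: power2_eq_square)

lemma DERIV_cutoff':
  assumes "R > 0"
  shows "(cutoff' R j has_real_derivative cutoff'' R j k) (at k)"
proof -
  have e: "real j * (k * k ^ (j - 1)) = real j * k ^ j" by (cases j) auto
  have "((\<lambda>k. 1 - (k / R)\<^sup>2) has_real_derivative - 2 * k / R\<^sup>2) (at k)"
    using assms by (auto intro!: derivative_eq_intros simp: power2_eq_square)
  note v = this
  have 1: "((\<lambda>k. real j * k ^ (j - 1) * (1 - (k / R)\<^sup>2)\<^sup>2) has_real_derivative
     real j * real (j - 1) * k ^ (j - 2) * (1 - (k / R)\<^sup>2)\<^sup>2 - 4 * (real j * (k ^ j / R ^ 2)) * (1 - (k / R)\<^sup>2)) (at k)"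
    using assms
    by (auto intro!: derivative_eq_intros v simp: e[symmetric] diff_diff_left numeral_2_eq_2[symmetric])
       (auto simp: algebra_simps power2_eq_square)
  have 2: "((\<lambda>k. 4 * (k ^ (j + 1) / R ^ 2) * (1 - (k / R)\<^sup>2)) has_real_derivative
     4 * ((real j + 1) * (k ^ j / R ^ 2)) * (1 - (k / R)\<^sup>2) - 8 * (k ^ (j + 2) / R ^ 4)) (at k)"
  proof -
    have "((\<lambda>k. 4 * (k ^ (j + 1) / R ^ 2)) has_real_derivative 4 * ((real j + 1) * k ^ j / R ^ 2)) (at k)"
      using DERIV_pow[of "j + 1" k] by (intro DERIV_cmult DERIV_cdivide) (simp add: add.commute)
    from DERIV_mult[OF this v] show ?thesis
      by (rule DERIV_cong) (simp add: power2_eq_square power4_eq_xxxx)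
  qed
  show ?thesis
    unfolding cutoff'_def[abs_def]
    by (rule DERIV_cong[OF DERIV_diff[OF 1 2]]) (simp add: cutoff''_def algebra_simps add_divide_distrib diff_divide_distrib)
qed

lemma cutoff_at_end: "R > 0 \<Longrightarrow> cutoff R j R = 0" "R > 0 \<Longrightarrow> cutoff' R j R = 0"
  by (simp_all add: cutoff_def cutoff'_def)

lemma cutoff_factor_bounds:
  assumes "\<bar>k\<bar> \<le> R" "R > 0"
  shows "0 \<le> 1 - (k / R)\<^sup>2" "1 - (k / R)\<^sup>2 \<le> (1::real)"
  using assms abs_square_le_1[of "k / R"] by auto

lemma cutoff_minus: "cutoff R j (- k) = (-1) ^ j * cutoff R j k"
  by (simp add: cutoff_def power_minus[of k])

text \<open>A derivative that falls on the cutoff factor costs a power of \<open>1 / R\<close>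
  instead of \<open>1 / k\<close>, and this is no worse since \<open>k \<le> R\<close>. It makes the
  bounds on \<open>cutoff\<close>, \<open>cutoff'\<close> and \<open>cutoff''\<close> independent of
  R.\<close>

lemma power_div_le_power:
  fixes k R :: real
  assumes "1 \<le> k" "k \<le> R" "i \<le> m + d"
  shows "k ^ i / R ^ d \<le> k ^ m"
proof -
  have "k ^ i \<le> k ^ (m + d)" using assms by (intro power_increasing) auto
  also have "\<dots> \<le> k ^ m * R ^ d"
    unfolding power_add using assms by (intro mult_left_mono power_mono) auto
  finally show ?thesis using assms by (simp add: divide_le_eq)
qed

lemma cutoff_bounds:
  fixes k R :: real
  assumes "1 \<le> k" "k \<le> R" "j \<le> n" "2 \<le> n"
  defines "A \<equiv> 4 * (real n + 4)\<^sup>2"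
  shows "\<bar>cutoff R j k\<bar> \<le> A * k ^ n"
    "\<bar>cutoff' R j k\<bar> \<le> A * k ^ (n - 1)"
    "\<bar>cutoff'' R j k\<bar> \<le> A * k ^ (n - 1) / k"
proof -
  define v where "v = 1 - (k / R)\<^sup>2"
  have v: "0 \<le> v" "v \<le> 1" "v\<^sup>2 \<le> 1"
    using cutoff_factor_bounds[of k R] assms by (auto simp: v_def power_le_one)
  have jn: "real j \<le> real n" "real (j - 1) \<le> real n" using assms by auto
  \<comment> \<open>One generous constant majorises the coefficient sums of all three
    bounds.\<close>
  have A: "A \<ge> 1" "A \<ge> real n + 4" "A \<ge> real n * real n + 4 * (2 * real n + 1) + 8"
    unfolding A_def power2_eq_square by (auto simp: algebra_simps)
  have k: "k > 0" using assms by auto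
  have "k ^ j * v\<^sup>2 \<le> k ^ n * 1"
    using assms v k by (intro mult_mono power_increasing) auto
  also have "\<dots> \<le> A * k ^ n" using A k by simp
  finally show "\<bar>cutoff R j k\<bar> \<le> A * k ^ n"
    using k by (simp add: cutoff_def v_def)
  have "real j * k ^ (j - 1) * v\<^sup>2 \<le> real n * k ^ (n - 1) * 1"
    using assms v k jn by (intro mult_mono power_increasing) auto
  moreover have "4 * (k ^ (j + 1) / R ^ 2) * v \<le> 4 * k ^ (n - 1) * 1"
    using assms v k by (intro mult_mono power_div_le_power) auto
  moreover have "0 \<le> real j * k ^ (j - 1) * v\<^sup>2" "0 \<le> 4 * (k ^ (j + 1) / R ^ 2) * v"
    using v k by auto
  ultimately have "\<bar>cutoff' R j k\<bar> \<le> (real n + 4) * k ^ (n - 1)"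
    unfolding cutoff'_def v_def[symmetric] by (simp add: algebra_simps)
  also have "\<dots> \<le> A * k ^ (n - 1)" using A k by (intro mult_right_mono) auto
  finally show "\<bar>cutoff' R j k\<bar> \<le> A * k ^ (n - 1)" .
  have "real j * real (j - 1) * k ^ (j - 2) * v\<^sup>2 \<le> real n * real n * k ^ (n - 2) * 1"
    using assms v k jn by (intro mult_mono power_increasing) auto
  moreover have "4 * (2 * real j + 1) * (k ^ j / R ^ 2) * v \<le> 4 * (2 * real n + 1) * k ^ (n - 2) * 1"
    using assms v k jn by (intro mult_mono power_div_le_power) auto
  moreover have "8 * (k ^ (j + 2) / R ^ 4) \<le> 8 * k ^ (n - 2)"
    using assms by (intro mult_mono power_div_le_power) auto
  moreover have "0 \<le> real j * real (j - 1) * k ^ (j - 2) * v\<^sup>2"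
    "0 \<le> 4 * (2 * real j + 1) * (k ^ j / R ^ 2) * v" "0 \<le> 8 * (k ^ (j + 2) / R ^ 4)"
    using v k assms by auto
  ultimately have "\<bar>cutoff'' R j k\<bar> \<le> real n * real n * k ^ (n - 2)
      + 4 * (2 * real n + 1) * k ^ (n - 2) + 8 * k ^ (n - 2)"
    unfolding cutoff''_def v_def[symmetric] by linarith
  also have "\<dots> = (real n * real n + 4 * (2 * real n + 1) + 8) * k ^ (n - 2)"
    by (simp add: algebra_simps)
  also have "\<dots> \<le> A * k ^ (n - 2)" using A(3) k by (intro mult_right_mono) auto
  also have "k ^ (n - 2) = k ^ (n - 1) / k"
    using \<open>2 \<le> n\<close> k by (cases n rule: nat.exhaust; cases "n - 1") (auto simp: Suc_diff_Suc)
  finally show "\<bar>cutoff'' R j k\<bar> \<le> A * k ^ (n - 1) / k" by simp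
qed

lemma cutoff_le_power: "\<bar>k\<bar> \<le> R \<Longrightarrow> R > 0 \<Longrightarrow> \<bar>cutoff R j k\<bar> \<le> \<bar>k\<bar> ^ j"
  using cutoff_factor_bounds[of k R]
  by (auto simp: cutoff_def abs_mult power_abs intro!: mult_left_le power_le_one)

text \<open>On a fixed interval the cutoff disappears at rate \<open>1 / R ^ 2\<close>. The
  derivative is needed only at the endpoint \<open>N\<close>, where it enters the boundary term of
  the tail; the exponent \<open>n + 2\<close> makes the bounds uniform in j.\<close>

lemma cutoff_approx:
  assumes "\<bar>k\<bar> \<le> N" "1 \<le> N" "N \<le> R" "j \<le> n"
  shows "\<bar>cutoff R j k - k ^ j\<bar> \<le> 2 * N ^ (n + 2) / R\<^sup>2"
    "\<bar>cutoff' R j N - real j * N ^ (j - 1)\<bar> \<le> (2 * real n + 4) * N ^ (n + 2) / R\<^sup>2"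
proof -
  have 1: "\<bar>(1 - (k / R)\<^sup>2)\<^sup>2 - 1\<bar> \<le> 2 * (k\<^sup>2 / R\<^sup>2)" if "\<bar>k\<bar> \<le> N" for k
  proof -
    define s where "s = (k / R)\<^sup>2"
    have "0 \<le> s" "s \<le> 1" using cutoff_factor_bounds[of k R] that assms by (auto simp: s_def)
    then have "\<bar>s * s - 2 * s\<bar> \<le> 2 * s" using mult_left_le[of s s] by (auto simp: abs_le_iff)
    then show ?thesis unfolding s_def[symmetric] power_divide[symmetric]
      by (simp add: power2_eq_square algebra_simps)
  qed
  have e: "N ^ i \<le> N ^ m" if "i \<le> m" for i m using that assms by (intro power_increasing) auto
  have "\<bar>cutoff R j k - k ^ j\<bar> = \<bar>k\<bar> ^ j * \<bar>(1 - (k / R)\<^sup>2)\<^sup>2 - 1\<bar>"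
    by (simp add: cutoff_def power_abs[symmetric] right_diff_distrib abs_mult[symmetric])
  also have "\<dots> \<le> N ^ j * (2 * (N\<^sup>2 / R\<^sup>2))"
    using assms by (intro mult_mono power_mono order_trans[OF 1]) (auto intro!: mult_left_mono divide_right_mono simp: abs_le_square_iff[symmetric])
  also have "\<dots> = 2 * N ^ (j + 2) / R\<^sup>2" by (simp add: power_add power2_eq_square)
  also have "\<dots> \<le> 2 * N ^ (n + 2) / R\<^sup>2"
    using assms by (intro divide_right_mono mult_left_mono e) auto
  finally show "\<bar>cutoff R j k - k ^ j\<bar> \<le> 2 * N ^ (n + 2) / R\<^sup>2" .
  have "\<bar>cutoff' R j N - real j * N ^ (j - 1)\<bar>
      = \<bar>real j * N ^ (j - 1) * ((1 - (N / R)\<^sup>2)\<^sup>2 - 1) - 4 * (N ^ (j + 1) / R ^ 2) * (1 - (N / R)\<^sup>2)\<bar>"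
    by (simp add: cutoff'_def algebra_simps)
  also have "\<dots> \<le> \<bar>real j * N ^ (j - 1) * ((1 - (N / R)\<^sup>2)\<^sup>2 - 1)\<bar> + \<bar>4 * (N ^ (j + 1) / R ^ 2) * (1 - (N / R)\<^sup>2)\<bar>"
    by (rule abs_triangle_ineq4)
  also have "\<bar>real j * N ^ (j - 1) * ((1 - (N / R)\<^sup>2)\<^sup>2 - 1)\<bar> = real j * N ^ (j - 1) * \<bar>(1 - (N / R)\<^sup>2)\<^sup>2 - 1\<bar>"
    using assms by (simp add: abs_mult)
  also have "\<dots> \<le> real n * N ^ n * (2 * (N\<^sup>2 / R\<^sup>2))"
    using assms by (intro mult_mono e 1) auto
  also have "\<bar>4 * (N ^ (j + 1) / R ^ 2) * (1 - (N / R)\<^sup>2)\<bar> \<le> 4 * (N ^ (n + 2) / R\<^sup>2) * 1"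
    unfolding abs_mult using assms cutoff_factor_bounds[of N R]
    by (intro mult_mono) (auto intro!: divide_right_mono e simp del: power_Suc)
  also have "real n * N ^ n * (2 * (N\<^sup>2 / R\<^sup>2)) + 4 * (N ^ (n + 2) / R\<^sup>2) * 1 = (2 * real n + 4) * N ^ (n + 2) / R\<^sup>2"
    by (simp add: power_add power2_eq_square add_divide_distrib algebra_simps)
  finally show "\<bar>cutoff' R j N - real j * N ^ (j - 1)\<bar> \<le> (2 * real n + 4) * N ^ (n + 2) / R\<^sup>2" by simp
qed

lemma continuous_on_cutoff [continuous_intros]:
  "continuous_on S f \<Longrightarrow> continuous_on S (\<lambda>x. cutoff R j (f x))"
  unfolding cutoff_def divide_inverse by (intro continuous_intros)

section \<open>Growth and eventual sign of real polynomials\<close>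

lemma poly_upper_growth:
  fixes q :: "real poly"
  obtains C where "0 \<le> C" "\<And>k. 1 \<le> k \<Longrightarrow> \<bar>poly q k\<bar> \<le> C * k ^ degree q"
proof
  show "0 \<le> (\<Sum>i\<le>degree q. \<bar>coeff q i\<bar>)" by (intro sum_nonneg) auto
  fix k :: real assume k: "1 \<le> k"
  have "\<bar>poly q k\<bar> \<le> (\<Sum>i\<le>degree q. \<bar>coeff q i\<bar> * k ^ i)"
    unfolding poly_altdef using k by (intro order_trans[OF sum_abs] sum_mono) (auto simp: abs_mult)
  also have "\<dots> \<le> (\<Sum>i\<le>degree q. \<bar>coeff q i\<bar> * k ^ degree q)"
    using k by (intro sum_mono mult_left_mono power_increasing) auto
  finally show "\<bar>poly q k\<bar> \<le> (\<Sum>i\<le>degree q. \<bar>coeff q i\<bar>) * k ^ degree q"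
    by (simp add: sum_distrib_right)
qed

lemma poly_lower_growth_pos:
  fixes q :: "real poly"
  assumes "lead_coeff q > 0"
  obtains B where "1 \<le> B" "\<And>k. B \<le> k \<Longrightarrow> lead_coeff q / 2 * k ^ degree q \<le> poly q k"
proof -
  have "((\<lambda>x. poly q x / x ^ degree q) \<longlongrightarrow> lead_coeff q) at_top"
    by (rule filterlim_mono[OF poly_divide_tendsto_aux order_refl at_top_le_at_infinity])
  then have "eventually (\<lambda>x. lead_coeff q / 2 < poly q x / x ^ degree q) at_top"
    using assms by (intro order_tendstoD(1)) auto
  then obtain B where B: "\<And>x. x \<ge> B \<Longrightarrow> lead_coeff q / 2 < poly q x / x ^ degree q"
    unfolding eventually_at_top_linorder by blast
  show ?thesis
  proof (rule that[of "max 1 B"])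
    fix k assume "max 1 B \<le> k"
    then show "lead_coeff q / 2 * k ^ degree q \<le> poly q k"
      using B[of k] by (auto simp: less_divide_eq dest: less_imp_le)
  qed auto
qed

text \<open>The quotient by the leading power tends to the leading coefficient, so half of that
  coefficient is eventually a bound. The disjunction stands outside the quantifiers to record that
  the sign is eventually constant, as the second derivative test requires.\<close>

lemma poly_lower_growth:
  fixes q :: "real poly"
  assumes "q \<noteq> 0"
  obtains B c where "1 \<le> B" "0 < c"
    "(\<forall>k\<ge>B. c * k ^ degree q \<le> poly q k) \<or> (\<forall>k\<ge>B. c * k ^ degree q \<le> - poly q k)"
proof (cases "lead_coeff q > 0")
  case True
  from poly_lower_growth_pos[OF this] True that[of _ "lead_coeff q / 2"] show ?thesis
    by (metis half_gt_zero_iff)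
next
  case False
  then have "lead_coeff (- q) > 0" using assms by (simp add: less_le)
  from poly_lower_growth_pos[OF this] obtain B where
    "1 \<le> B" "\<And>k. B \<le> k \<Longrightarrow> - lead_coeff q / 2 * k ^ degree q \<le> - poly q k" by auto
  then show ?thesis using that[of B "- lead_coeff q / 2"] \<open>lead_coeff (- q) > 0\<close> by auto
qed

section \<open>Kernel estimates\<close>

text \<open>Only a half-line is taken because the second derivative of p may have opposite signs
  near the two infinities.\<close>

definition half_osc :: "real poly \<Rightarrow> real \<Rightarrow> nat \<Rightarrow> real \<Rightarrow> real \<Rightarrow> complex" where
  "half_osc p R j z t = integral {0..R} (\<lambda>k. of_real (cutoff R j k) * cis (k * z - poly p k * t))"

text \<open>Beyond \<open>B\<close> the derivatives of p are controlled by their expected leading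
  powers. Times range over a compact interval away from 0, so that every constant derived here is
  uniform in t.\<close>

locale half_line_phase =
  fixes p :: "real poly" and n :: nat and B c C t1 t2 :: real
  assumes n: "2 \<le> n" and B: "1 \<le> B" and c: "0 < c" and C: "0 \<le> C" and t1: "0 < t1" and t12: "t1 \<le> t2"
    and p1_ge: "\<And>k. B \<le> k \<Longrightarrow> c * k ^ (n - 1) \<le> \<bar>poly (pderiv p) k\<bar>"
    and p2_le: "\<And>k. B \<le> k \<Longrightarrow> \<bar>poly (pderiv (pderiv p)) k\<bar> \<le> C * k ^ (n - 1) / k"
    and p3_le: "\<And>k. B \<le> k \<Longrightarrow> \<bar>poly (pderiv (pderiv (pderiv p))) k\<bar> \<le> C * k ^ (n - 1) / k\<^sup>2"
    and p2_ge: "(\<forall>k\<ge>B. c * k ^ (n - 2) \<le> poly (pderiv (pderiv p)) k)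
      \<or> (\<forall>k\<ge>B. c * k ^ (n - 2) \<le> - poly (pderiv (pderiv p)) k)"
begin

abbreviation phase :: "real \<Rightarrow> real \<Rightarrow> real \<Rightarrow> real" where
  "phase z t k \<equiv> k * z - poly p k * t"

text \<open>The boundary term \<open>b\<close> of \<open>oscillatory_tail\<close> for this phase,
  with \<alpha> and \<beta> in the roles of the amplitude and its derivative at \<open>N\<close>.
  Keeping them as parameters exposes the linearity used to compare two cutoffs.\<close>

definition endpoint :: "real \<Rightarrow> real \<Rightarrow> real \<Rightarrow> real \<Rightarrow> real \<Rightarrow> complex" where
  "endpoint \<alpha> \<beta> N z t = - \<i> * of_real (\<alpha> / (z - poly (pderiv p) N * t))
     + of_real (\<beta> / (z - poly (pderiv p) N * t)\<^sup>2
         - \<alpha> * (- poly (pderiv (pderiv p)) N * t) / (z - poly (pderiv p) N * t) ^ 3)"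

lemma endpoint_diff:
  "endpoint \<alpha> \<beta> N z t - endpoint \<alpha>' \<beta>' N z t = endpoint (\<alpha> - \<alpha>') (\<beta> - \<beta>') N z t"
  by (simp add: endpoint_def diff_divide_distrib algebra_simps)

lemma DERIV_phase: "(phase z t has_real_derivative (z - poly (pderiv p) k * t)) (at k)"
  "((\<lambda>k. z - poly (pderiv p) k * t) has_real_derivative (- poly (pderiv (pderiv p)) k * t)) (at k)"
  "((\<lambda>k. - poly (pderiv (pderiv p)) k * t) has_real_derivative (- poly (pderiv (pderiv (pderiv p))) k * t)) (at k)"
  by (auto intro!: derivative_eq_intros poly_DERIV)

text \<open>The term \<open>poly (pderiv p) k * t\<close> has size at least
  \<open>t1 * c * k ^ (n - 1)\<close>. If z uses up at most half of this, the other half remains, so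
  k is beyond the stationary point.\<close>

lemma phase_bounds:
  assumes "B \<le> k" "t1 \<le> t" "t \<le> t2"
  shows "\<bar>z\<bar> \<le> t1 * c / 2 * k ^ (n - 1) \<Longrightarrow> t1 * c / 2 * k ^ (n - 1) \<le> \<bar>z - poly (pderiv p) k * t\<bar>"
    "\<bar>- poly (pderiv (pderiv p)) k * t\<bar> \<le> t2 * C * k ^ (n - 1) / k"
    "\<bar>- poly (pderiv (pderiv (pderiv p))) k * t\<bar> \<le> t2 * C * k ^ (n - 1) / k\<^sup>2"
proof -
  have k: "k > 0" using assms B by auto
  have "c * k ^ (n - 1) * t1 \<le> \<bar>poly (pderiv p) k\<bar> * t"
    using assms t1 c k by (intro mult_mono p1_ge) auto
  also have "\<dots> = \<bar>poly (pderiv p) k * t\<bar>" using assms t1 by (simp add: abs_mult)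
  finally have "t1 * c * k ^ (n - 1) \<le> \<bar>poly (pderiv p) k * t\<bar>" by (simp add: mult_ac)
  then have "t1 * c / 2 * k ^ (n - 1) + t1 * c / 2 * k ^ (n - 1) \<le> \<bar>poly (pderiv p) k * t\<bar>"
    by (simp add: mult_ac)
  then show "t1 * c / 2 * k ^ (n - 1) \<le> \<bar>z - poly (pderiv p) k * t\<bar>"
    if "\<bar>z\<bar> \<le> t1 * c / 2 * k ^ (n - 1)"
    using that by linarith
  have "\<bar>poly (pderiv (pderiv p)) k\<bar> * t \<le> (C * k ^ (n - 1) / k) * t2"
    using assms t1 C k by (intro mult_mono p2_le) auto
  then show "\<bar>- poly (pderiv (pderiv p)) k * t\<bar> \<le> t2 * C * k ^ (n - 1) / k"
    using assms t1 by (simp add: abs_mult mult_ac)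
  have "\<bar>poly (pderiv (pderiv (pderiv p))) k\<bar> * t \<le> (C * k ^ (n - 1) / k\<^sup>2) * t2"
    using assms t1 C k by (intro mult_mono p3_le) auto
  then show "\<bar>- poly (pderiv (pderiv (pderiv p))) k * t\<bar> \<le> t2 * C * k ^ (n - 1) / k\<^sup>2"
    using assms t1 by (simp add: abs_mult mult_ac)
qed

text \<open>The first three constants are inputs: \<open>c1\<close> and \<open>C1\<close> control
  the phase derivatives, \<open>A\<close> the amplitude. The last three are the resulting bounds:
  \<open>M\<close> for the tail, \<open>K\<close> for the endpoint term, \<open>H\<close> for the
  part around the stationary point.\<close>

definition "c1 = t1 * c / 2"
definition "C1 = t2 * C"
definition "A = 4 * (real n + 4)\<^sup>2"
definition "M = A / c1\<^sup>2 + 4 * A * C1 / c1 ^ 3 + 3 * A * C1\<^sup>2 / c1 ^ 4"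
definition "K = 1 / c1 + 1 / c1\<^sup>2 + C1 / c1 ^ 3"
definition "H = 2 * (1 + 2 * pi) * A / sqrt (t1 * c)"

lemma const_pos: "c1 > 0" "C1 \<ge> 0" "A > 0" "M \<ge> 0" "K \<ge> 0" "H \<ge> 0"
proof -
  show *: "c1 > 0" "C1 \<ge> 0" "A > 0"
    using t1 c C t12 unfolding c1_def C1_def A_def by (auto intro!: mult_nonneg_nonneg)
  show "M \<ge> 0" "K \<ge> 0" using * unfolding M_def K_def by auto
  show "H \<ge> 0" unfolding H_def using * pi_gt_zero t1 c by auto
qed

lemma tail:
  assumes "j \<le> n" "t1 \<le> t" "t \<le> t2" "B \<le> N" "N \<le> R" "\<bar>z\<bar> \<le> c1 * N ^ (n - 1)"
  shows "norm (integral {N..R} (\<lambda>k. of_real (cutoff R j k) * cis (phase z t k))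
     + endpoint (cutoff R j N) (cutoff' R j N) N z t * cis (phase z t N)) \<le> M / N"
  unfolding M_def
proof (rule oscillatory_tail[where n = n and A = A, OF _ \<open>N \<le> R\<close> n const_pos(1) _ const_pos(2) DERIV_phase DERIV_cutoff DERIV_cutoff'])
  have R: "R > 0" "1 \<le> N" using assms B by auto
  show "1 \<le> N" "0 \<le> A" using R const_pos by auto
  show "cutoff R j R = 0" "cutoff' R j R = 0" using cutoff_at_end R by auto
  fix k assume k: "k \<in> {N..R}"
  then have Bk: "B \<le> k" and k1: "1 \<le> k" "k \<le> R" using assms B by auto
  show "R > 0" "R > 0" by fact+
  show "\<bar>cutoff R j k\<bar> \<le> A * k ^ n" "\<bar>cutoff' R j k\<bar> \<le> A * k ^ (n - 1)"
    "\<bar>cutoff'' R j k\<bar> \<le> A * k ^ (n - 1) / k"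
    using cutoff_bounds[OF k1 assms(1) n] unfolding A_def by auto
  have "\<bar>z\<bar> \<le> c1 * k ^ (n - 1)"
    using k assms R const_pos
    by (intro order_trans[OF assms(6)] mult_left_mono power_mono) auto
  then show "c1 * k ^ (n - 1) \<le> \<bar>z - poly (pderiv p) k * t\<bar>"
    using phase_bounds(1)[OF Bk assms(2,3)] unfolding c1_def by auto
  show "\<bar>- poly (pderiv (pderiv p)) k * t\<bar> \<le> C1 * k ^ (n - 1) / k"
    "\<bar>- poly (pderiv (pderiv (pderiv p))) k * t\<bar> \<le> C1 * k ^ (n - 1) / k\<^sup>2"
    using phase_bounds(2,3)[OF Bk assms(2,3)] unfolding C1_def by auto
qed (simp add: endpoint_def)

text \<open>The higher powers of \<open>s = N ^ (n - 1)\<close> in the denominators are weakened to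
  \<open>s\<close> itself. As \<alpha> will be of order \<open>N ^ n\<close>, the endpoint term then
  costs only order \<open>N\<close>. \<open>K\<close> is the sum of the coefficients of
  \<bar>\<alpha>\<bar> and \<bar>\<beta>\<bar>.\<close>

lemma endpoint_le:
  assumes "t1 \<le> t" "t \<le> t2" "B \<le> N" "\<bar>z\<bar> \<le> c1 * N ^ (n - 1)"
  shows "norm (endpoint \<alpha> \<beta> N z t) \<le> K * ((\<bar>\<alpha>\<bar> + \<bar>\<beta>\<bar>) / N ^ (n - 1))"
proof -
  define s where "s = N ^ (n - 1)"
  define P where "P = z - poly (pderiv p) N * t"
  define P' where "P' = - poly (pderiv (pderiv p)) N * t"
  have N: "1 \<le> N" using assms B by auto
  have s: "s \<ge> 1" using N by (simp add: s_def)
  have P: "c1 * s \<le> \<bar>P\<bar>"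
    using phase_bounds(1)[OF assms(3,1,2)] assms(4) unfolding P_def s_def c1_def by blast
  have "\<bar>P'\<bar> \<le> C1 * s / N"
    using phase_bounds(2)[OF assms(3,1,2)] unfolding P'_def s_def C1_def by blast
  also have "\<dots> \<le> C1 * s / 1"
    using N s const_pos by (intro divide_left_mono) auto
  finally have P': "\<bar>P'\<bar> \<le> C1 * s" by simp
  have cs: "c1 * s > 0" using s const_pos by auto
  have x: "\<bar>\<alpha> / P\<bar> \<le> \<bar>\<alpha>\<bar> / (c1 * s)" for \<alpha>
    using P cs by (auto simp: abs_divide intro!: divide_left_mono mult_pos_pos)
  have "s \<le> s\<^sup>2" using s by (simp add: power2_eq_square)
  have y: "\<bar>\<beta> / P\<^sup>2\<bar> \<le> \<bar>\<beta>\<bar> / (c1\<^sup>2 * s)"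
  proof -
    have "c1\<^sup>2 * s \<le> c1\<^sup>2 * s\<^sup>2" using \<open>s \<le> s\<^sup>2\<close> by (intro mult_left_mono) auto
    also have "c1\<^sup>2 * s\<^sup>2 \<le> \<bar>P\<bar>\<^sup>2"
      unfolding power_mult_distrib[symmetric] using P cs by (intro power_mono) auto
    finally have "c1\<^sup>2 * s \<le> P\<^sup>2" by simp
    moreover have "P \<noteq> 0" using P cs by auto
    ultimately show ?thesis using s const_pos
      by (auto simp: abs_divide intro!: divide_left_mono mult_pos_pos)
  qed
  have z: "\<bar>\<alpha> * P' / P ^ 3\<bar> \<le> \<bar>\<alpha>\<bar> * (C1 / c1 ^ 3) / s"
  proof -
    have "\<bar>\<alpha> * P' / P ^ 3\<bar> = \<bar>\<alpha>\<bar> * \<bar>P'\<bar> / \<bar>P\<bar> ^ 3" by (simp add: abs_mult power_abs)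
    also have "\<dots> \<le> \<bar>\<alpha>\<bar> * (C1 * s) / (c1 * s) ^ 3"
      using P P' cs const_pos s by (intro frac_le mult_left_mono power_mono) auto
    also have "\<dots> = \<bar>\<alpha>\<bar> * (C1 / c1 ^ 3) / s\<^sup>2"
      using s by (simp add: power2_eq_square power3_eq_cube)
    also have "\<dots> \<le> \<bar>\<alpha>\<bar> * (C1 / c1 ^ 3) / s"
      using \<open>s \<le> s\<^sup>2\<close> s const_pos by (intro divide_left_mono) auto
    finally show ?thesis .
  qed
  have "norm (endpoint \<alpha> \<beta> N z t) \<le> \<bar>\<alpha> / P\<bar> + (\<bar>\<beta> / P\<^sup>2\<bar> + \<bar>\<alpha> * P' / P ^ 3\<bar>)"
  proof -
    have "norm (complex_of_real (\<beta> / P\<^sup>2 - \<alpha> * P' / P ^ 3)) \<le> \<bar>\<beta> / P\<^sup>2\<bar> + \<bar>\<alpha> * P' / P ^ 3\<bar>"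
      unfolding norm_of_real by (rule abs_triangle_ineq4)
    moreover have "norm (- \<i> * complex_of_real (\<alpha> / P)) \<le> \<bar>\<alpha> / P\<bar>"
      unfolding norm_mult norm_of_real by simp
    ultimately show ?thesis
      unfolding endpoint_def P_def[symmetric] P'_def[symmetric]
      by (intro norm_triangle_le add_mono)
  qed
  also have "\<dots> \<le> \<bar>\<alpha>\<bar> / (c1 * s) + (\<bar>\<beta>\<bar> / (c1\<^sup>2 * s) + \<bar>\<alpha>\<bar> * (C1 / c1 ^ 3) / s)"
    by (intro add_mono x y z)
  also have "\<dots> = (\<bar>\<alpha>\<bar> * (1 / c1 + C1 / c1 ^ 3) + \<bar>\<beta>\<bar> * (1 / c1\<^sup>2)) / s"
    using s const_pos by (simp add: field_simps)
  also have "\<dots> \<le> (\<bar>\<alpha>\<bar> * K + \<bar>\<beta>\<bar> * K) / s"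
    unfolding K_def using s const_pos by (intro divide_right_mono add_mono mult_left_mono) auto
  finally show ?thesis by (simp add: s_def field_simps)
qed

lemma head:
  assumes "j \<le> n" "t1 \<le> t" "t \<le> t2" "B \<le> m" "m \<le> R"
  shows "norm (integral {B..m} (\<lambda>k. of_real (cutoff R j k) * cis (phase z t k))) \<le> H * sqrt (m ^ (n + 2))"
  unfolding H_def
proof (rule oscillatory_head[OF B \<open>B \<le> m\<close> n _ _ DERIV_phase(1,2) _ DERIV_cutoff])
  have R: "R > 0" using assms B by auto
  show "0 < t1 * c" "0 \<le> A" using t1 c const_pos by auto
  have "t1 * c * k ^ (n - 2) \<le> x * t" if "c * k ^ (n - 2) \<le> x" "k \<ge> B" for k x
  proof -
    have "c * k ^ (n - 2) * t1 \<le> x * t"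
      using that assms c t1 B by (intro mult_mono) (auto intro: order_trans[rotated])
    then show ?thesis by (simp add: mult_ac)
  qed
  from this[of _ "poly (pderiv (pderiv p)) _"] this[of _ "- poly (pderiv (pderiv p)) _"]
  show "(\<forall>k\<in>{B..m}. t1 * c * k ^ (n - 2) \<le> - poly (pderiv (pderiv p)) k * t) \<or>
    (\<forall>k\<in>{B..m}. t1 * c * k ^ (n - 2) \<le> - (- poly (pderiv (pderiv p)) k * t))"
    using p2_ge by auto
  fix k assume k: "k \<in> {B..m}"
  then have k1: "1 \<le> k" "k \<le> R" using assms B by auto
  show "R > 0" by fact
  show "\<bar>cutoff R j k\<bar> \<le> A * k ^ n" "\<bar>cutoff' R j k\<bar> \<le> A * k ^ (n - 1)"
    using cutoff_bounds[OF k1 assms(1) n] unfolding A_def by auto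
qed

lemma integrand_cont: "continuous_on S (\<lambda>k. complex_of_real (cutoff R j k) * cis (phase z t k))"
  by (intro continuous_intros)

lemma initial_le:
  assumes "j \<le> n" "1 \<le> N" "N \<le> R"
  shows "norm (integral {0..N} (\<lambda>k. of_real (cutoff R j k) * cis (phase z t k))) \<le> N ^ n * N"
proof -
  have "norm (of_real (cutoff R j k) * cis (phase z t k)) \<le> N ^ n" if "k \<in> {0..N}" for k
  proof -
    have "\<bar>cutoff R j k\<bar> \<le> \<bar>k\<bar> ^ j" using cutoff_le_power[of k R j] that assms by auto
    also have "\<dots> \<le> N ^ j" using that by (intro power_mono) auto
    also have "\<dots> \<le> N ^ n" using assms by (intro power_increasing) auto
    finally show ?thesis by (simp add: norm_mult)
  qed
  then show ?thesis
    using integral_bound[of 0 N "\<lambda>k. of_real (cutoff R j k) * cis (phase z t k)" "N ^ n"] integrand_cont assms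
    by auto
qed

lemma half_osc_split:
  assumes "0 \<le> N" "N \<le> R"
  shows "half_osc p R j z t = integral {0..N} (\<lambda>k. of_real (cutoff R j k) * cis (phase z t k))
     + integral {N..R} (\<lambda>k. of_real (cutoff R j k) * cis (phase z t k))"
  unfolding half_osc_def
  by (rule Henstock_Kurzweil_Integration.integral_combine[symmetric])
    (use assms in \<open>auto intro!: integrable_continuous_real integrand_cont\<close>)

text \<open>The half-line is cut at \<open>B\<close> and at a point \<open>k0\<close> of order
  \<open>(1 + \<bar>z\<bar>) powr (1 / (n - 1))\<close>, past which the phase is not stationary. The
  middle piece contributes \<open>sqrt (k0 ^ (n + 2))\<close>, which is the claimed growth; the
  other pieces and the endpoint term at \<open>k0\<close> are no larger.\<close>

lemma half_osc_bound:
  obtains D where "0 \<le> D"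
    "\<And>R j t z. \<lbrakk>B \<le> R; j \<le> n; t1 \<le> t; t \<le> t2\<rbrakk> \<Longrightarrow>
       norm (half_osc p R j z t) \<le> D * (1 + \<bar>z\<bar>) powr ((real n + 2) / (2 * (real n - 1)))"
proof -
  \<comment> \<open>The scale of \<open>k0\<close>: \<open>d \<ge> B\<close> keeps \<open>k0\<close>
    in the range of the growth bounds, and \<open>c1 * d \<ge> 1\<close> ensures
    \<open>\<bar>z\<bar> \<le> c1 * k0 ^ (n - 1)\<close>, the condition of
    \<open>tail\<close>.\<close>
  define d where "d = max B (1 / c1)"
  have d: "d \<ge> 1" "B \<le> d" "c1 * d \<ge> 1"
    using B const_pos mult_left_mono[of "1 / c1" d c1] by (auto simp: d_def)
  define D where "D = B ^ n * B + H + (M + K * (2 * A))"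
  have D: "D \<ge> 0" unfolding D_def using B const_pos by simp
  have main: "norm (half_osc p R j z t) \<le> D * (sqrt (d ^ (n + 2)) * (1 + \<bar>z\<bar>) powr ((real n + 2) / (2 * (real n - 1))))"
    if *: "B \<le> R" "j \<le> n" "t1 \<le> t" "t \<le> t2" for R j t z
  proof -
    define k0 where "k0 = d * (1 + \<bar>z\<bar>) powr (1 / (real n - 1))"
    have "(1 + \<bar>z\<bar>) powr (1 / (real n - 1)) \<ge> 1" using n by (intro ge_one_powr_ge_zero) auto
    then have k0: "k0 \<ge> d" unfolding k0_def using d by (simp add: mult_le_cancel_left1)
    have k0p: "k0 ^ i = d ^ i * (1 + \<bar>z\<bar>) powr (real i / (real n - 1))" for i
      by (simp add: k0_def power_mult_distrib powr_power)
    have "k0 ^ (n - 1) = d ^ (n - 1) * (1 + \<bar>z\<bar>)"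
      using n by (simp add: k0p of_nat_diff)
    moreover have "d \<le> d ^ (n - 1)" using d n power_increasing[of 1 "n - 1" d] by simp
    ultimately have ge1: "c1 * k0 ^ (n - 1) \<ge> c1 * d * (1 + \<bar>z\<bar>)"
      using const_pos by (simp add: mult.assoc mult_right_mono)
    have "c1 * d * (1 + \<bar>z\<bar>) \<ge> 1 * (1 + \<bar>z\<bar>)" by (intro mult_right_mono d) auto
    from order_trans[OF this ge1] have zk: "\<bar>z\<bar> \<le> c1 * k0 ^ (n - 1)" by simp
    define S where "S = sqrt (k0 ^ (n + 2))"
    have k01: "k0 \<ge> 1" using k0 d by auto
    have S1: "S \<ge> 1"
      unfolding S_def real_sqrt_ge_1_iff by (rule one_le_power[OF k01])
    \<comment> \<open>This absorbs the endpoint term, which is of order \<open>k0\<close>, into the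
      main order \<open>S\<close>.\<close>
    have Sk: "k0 \<le> S"
    proof -
      have "k0 ^ 2 \<le> k0 ^ (n + 2)" using k01 by (intro power_increasing) auto
      then show ?thesis unfolding S_def by (intro real_le_rsqrt)
    qed
    \<comment> \<open>If the cutoff radius lies below \<open>k0\<close>, the tail is empty and the
      middle piece ends at \<open>R\<close>.\<close>
    define m where "m = min k0 R"
    let ?f = "\<lambda>k. of_real (cutoff R j k) * cis (phase z t k)"
    have "integral {B..R} ?f = integral {B..m} ?f + integral {m..R} ?f"
      by (rule Henstock_Kurzweil_Integration.integral_combine[symmetric])
        (use k0 d * in \<open>auto simp: m_def intro!: integrable_continuous_real integrand_cont\<close>)
    then have split: "half_osc p R j z t = integral {0..B} ?f + integral {B..m} ?f + integral {m..R} ?f"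
      using half_osc_split[of B R j z t] * B by simp
    have 1: "norm (integral {0..B} ?f) \<le> B ^ n * B"
      by (rule initial_le) (use * B in auto)
    have "norm (integral {B..m} ?f) \<le> H * sqrt (m ^ (n + 2))"
      by (rule head) (use * k0 d in \<open>auto simp: m_def\<close>)
    also have "\<dots> \<le> H * S"
      unfolding S_def using * k01 B const_pos
      by (intro mult_left_mono real_sqrt_le_mono power_mono) (auto simp: m_def)
    finally have 2: "norm (integral {B..m} ?f) \<le> H * S" .
    have 3: "norm (integral {m..R} ?f) \<le> (M + K * (2 * A)) * S"
    proof (cases "k0 \<le> R")
      case False
      then have "m = R" by (simp add: m_def)
      then show ?thesis using S1 const_pos by simp
    next
      case True
      then have m: "m = k0" by (simp add: m_def)
      let ?b = "endpoint (cutoff R j k0) (cutoff' R j k0) k0 z t * cis (phase z t k0)"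
      have "norm (integral {k0..R} ?f + ?b) \<le> M / k0"
        by (rule tail) (use * k0 d zk True in auto)
      also have "\<dots> \<le> M * 1" using k01 const_pos by (simp add: divide_le_eq mult_le_cancel_left1)
      also have "\<dots> \<le> M * S" using S1 const_pos by (intro mult_left_mono) auto
      finally have a: "norm (integral {k0..R} ?f + ?b) \<le> M * S" .
      have "norm ?b \<le> K * ((\<bar>cutoff R j k0\<bar> + \<bar>cutoff' R j k0\<bar>) / k0 ^ (n - 1))"
        unfolding norm_mult norm_cis mult_1_right
        by (rule endpoint_le) (use * k0 d zk in auto)
      also have "\<dots> \<le> K * ((A * k0 ^ n + A * k0 ^ (n - 1)) / k0 ^ (n - 1))"
        using cutoff_bounds(1,2)[OF k01 True *(2) n] const_pos k01 unfolding A_def[symmetric]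
        by (intro mult_left_mono divide_right_mono add_mono) auto
      also have "(A * k0 ^ n + A * k0 ^ (n - 1)) / k0 ^ (n - 1) = A * k0 + A"
      proof -
        have "k0 ^ n = k0 * k0 ^ (n - 1)" using n by (simp flip: power_Suc)
        then show ?thesis using k01 by (simp add: field_simps)
      qed
      also have "K * (A * k0 + A) \<le> K * (A * S + A * S)"
        using Sk S1 const_pos by (intro mult_left_mono add_mono) auto
      finally have b: "norm ?b \<le> K * (2 * A) * S" by (simp add: algebra_simps)
      have "norm (integral {k0..R} ?f) \<le> norm (integral {k0..R} ?f + ?b) + norm ?b"
        using norm_triangle_ineq4[of "integral {k0..R} ?f + ?b" ?b] by (simp only: add_diff_cancel_right')
      also have "\<dots> \<le> M * S + K * (2 * A) * S" by (intro add_mono a b)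
      finally show ?thesis unfolding m distrib_right .
    qed
    have "norm (half_osc p R j z t) \<le> B ^ n * B + H * S + (M + K * (2 * A)) * S"
      unfolding split by (intro norm_triangle_le add_mono 1 2 3)
    also have "\<dots> \<le> B ^ n * B * S + H * S + (M + K * (2 * A)) * S"
      using mult_left_mono[OF S1, of "B ^ n * B"] B by simp
    also have "\<dots> = D * S" by (simp add: D_def algebra_simps)
    also have "S = sqrt (d ^ (n + 2)) * (1 + \<bar>z\<bar>) powr ((real n + 2) / (2 * (real n - 1)))"
    proof -
      have "S = sqrt (d ^ (n + 2)) * sqrt ((1 + \<bar>z\<bar>) powr (real (n + 2) / (real n - 1)))"
        unfolding S_def k0p by (simp add: real_sqrt_mult)
      also have "sqrt ((1 + \<bar>z\<bar>) powr (real (n + 2) / (real n - 1))) = (1 + \<bar>z\<bar>) powr ((real n + 2) / (2 * (real n - 1)))"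
        by (simp add: powr_half_sqrt[symmetric] powr_powr mult.commute add.commute)
      finally show ?thesis .
    qed
    finally show ?thesis .
  qed
  show ?thesis
    by (rule that[of "D * sqrt (d ^ (n + 2))"]) (use D d main in \<open>auto simp: mult.assoc\<close>)
qed

text \<open>By \<open>tail\<close>, the integral beyond a large fixed \<open>N\<close> is minus its
  endpoint term up to \<open>M / N\<close>, whatever R is. So only data on [0, N] matter, and there
  the cutoff tends to 1. No absolute convergence is involved.\<close>

lemma half_osc_cauchy:
  assumes "e > 0"
  obtains R0 where "\<And>R R' j t z. \<lbrakk>R0 \<le> R; R0 \<le> R'; j \<le> n; t1 \<le> t; t \<le> t2; \<bar>z\<bar> \<le> Z\<rbrakk> \<Longrightarrow>
       norm (half_osc p R j z t - half_osc p R' j z t) \<le> e"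
proof -
  \<comment> \<open>The three entries serve the growth bounds, the non-stationarity of the phase for
    \<open>\<bar>z\<bar> \<le> Z\<close>, and the smallness
    \<open>M / N \<le> e / 4\<close>.\<close>
  define N where "N = Max {B, Z / c1, 4 * M / e}"
  have N: "B \<le> N" "Z / c1 \<le> N" "4 * M / e \<le> N" by (simp_all add: N_def)
  have N1: "1 \<le> N" using N B by simp
  have NZ: "Z \<le> c1 * N ^ (n - 1)"
  proof -
    have "Z \<le> c1 * N" using N const_pos by (simp add: divide_le_eq mult.commute)
    also have "N \<le> N ^ (n - 1)" using N1 n power_increasing[of 1 "n - 1" N] by simp
    finally show ?thesis using const_pos by simp
  qed
  have MN: "M / N \<le> e / 4" using N N1 assms by (simp add: field_simps)
  define X where "X = (2 * N ^ (n + 2)) * N + K * (2 * N ^ (n + 2) + (2 * real n + 4) * N ^ (n + 2))"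
  have X: "X \<ge> 0" unfolding X_def using N1 const_pos by simp
  define R0 where "R0 = max N (4 * X / e)"
  define G where "G R j z t = integral {0..N} (\<lambda>k. of_real (cutoff R j k) * cis (phase z t k))
      - endpoint (cutoff R j N) (cutoff' R j N) N z t * cis (phase z t N)" for R j z t
  \<comment> \<open>The formal limit of \<open>G\<close> as R tends to infinity. It does not mention
    R, so two cutoffs can be compared through it, each within \<open>e / 2\<close>.\<close>
  define G0 where "G0 j z t = integral {0..N} (\<lambda>k. of_real (k ^ j) * cis (phase z t k))
      - endpoint (N ^ j) (real j * N ^ (j - 1)) N z t * cis (phase z t N)" for j z t
  have close: "norm (half_osc p R j z t - G0 j z t) \<le> e / 2"
    if *: "R0 \<le> R" "j \<le> n" "t1 \<le> t" "t \<le> t2" "\<bar>z\<bar> \<le> Z" for R j t z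
  proof -
    have NR: "N \<le> R" using * by (simp add: R0_def)
    have z: "\<bar>z\<bar> \<le> c1 * N ^ (n - 1)" using * NZ by auto
    have a: "norm (half_osc p R j z t - G R j z t) \<le> M / N"
      using tail[OF *(2,3,4) N(1) NR z] half_osc_split[of N R j z t] N1 NR by (simp add: G_def)
    let ?g = "\<lambda>k. of_real (cutoff R j k) * cis (phase z t k) - of_real (k ^ j) * cis (phase z t k)"
    have cont: "continuous_on {0..N} (\<lambda>k. complex_of_real (k ^ j) * cis (phase z t k))"
      by (intro continuous_intros)
    have eq: "G R j z t - G0 j z t = integral {0..N} ?g
        - endpoint (cutoff R j N - N ^ j) (cutoff' R j N - real j * N ^ (j - 1)) N z t * cis (phase z t N)"
    proof -
      have "integral {0..N} ?g = integral {0..N} (\<lambda>k. of_real (cutoff R j k) * cis (phase z t k))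
          - integral {0..N} (\<lambda>k. of_real (k ^ j) * cis (phase z t k))"
        by (intro Henstock_Kurzweil_Integration.integral_diff integrable_continuous_real integrand_cont cont)
      then show ?thesis
        by (simp add: G_def G0_def algebra_simps flip: endpoint_diff)
    qed
    have "norm (integral {0..N} ?g) \<le> (2 * N ^ (n + 2) / R\<^sup>2) * (N - 0)"
    proof (rule integral_bound)
      show "continuous_on {0..N} ?g" by (intro continuous_on_diff integrand_cont cont)
      fix k assume "k \<in> {0..N}"
      then have "\<bar>cutoff R j k - k ^ j\<bar> \<le> 2 * N ^ (n + 2) / R\<^sup>2"
        using cutoff_approx(1)[OF _ N1 NR *(2), of k] by auto
      then show "norm (?g k) \<le> 2 * N ^ (n + 2) / R\<^sup>2"
        by (simp add: norm_mult flip: left_diff_distrib of_real_diff of_real_power)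
    qed (use N1 in auto)
    moreover have "norm (endpoint (cutoff R j N - N ^ j) (cutoff' R j N - real j * N ^ (j - 1)) N z t * cis (phase z t N))
       \<le> K * (2 * N ^ (n + 2) / R\<^sup>2 + (2 * real n + 4) * N ^ (n + 2) / R\<^sup>2)"
    proof -
      let ?a = "\<bar>cutoff R j N - N ^ j\<bar> + \<bar>cutoff' R j N - real j * N ^ (j - 1)\<bar>"
      have "norm (endpoint (cutoff R j N - N ^ j) (cutoff' R j N - real j * N ^ (j - 1)) N z t * cis (phase z t N))
          \<le> K * (?a / N ^ (n - 1))"
        unfolding norm_mult norm_cis mult_1_right by (rule endpoint_le) (use * N z in auto)
      also have "?a / N ^ (n - 1) \<le> ?a / 1" using N1 by (intro divide_left_mono) auto
      also have "?a / 1 \<le> 2 * N ^ (n + 2) / R\<^sup>2 + (2 * real n + 4) * N ^ (n + 2) / R\<^sup>2"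
        using cutoff_approx[OF _ N1 NR *(2), of N] N1 by auto
      finally show ?thesis using const_pos by (simp add: mult_left_mono)
    qed
    ultimately have "norm (G R j z t - G0 j z t) \<le> (2 * N ^ (n + 2) / R\<^sup>2) * (N - 0)
       + K * (2 * N ^ (n + 2) / R\<^sup>2 + (2 * real n + 4) * N ^ (n + 2) / R\<^sup>2)"
      unfolding eq by (intro norm_triangle_le_diff add_mono)
    also have "\<dots> = X / R\<^sup>2" by (simp add: X_def add_divide_distrib algebra_simps)
    also have "\<dots> \<le> X / R" using N1 NR X by (intro divide_left_mono) (auto simp: power2_eq_square)
    also have "\<dots> \<le> e / 4"
      using * N1 NR X assms by (simp add: R0_def field_simps)
    finally have b: "norm (G R j z t - G0 j z t) \<le> e / 4" .
    have "norm (half_osc p R j z t - G0 j z t) \<le> norm (half_osc p R j z t - G R j z t) + norm (G R j z t - G0 j z t)"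
      using norm_triangle_ineq[of "half_osc p R j z t - G R j z t" "G R j z t - G0 j z t"] by simp
    with a b MN show ?thesis by linarith
  qed
  show ?thesis
  proof (rule that[of R0])
    fix R R' j t z
    assume *: "R0 \<le> R" "R0 \<le> R'" "j \<le> n" "t1 \<le> t" "t \<le> t2" "\<bar>z\<bar> \<le> Z"
    show "norm (half_osc p R j z t - half_osc p R' j z t) \<le> e"
      using norm_triangle_ineq4[of "half_osc p R j z t - G0 j z t" "half_osc p R' j z t - G0 j z t"]
        close[OF *(1,3-6)] close[OF *(2,3-6)] by simp
  qed
qed

end

lemma half_line_phase_exists:
  fixes p :: "real poly"
  assumes "degree p = n" "2 \<le> n" "0 < t1" "t1 \<le> t2"
  obtains B c C where "half_line_phase p n B c C t1 t2"
proof -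
  let ?p1 = "pderiv p" and ?p2 = "pderiv (pderiv p)" and ?p3 = "pderiv (pderiv (pderiv p))"
  have deg: "degree ?p1 = n - 1" "degree ?p2 = n - 2" "degree ?p3 = n - 3"
    using assms by (simp_all add: degree_pderiv)
  have nz: "?p1 \<noteq> 0" using assms deg by (metis One_nat_def degree_0 diff_is_0_eq not_less_eq_eq numeral_2_eq_2)
  have nz2: "?p2 \<noteq> 0"
    using assms deg by (simp add: pderiv_eq_0_iff)
  obtain B1 c1 where 1: "1 \<le> B1" "0 < c1"
    "(\<forall>k\<ge>B1. c1 * k ^ (n - 1) \<le> poly ?p1 k) \<or> (\<forall>k\<ge>B1. c1 * k ^ (n - 1) \<le> - poly ?p1 k)"
    using poly_lower_growth[OF nz] unfolding deg by metis
  obtain B2 c2 where 2: "1 \<le> B2" "0 < c2"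
    "(\<forall>k\<ge>B2. c2 * k ^ (n - 2) \<le> poly ?p2 k) \<or> (\<forall>k\<ge>B2. c2 * k ^ (n - 2) \<le> - poly ?p2 k)"
    using poly_lower_growth[OF nz2] unfolding deg by metis
  obtain C2 where C2: "0 \<le> C2" "\<And>k. 1 \<le> k \<Longrightarrow> \<bar>poly ?p2 k\<bar> \<le> C2 * k ^ (n - 2)"
    using poly_upper_growth[of ?p2] unfolding deg by metis
  obtain C3 where C3: "0 \<le> C3" "\<And>k. 1 \<le> k \<Longrightarrow> \<bar>poly ?p3 k\<bar> \<le> C3 * k ^ (n - 3)"
    using poly_upper_growth[of ?p3] unfolding deg by metis
  define B where "B = max B1 B2"
  define c where "c = min c1 c2"
  define C where "C = max C2 C3"
  have B: "1 \<le> B" "B1 \<le> B" "B2 \<le> B" and c: "0 < c" "c \<le> c1" "c \<le> c2" and C: "0 \<le> C" "C2 \<le> C" "C3 \<le> C"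
    using 1(1,2) 2(1,2) C2(1) by (auto simp: B_def c_def C_def)
  have cm: "c * k ^ i \<le> c1 * k ^ i" "c * k ^ i \<le> c2 * k ^ i" if "B \<le> k" for k i
    using that B c by (auto intro!: mult_right_mono)
  have k12: "k ^ (n - 2) = k ^ (n - 1) / k" if "B \<le> k" for k
  proof -
    have "n - 1 = Suc (n - 2)" using \<open>2 \<le> n\<close> by simp
    then show ?thesis using that B by simp
  qed
  have "half_line_phase p n B c C t1 t2"
  proof
    show "2 \<le> n" "1 \<le> B" "0 < c" "0 \<le> C" "0 < t1" "t1 \<le> t2" by fact+
    show "(\<forall>k\<ge>B. c * k ^ (n - 2) \<le> poly ?p2 k) \<or> (\<forall>k\<ge>B. c * k ^ (n - 2) \<le> - poly ?p2 k)"
      using 2(3) cm(2) B(3) by (meson order_trans)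
    fix k assume k: "B \<le> k"
    have k1: "1 \<le> k" using k B by simp
    show "c * k ^ (n - 1) \<le> \<bar>poly ?p1 k\<bar>"
    proof -
      have "c1 * k ^ (n - 1) \<le> poly ?p1 k \<or> c1 * k ^ (n - 1) \<le> - poly ?p1 k"
        using 1(3) k B(2) by auto
      then show ?thesis using cm(1)[OF k, of "n - 1"] by linarith
    qed
    have "\<bar>poly ?p2 k\<bar> \<le> C * k ^ (n - 2)"
      using C2(2)[OF k1] C k1 by (auto intro: order_trans mult_right_mono)
    then show "\<bar>poly ?p2 k\<bar> \<le> C * k ^ (n - 1) / k" by (simp add: k12[OF k])
    show "\<bar>poly ?p3 k\<bar> \<le> C * k ^ (n - 1) / k\<^sup>2"
    \<comment> \<open>For \<open>n = 2\<close> the truncated exponent \<open>n - 3\<close> is 0, and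
      a constant bound would exceed the required \<open>C / k\<close>; but then the third derivative
      vanishes.\<close>
    proof (cases "n = 2")
      case True
      then have "?p3 = 0" using deg(2) by (simp add: pderiv_eq_0_iff)
      then show ?thesis using C k1 by simp
    next
      case False
      then have "n - 1 = Suc (Suc (n - 3))" using \<open>2 \<le> n\<close> by simp
      then have "C * k ^ (n - 1) / k\<^sup>2 = C * k ^ (n - 3)" using k1 by (simp add: power2_eq_square)
      then show ?thesis using C3(2)[OF k1] C k1 by (auto intro: order_trans mult_right_mono)
    qed
  qed
  then show ?thesis by (rule that)
qed

section \<open>From the half-line to the whole line\<close>

definition osc :: "real poly \<Rightarrow> real \<Rightarrow> nat \<Rightarrow> real \<Rightarrow> real \<Rightarrow> complex" where
  "osc p R j z t = integral {- R..R} (\<lambda>k. of_real (cutoff R j k) * cis (k * z - poly p k * t))"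

lemma osc_integrand_continuous:
  fixes f g :: "'a::topological_space \<Rightarrow> real"
  assumes "continuous_on S f" "continuous_on S z" "continuous_on S t"
  shows "continuous_on S (\<lambda>x. complex_of_real (cutoff R j (f x)) * cis (f x * z x - poly p (f x) * t x))"
  by (intro continuous_intros assms)

text \<open>Reflecting k replaces p by a polynomial of the same degree and z by \<open>- z\<close>,
  so the half-line estimates apply to both halves.\<close>

lemma osc_eq_half_osc:
  assumes "0 \<le> R"
  shows "osc p R j z t = half_osc p R j z t + (-1) ^ j * half_osc (p \<circ>\<^sub>p [:0, -1:]) R j (- z) t"
proof -
  let ?f = "\<lambda>k. complex_of_real (cutoff R j k) * cis (k * z - poly p k * t)"
  have cont: "continuous_on S ?f" for S by (intro osc_integrand_continuous continuous_intros)
  have "osc p R j z t = integral {- R..0} ?f + integral {0..R} ?f"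
    unfolding osc_def
    by (rule Henstock_Kurzweil_Integration.integral_combine[symmetric])
      (use assms in \<open>auto intro!: integrable_continuous_real cont\<close>)
  also have "integral {- R..0} ?f = integral {0..R} (\<lambda>k. ?f (- k))"
    using Henstock_Kurzweil_Integration.integral_reflect_real[of R 0 "\<lambda>k. ?f (- k)"] by simp
  also have "(\<lambda>k. ?f (- k)) = (\<lambda>k. (-1) ^ j * (complex_of_real (cutoff R j k) * cis (k * (- z) - poly (p \<circ>\<^sub>p [:0, -1:]) k * t)))"
    by (simp add: cutoff_minus poly_pcompose mult.assoc)
  also have "integral {0..R} \<dots> = (-1) ^ j * half_osc (p \<circ>\<^sub>p [:0, -1:]) R j (- z) t"
    unfolding half_osc_def by (rule integral_mult_right)
  finally show ?thesis by (simp add: half_osc_def add.commute)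
qed

text \<open>Stationary phase: the stationary point is of size \<open>k = \<bar>z\<bar> powr (1 / (n - 1))\<close>, and the amplitude
  \<open>k ^ n\<close> times the width \<open>1 / sqrt (k ^ (n - 2))\<close> of the critical region is
  \<open>\<bar>z\<bar> powr ((n + 2) / (2 * (n - 1)))\<close>.\<close>

lemma osc_bound:
  assumes "degree p = n" "2 \<le> n" "0 < t1" "t1 \<le> t2"
  obtains D R1 where "0 \<le> D" "1 \<le> R1"
    "\<And>R j t z. \<lbrakk>R1 \<le> R; j \<le> n; t1 \<le> t; t \<le> t2\<rbrakk> \<Longrightarrow>
       norm (osc p R j z t) \<le> D * (1 + \<bar>z\<bar>) powr ((real n + 2) / (2 * (real n - 1)))"
proof -
  let ?p = "p \<circ>\<^sub>p [:0, -1:]"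
  have "degree ?p = n" using assms by (simp add: degree_pcompose)
  then obtain B c C B' c' C' where "half_line_phase p n B c C t1 t2" "half_line_phase ?p n B' c' C' t1 t2"
    using half_line_phase_exists assms by metis
  then interpret h: half_line_phase p n B c C t1 t2 + h': half_line_phase ?p n B' c' C' t1 t2 .
  obtain D where D: "0 \<le> D" "\<And>R j t z. \<lbrakk>B \<le> R; j \<le> n; t1 \<le> t; t \<le> t2\<rbrakk> \<Longrightarrow>
       norm (half_osc p R j z t) \<le> D * (1 + \<bar>z\<bar>) powr ((real n + 2) / (2 * (real n - 1)))"
    using h.half_osc_bound by metis
  obtain D' where D': "0 \<le> D'" "\<And>R j t z. \<lbrakk>B' \<le> R; j \<le> n; t1 \<le> t; t \<le> t2\<rbrakk> \<Longrightarrow>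
       norm (half_osc ?p R j z t) \<le> D' * (1 + \<bar>z\<bar>) powr ((real n + 2) / (2 * (real n - 1)))"
    using h'.half_osc_bound by metis
  show ?thesis
  proof (rule that[of "D + D'" "max B B'"])
    show "0 \<le> D + D'" "1 \<le> max B B'" using D D' h.B by auto
    fix R j t z assume *: "max B B' \<le> R" "j \<le> n" "t1 \<le> t" "t \<le> t2"
    have "norm (osc p R j z t) \<le> norm (half_osc p R j z t) + norm (half_osc ?p R j (- z) t)"
      using osc_eq_half_osc[of R p j z t] * h.B norm_triangle_ineq[of "half_osc p R j z t" "(-1) ^ j * half_osc ?p R j (- z) t"]
      by (simp add: norm_mult norm_power)
    also have "\<dots> \<le> D * (1 + \<bar>z\<bar>) powr ((real n + 2) / (2 * (real n - 1)))
        + D' * (1 + \<bar>- z\<bar>) powr ((real n + 2) / (2 * (real n - 1)))"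
      using * by (intro add_mono D(2) D'(2)) auto
    finally show "norm (osc p R j z t) \<le> (D + D') * (1 + \<bar>z\<bar>) powr ((real n + 2) / (2 * (real n - 1)))"
      by (simp add: distrib_right)
  qed
qed

lemma osc_cauchy:
  assumes "degree p = n" "2 \<le> n" "0 < t1" "t1 \<le> t2" "0 < e"
  obtains R0 where
    "\<And>R R' j t z. \<lbrakk>R0 \<le> R; R0 \<le> R'; j \<le> n; t1 \<le> t; t \<le> t2; \<bar>z\<bar> \<le> Z\<rbrakk> \<Longrightarrow>
       norm (osc p R j z t - osc p R' j z t) \<le> e"
proof -
  let ?p = "p \<circ>\<^sub>p [:0, -1:]"
  have "degree ?p = n" using assms by (simp add: degree_pcompose)
  then obtain B c C B' c' C' where "half_line_phase p n B c C t1 t2" "half_line_phase ?p n B' c' C' t1 t2"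
    using half_line_phase_exists assms by metis
  then interpret h: half_line_phase p n B c C t1 t2 + h': half_line_phase ?p n B' c' C' t1 t2 .
  have e: "e / 2 > 0" using assms by simp
  obtain R0 where R0: "\<And>R R' j t z. \<lbrakk>R0 \<le> R; R0 \<le> R'; j \<le> n; t1 \<le> t; t \<le> t2; \<bar>z\<bar> \<le> Z\<rbrakk> \<Longrightarrow>
       norm (half_osc p R j z t - half_osc p R' j z t) \<le> e / 2"
    using h.half_osc_cauchy[OF e, of Z] by metis
  obtain R0' where R0': "\<And>R R' j t z. \<lbrakk>R0' \<le> R; R0' \<le> R'; j \<le> n; t1 \<le> t; t \<le> t2; \<bar>z\<bar> \<le> Z\<rbrakk> \<Longrightarrow>
       norm (half_osc ?p R j z t - half_osc ?p R' j z t) \<le> e / 2"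
    using h'.half_osc_cauchy[OF e, of Z] by metis
  show ?thesis
  proof (rule that[of "Max {0, R0, R0'}"])
    fix R R' j t z assume *: "Max {0, R0, R0'} \<le> R" "Max {0, R0, R0'} \<le> R'" "j \<le> n" "t1 \<le> t" "t \<le> t2" "\<bar>z\<bar> \<le> Z"
    have "osc p R j z t - osc p R' j z t = (half_osc p R j z t - half_osc p R' j z t)
        + (-1) ^ j * (half_osc ?p R j (- z) t - half_osc ?p R' j (- z) t)"
      using * by (simp add: osc_eq_half_osc algebra_simps)
    also have "norm \<dots> \<le> e / 2 + e / 2"
    proof (intro norm_triangle_le add_mono)
      show "norm (half_osc p R j z t - half_osc p R' j z t) \<le> e / 2" using * by (intro R0) auto
      have "norm (half_osc ?p R j (- z) t - half_osc ?p R' j (- z) t) \<le> e / 2" using * by (intro R0') auto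
      then show "norm ((-1) ^ j * (half_osc ?p R j (- z) t - half_osc ?p R' j (- z) t)) \<le> e / 2"
        by (simp add: norm_mult norm_power)
    qed
    finally show "norm (osc p R j z t - osc p R' j z t) \<le> e" by simp
  qed
qed

section \<open>Approximate solutions and their limit\<close>

lemma integrable_prod_mult:
  fixes f g :: "real \<Rightarrow> real"
  assumes "integrable lborel f" "integrable lborel g"
  shows "integrable (lborel \<Otimes>\<^sub>M lborel) (\<lambda>(x, y). f x * g y)"
proof (rule lborel_pair.Fubini_integrable)
  have [measurable]: "f \<in> borel_measurable borel" "g \<in> borel_measurable borel"
    using assms by auto
  show "(\<lambda>(x, y). f x * g y) \<in> borel_measurable (lborel \<Otimes>\<^sub>M lborel)" by measurable
  show "integrable lborel (\<lambda>x. LINT y|lborel. norm (case (x, y) of (x, y) \<Rightarrow> f x * g y))"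
    using assms by (simp add: abs_mult)
  show "AE x in lborel. integrable lborel (\<lambda>y. case (x, y) of (x, y) \<Rightarrow> f x * g y)"
    using assms by simp
qed

text \<open>The counterpart of \<open>fourier\<close> over \<open>lborel\<close>, whose products
  carry the Fubini arguments. \<open>fourier_eq_fourier_borel\<close> links the two through a Borel
  function that agrees almost everywhere with the datum.\<close>

definition fourier_borel :: "(real \<Rightarrow> complex) \<Rightarrow> real \<Rightarrow> complex" where
  "fourier_borel h k = (LINT y|lborel. cis (- (k * y)) * h y)"

lemma cis_borel_measurable [measurable]:
  "f \<in> borel_measurable M \<Longrightarrow> (\<lambda>x. cis (f x)) \<in> borel_measurable M"
  by (rule borel_measurable_continuous_on[of cis]) (auto intro: continuous_intros)

lemma continuous_on_fourier_borel:
  assumes "integrable lborel h"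
  shows "continuous_on S (fourier_borel h)"
proof -
  have [measurable]: "h \<in> borel_measurable borel" using assms by auto
  have "isCont (fourier_borel h) k" for k
    unfolding continuous_at_sequentially o_def fourier_borel_def
  proof (intro allI impI)
    fix u assume u: "u \<longlonglongrightarrow> k"
    show "(\<lambda>m. LINT y|lborel. cis (- (u m * y)) * h y) \<longlonglongrightarrow> (LINT y|lborel. cis (- (k * y)) * h y)"
      by (rule integral_dominated_convergence[where w = "\<lambda>y. norm (h y)"])
        (use assms in \<open>auto intro!: tendsto_intros u simp: norm_mult\<close>)
  qed
  then show ?thesis by (simp add: continuous_at_imp_continuous_on)
qed

lemma norm_fourier_borel_le:
  assumes "integrable lborel h"
  shows "norm (fourier_borel h k) \<le> (LINT y|lborel. norm (h y))"
  unfolding fourier_borel_def by (rule order_trans[OF integral_norm_bound]) (simp add: norm_mult)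

lemma has_vector_derivative_uniform_limit:
  fixes f f' :: "nat \<Rightarrow> real \<Rightarrow> complex"
  assumes "open S" "convex S" "x \<in> S"
    and f: "\<And>m x. x \<in> S \<Longrightarrow> (f m has_vector_derivative f' m x) (at x)"
    and g: "\<And>x. x \<in> S \<Longrightarrow> (\<lambda>m. f m x) \<longlonglongrightarrow> g x"
    and g': "uniform_limit S f' g' sequentially"
  shows "(g has_vector_derivative g' x) (at x)"
proof -
  have "\<exists>g0. \<forall>x\<in>S. (\<lambda>m. f m x) \<longlonglongrightarrow> g0 x \<and> (g0 has_derivative (\<lambda>h. h *\<^sub>R g' x)) (at x within S)"
  proof (rule has_derivative_sequence[where f = f and f' = "\<lambda>m x h. h *\<^sub>R f' m x",
        OF \<open>convex S\<close> _ _ \<open>x \<in> S\<close> g[OF \<open>x \<in> S\<close>]])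
    show "(f m has_derivative (\<lambda>h. h *\<^sub>R f' m x)) (at x within S)" if "x \<in> S" for m x
      using f[OF that] by (simp add: has_vector_derivative_def has_derivative_at_withinI)
    fix e :: real assume "e > 0"
    with g' have "\<forall>\<^sub>F m in sequentially. \<forall>x\<in>S. dist (f' m x) (g' x) < e"
      by (simp add: uniform_limit_iff)
    then show "\<forall>\<^sub>F m in sequentially. \<forall>x\<in>S. \<forall>h. norm (h *\<^sub>R f' m x - h *\<^sub>R g' x) \<le> e * norm h"
    proof eventually_elim
      case (elim m)
      have "norm (h *\<^sub>R f' m x - h *\<^sub>R g' x) = \<bar>h\<bar> * dist (f' m x) (g' x)" for h x
        by (simp add: dist_norm flip: scaleR_diff_right)
      moreover have "\<bar>h\<bar> * dist (f' m x) (g' x) \<le> \<bar>h\<bar> * e" if "x \<in> S" for h x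
        using elim that by (intro mult_left_mono) auto
      ultimately show ?case by (simp add: mult.commute)
    qed
  qed
  then obtain g0 where g0: "\<And>x. x \<in> S \<Longrightarrow> (\<lambda>m. f m x) \<longlonglongrightarrow> g0 x"
    "\<And>x. x \<in> S \<Longrightarrow> (g0 has_derivative (\<lambda>h. h *\<^sub>R g' x)) (at x within S)" by blast
  have eq: "g0 y = g y" if "y \<in> S" for y
    by (rule LIMSEQ_unique[OF g0(1)[OF that] g[OF that]])
  have "(g0 has_vector_derivative g' x) (at x)"
    using g0(2)[OF \<open>x \<in> S\<close>] unfolding has_vector_derivative_def at_within_open[OF \<open>x \<in> S\<close> \<open>open S\<close>] .
  then show ?thesis
    by (rule has_vector_derivative_transform_within_open[OF _ \<open>open S\<close> \<open>x \<in> S\<close> eq])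
qed

text \<open>The datum is a Borel function with exactly the critical weight \<open>s\<close>; a
  larger exponent is reduced to this one in the final theorem.\<close>

locale dispersive_datum =
  fixes p :: "real poly" and n :: nat and h :: "real \<Rightarrow> complex" and s :: real
  assumes deg: "degree p = n" and n: "2 \<le> n"
    and s_def: "s = (real n + 2) / (2 * (real n - 1))"
    and h_meas [measurable]: "h \<in> borel_measurable borel"
    and h_weighted: "integrable lborel (\<lambda>y. (1 + \<bar>y\<bar>) powr s * norm (h y))"
begin

lemma s_pos: "s > 0"
  using n by (simp add: s_def)

lemma h_integrable: "integrable lborel h"
proof (rule Bochner_Integration.integrable_bound[OF h_weighted])
  have "1 * norm (h y) \<le> (1 + \<bar>y\<bar>) powr s * norm (h y)" for y
    using s_pos by (intro mult_right_mono ge_one_powr_ge_zero) auto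
  then show "AE y in lborel. norm (h y) \<le> norm ((1 + \<bar>y\<bar>) powr s * norm (h y))" by simp
qed simp

text \<open>The cut-off solution for \<open>j = 0\<close> and its x-derivative of order j in
  general. In this frequency form the integral runs over a compact interval and can be
  differentiated freely; its convergence is read off from the convolution form instead.\<close>

definition approx :: "real \<Rightarrow> nat \<Rightarrow> real \<Rightarrow> real \<Rightarrow> complex" where
  "approx R j x t = \<i> ^ j / (2 * of_real pi) *
     integral {- R..R} (\<lambda>k. of_real (cutoff R j k) * cis (k * x - poly p k * t) * fourier_borel h k)"

text \<open>Fubini's theorem applies because on the compact frequency interval the kernel is bounded
  by \<open>(1 + R) ^ j\<close>, while \<open>h\<close> is integrable.\<close>

lemma approx_eq_convolution:
  assumes "R > 0"
  shows "approx R j x t = \<i> ^ j / (2 * of_real pi) * (LINT y|lborel. osc p R j (x - y) t * h y)"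
proof -
  let ?I = "{- R..R}"
  define a where "a k y = of_real (cutoff R j k) * cis (k * (x - y) - poly p k * t)" for k y
  have a_cont: "continuous_on UNIV (\<lambda>z. a (fst z) (snd z))"
    unfolding a_def by (intro osc_integrand_continuous continuous_intros)
  then have "(\<lambda>z. a (fst z) (snd z)) \<in> borel_measurable borel"
    by (rule borel_measurable_continuous_onI)
  then have a_meas [measurable]: "(\<lambda>z. a (fst z) (snd z)) \<in> borel_measurable (lborel \<Otimes>\<^sub>M lborel)"
    by (simp add: lborel_prod)
  have a_le: "norm (a k y) \<le> (1 + R) ^ j" if "k \<in> ?I" for k y
  proof -
    have "\<bar>cutoff R j k\<bar> \<le> \<bar>k\<bar> ^ j" using that assms by (intro cutoff_le_power) auto
    also have "\<dots> \<le> (1 + R) ^ j" using that by (intro power_mono) auto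
    finally show ?thesis by (simp add: a_def norm_mult)
  qed
  define F where "F k y = indicator ?I k *\<^sub>R (a k y * h y)" for k y
  have F_int: "integrable (lborel \<Otimes>\<^sub>M lborel) (\<lambda>(k, y). F k y)"
  proof (rule Bochner_Integration.integrable_bound[OF integrable_prod_mult])
    show "integrable lborel (\<lambda>k. indicator ?I k * (1 + R) ^ j)"
      by (intro integrable_mult_left integrable_real_indicator) (auto simp: emeasure_lborel_Icc_eq)
    show "integrable lborel (\<lambda>y. norm (h y))" using h_integrable by simp
    show "(\<lambda>(k, y). F k y) \<in> borel_measurable (lborel \<Otimes>\<^sub>M lborel)"
      unfolding F_def split_beta by measurable
    have "norm (F k y) \<le> norm (indicator ?I k * (1 + R) ^ j * norm (h y))" for k y
      using a_le[of k y] assms by (auto simp: F_def norm_mult indicator_def intro!: mult_right_mono)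
    then show "AE z in lborel \<Otimes>\<^sub>M lborel. norm (case z of (k, y) \<Rightarrow> F k y)
        \<le> norm (case z of (k, y) \<Rightarrow> indicator ?I k * (1 + R) ^ j * norm (h y))" by auto
  qed
  have 1: "(LINT y|lborel. F k y) = indicator ?I k *\<^sub>R (of_real (cutoff R j k) * cis (k * x - poly p k * t) * fourier_borel h k)" for k
  proof -
    have "a k y * h y = (of_real (cutoff R j k) * cis (k * x - poly p k * t)) * (cis (- (k * y)) * h y)" for y
      by (simp add: a_def cis_mult algebra_simps)
    then have "(LINT y|lborel. F k y) = (LINT y|lborel. indicator ?I k *\<^sub>R
        ((of_real (cutoff R j k) * cis (k * x - poly p k * t)) * (cis (- (k * y)) * h y)))"
      unfolding F_def by (simp only:)
    also have "\<dots> = indicator ?I k *\<^sub>R ((of_real (cutoff R j k) * cis (k * x - poly p k * t)) * fourier_borel h k)"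
      unfolding fourier_borel_def by (simp only: integral_scaleR_right integral_mult_right_zero)
    finally show ?thesis .
  qed
  have 2: "(LINT k|lborel. F k y) = osc p R j (x - y) t * h y" for y
  proof -
    have c: "continuous_on ?I (\<lambda>k. a k y)"
      unfolding a_def by (intro osc_integrand_continuous continuous_intros)
    have "(LINT k|lborel. F k y) = (LINT k|lborel. (indicator ?I k *\<^sub>R a k y) * h y)"
      by (simp add: F_def)
    also have "\<dots> = (LINT k:?I|lborel. a k y) * h y"
      unfolding set_lebesgue_integral_def by (rule integral_mult_left_zero)
    also have "(LINT k:?I|lborel. a k y) = osc p R j (x - y) t"
      using set_borel_integral_eq_integral(2)[OF borel_integrable_atLeastAtMost'[OF c]]
      by (simp add: osc_def a_def)
    finally show ?thesis .
  qed
  have c: "continuous_on ?I (\<lambda>k. of_real (cutoff R j k) * cis (k * x - poly p k * t) * fourier_borel h k)"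
    by (intro continuous_on_mult osc_integrand_continuous continuous_intros continuous_on_fourier_borel h_integrable)
  have "(LINT y|lborel. osc p R j (x - y) t * h y) = (LINT k|lborel. (LINT y|lborel. F k y))"
    unfolding 2[symmetric] by (rule lborel_pair.Fubini_integral[OF F_int])
  also have "\<dots> = (LINT k:?I|lborel. of_real (cutoff R j k) * cis (k * x - poly p k * t) * fourier_borel h k)"
    unfolding 1 set_lebesgue_integral_def ..
  also have "\<dots> = integral ?I (\<lambda>k. of_real (cutoff R j k) * cis (k * x - poly p k * t) * fourier_borel h k)"
    by (rule set_borel_integral_eq_integral(2)[OF borel_integrable_atLeastAtMost'[OF c]])
  finally show ?thesis by (simp add: approx_def)
qed

lemma osc_continuous: "continuous_on S (\<lambda>z. osc p R j z t)"
proof -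
  have "continuous_on UNIV (\<lambda>z. integral (cbox (- R) R) (\<lambda>k. complex_of_real (cutoff R j k) * cis (k * z - poly p k * t)))"
    by (rule integral_continuous_on_param)
      (auto simp: split_beta intro!: osc_integrand_continuous continuous_intros)
  then show ?thesis unfolding osc_def by (auto intro: continuous_on_subset)
qed

lemma osc_borel [measurable]: "(\<lambda>y. osc p R j (x - y) t) \<in> borel_measurable borel"
  by (intro borel_measurable_continuous_onI continuous_on_compose2[OF osc_continuous] continuous_intros) auto

lemma weighted_tail_small:
  assumes "\<delta> > 0"
  obtains Y where "(LINT y|lborel. indicator {y. \<bar>y\<bar> > Y} y * ((1 + \<bar>y\<bar>) powr s * norm (h y))) \<le> \<delta>"
proof -
  have "(\<lambda>m. LINT y|lborel. indicator {y. \<bar>y\<bar> > real m} y * ((1 + \<bar>y\<bar>) powr s * norm (h y)))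
      \<longlonglongrightarrow> (LINT y::real|lborel. 0)"
  proof (rule integral_dominated_convergence[OF _ _ h_weighted])
    have "(\<lambda>m. indicator {y. \<bar>y\<bar> > real m} y * ((1 + \<bar>y\<bar>) powr s * norm (h y))) \<longlonglongrightarrow> 0" for y
    proof (rule tendsto_eventually)
      obtain N where "\<bar>y\<bar> \<le> real N" using real_arch_simple by blast
      then show "\<forall>\<^sub>F m in sequentially. indicator {y. \<bar>y\<bar> > real m} y * ((1 + \<bar>y\<bar>) powr s * norm (h y)) = 0"
        by (intro eventually_sequentiallyI[of N]) (auto simp: indicator_def)
    qed
    then show "AE y in lborel. (\<lambda>m. indicator {y. \<bar>y\<bar> > real m} y * ((1 + \<bar>y\<bar>) powr s * norm (h y))) \<longlonglongrightarrow> 0"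
      by simp
  qed (auto simp: indicator_def)
  then have "\<forall>\<^sub>F m in sequentially. (LINT y|lborel. indicator {y. \<bar>y\<bar> > real m} y * ((1 + \<bar>y\<bar>) powr s * norm (h y))) < \<delta>"
    using assms by (intro order_tendstoD(2)[where y = 0]) auto
  then obtain N where "(LINT y|lborel. indicator {y. \<bar>y\<bar> > real N} y * ((1 + \<bar>y\<bar>) powr s * norm (h y))) < \<delta>"
    unfolding eventually_sequentially by blast
  then show ?thesis using that[of "real N"] by simp
qed

text \<open>The convolution is split at \<open>\<bar>y\<bar> = Y\<close>. For small y the kernels
  are uniformly close and are integrated against \<open>h\<close>; for large y both obey the
  weighted bound and meet only the small weighted tail of \<open>h\<close>.\<close>

lemma approx_cauchy:
  assumes "0 < t1" "t1 \<le> t2" "0 < e"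
  obtains R0 where "\<And>R R' j t x. \<lbrakk>R0 \<le> R; R0 \<le> R'; j \<le> n; t1 \<le> t; t \<le> t2; \<bar>x\<bar> \<le> X\<rbrakk> \<Longrightarrow>
     norm (approx R j x t - approx R' j x t) \<le> e"
proof -
  obtain D R1 where D: "0 \<le> D" "1 \<le> R1" "\<And>R j t z. \<lbrakk>R1 \<le> R; j \<le> n; t1 \<le> t; t \<le> t2\<rbrakk> \<Longrightarrow>
       norm (osc p R j z t) \<le> D * (1 + \<bar>z\<bar>) powr s"
    by (rule osc_bound[OF deg n assms(1,2), folded s_def]) (rule that)
  \<comment> \<open>\<open>E\<close> bounds the sum of two kernels relative to the weight in y. The
    added 1 keeps it a legitimate divisor when \<open>D = 0\<close>; the same holds for
    \<open>L + 1\<close> in \<eta>.\<close>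
  define E where "E = 2 * D * (1 + \<bar>X\<bar>) powr s + 1"
  have E: "E > 0" unfolding E_def using D by (intro add_nonneg_pos) auto
  define \<delta> where "\<delta> = e / (2 * E)"
  have "\<delta> > 0" using assms E by (simp add: \<delta>_def)
  then obtain Y where Y: "(LINT y|lborel. indicator {y. \<bar>y\<bar> > Y} y * ((1 + \<bar>y\<bar>) powr s * norm (h y))) \<le> \<delta>"
    by (rule weighted_tail_small)
  define L where "L = (LINT y|lborel. norm (h y))"
  have L: "L \<ge> 0" by (simp add: L_def)
  define \<eta> where "\<eta> = e / (2 * (L + 1))"
  have \<eta>: "\<eta> > 0" using assms L by (simp add: \<eta>_def)
  obtain R0 where R0: "\<And>R R' j t z. \<lbrakk>R0 \<le> R; R0 \<le> R'; j \<le> n; t1 \<le> t; t \<le> t2; \<bar>z\<bar> \<le> \<bar>X\<bar> + Y\<rbrakk> \<Longrightarrow>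
       norm (osc p R j z t - osc p R' j z t) \<le> \<eta>"
    by (rule osc_cauchy[OF deg n assms(1,2) \<eta>, where Z = "\<bar>X\<bar> + Y"]) (rule that)
  show ?thesis
  proof (rule that[of "max R0 R1"])
    fix R R' j t x
    assume *: "max R0 R1 \<le> R" "max R0 R1 \<le> R'" "j \<le> n" "t1 \<le> t" "t \<le> t2" "\<bar>x\<bar> \<le> X"
    let ?w = "\<lambda>y. (1 + \<bar>y\<bar>) powr s * norm (h y)"
    let ?d = "\<lambda>y. (osc p R j (x - y) t - osc p R' j (x - y) t) * h y"
    \<comment> \<open>The weight is submultiplicative, so growth in \<open>x - y\<close> becomes
      growth in y at the price of a factor that is uniform for
      \<open>\<bar>x\<bar> \<le> X\<close>.\<close>
    have wt: "(1 + \<bar>x - y\<bar>) powr s \<le> (1 + \<bar>X\<bar>) powr s * (1 + \<bar>y\<bar>) powr s" for y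
    proof -
      have "1 + \<bar>x - y\<bar> \<le> (1 + \<bar>X\<bar>) * (1 + \<bar>y\<bar>)"
      proof -
        have "0 \<le> \<bar>X\<bar> * \<bar>y\<bar>" by simp
        moreover have "\<bar>x - y\<bar> \<le> \<bar>X\<bar> + \<bar>y\<bar>" using *(6) by linarith
        moreover have "(1 + \<bar>X\<bar>) * (1 + \<bar>y\<bar>) = 1 + \<bar>X\<bar> + \<bar>y\<bar> + \<bar>X\<bar> * \<bar>y\<bar>" by (simp add: algebra_simps)
        ultimately show ?thesis by linarith
      qed
      then have "(1 + \<bar>x - y\<bar>) powr s \<le> ((1 + \<bar>X\<bar>) * (1 + \<bar>y\<bar>)) powr s"
        using s_pos by (intro powr_mono2) auto
      then show ?thesis by (simp add: powr_mult)
    qed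
    have osc_int: "integrable lborel (\<lambda>y. osc p R j (x - y) t * h y)" if "R1 \<le> R" for R
    proof (rule Bochner_Integration.integrable_bound[OF integrable_mult_right[OF h_weighted, of "D * (1 + \<bar>X\<bar>) powr s"]])
      have "norm (osc p R j (x - y) t * h y) \<le> D * ((1 + \<bar>X\<bar>) powr s * (1 + \<bar>y\<bar>) powr s) * norm (h y)" for y
        unfolding norm_mult using D(1) wt[of y] *
        by (intro mult_right_mono order_trans[OF D(3)[OF that *(3-5)] mult_left_mono]) auto
      then show "AE y in lborel. norm (osc p R j (x - y) t * h y) \<le> norm (D * (1 + \<bar>X\<bar>) powr s * ((1 + \<bar>y\<bar>) powr s * norm (h y)))"
        using D(1) by (simp add: mult_ac abs_mult)
    qed simp
    have ptw: "norm (?d y) \<le> \<eta> * norm (h y) + E * (indicator {y. \<bar>y\<bar> > Y} y * ?w y)" for y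
    proof (cases "\<bar>y\<bar> > Y")
      case False
      then have "norm (osc p R j (x - y) t - osc p R' j (x - y) t) \<le> \<eta>"
        using * by (intro R0) auto
      then have "norm (?d y) \<le> \<eta> * norm (h y)" by (auto simp: norm_mult intro!: mult_right_mono)
      then show ?thesis using False by simp
    next
      case True
      have "norm (osc p R j (x - y) t - osc p R' j (x - y) t)
          \<le> D * (1 + \<bar>x - y\<bar>) powr s + D * (1 + \<bar>x - y\<bar>) powr s"
        using * by (intro order_trans[OF norm_triangle_ineq4] add_mono D) auto
      also have "\<dots> \<le> 2 * D * ((1 + \<bar>X\<bar>) powr s * (1 + \<bar>y\<bar>) powr s)"
        using mult_left_mono[OF wt D(1), of y] by simp
      also have "\<dots> \<le> E * (1 + \<bar>y\<bar>) powr s" by (simp add: E_def algebra_simps)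
      finally have "norm (?d y) \<le> E * (1 + \<bar>y\<bar>) powr s * norm (h y)"
        by (auto simp: norm_mult intro!: mult_right_mono)
      moreover have "0 \<le> \<eta> * norm (h y)" using \<eta> by simp
      ultimately show ?thesis using True by (simp add: mult.assoc)
    qed
    have int1: "integrable lborel (\<lambda>y. \<eta> * norm (h y))" using h_integrable by simp
    have "integrable lborel (\<lambda>y. indicator {y. \<bar>y\<bar> > Y} y * ?w y)"
      by (rule Bochner_Integration.integrable_bound[OF h_weighted]) (auto simp: indicator_def)
    then have int2: "integrable lborel (\<lambda>y. E * (indicator {y. \<bar>y\<bar> > Y} y * ?w y))" by simp
    have R: "R > 0" "R' > 0" "R1 \<le> R" "R1 \<le> R'" using * D by auto
    have "approx R j x t - approx R' j x t = \<i> ^ j / (2 * of_real pi) * (LINT y|lborel. ?d y)"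
      using osc_int[OF R(3)] osc_int[OF R(4)]
      by (simp add: approx_eq_convolution R left_diff_distrib right_diff_distrib)
    also have "norm \<dots> \<le> 1 * norm (LINT y|lborel. ?d y)"
      unfolding norm_mult using pi_gt3 by (intro mult_right_mono) (auto simp: norm_divide norm_power)
    also have "\<dots> \<le> (LINT y|lborel. norm (?d y))" by simp
    also have "\<dots> \<le> (LINT y|lborel. \<eta> * norm (h y) + E * (indicator {y. \<bar>y\<bar> > Y} y * ?w y))"
      using osc_int[OF R(3)] osc_int[OF R(4)]
      by (intro integral_mono ptw Bochner_Integration.integrable_add int1 int2 integrable_norm)
        (simp add: left_diff_distrib)
    also have "\<dots> = \<eta> * L + E * (LINT y|lborel. indicator {y. \<bar>y\<bar> > Y} y * ?w y)"
      using int1 int2 by (simp add: L_def)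
    also have "\<dots> \<le> \<eta> * (L + 1) + E * \<delta>"
      using Y E \<eta> by (intro add_mono mult_left_mono) auto
    also have "\<dots> = e" using E L by (simp add: \<eta>_def \<delta>_def field_simps)
    finally show "norm (approx R j x t - approx R' j x t) \<le> e" .
  qed
qed

text \<open>\<open>lim\<close> is known to be a genuine limit for \<open>0 < t\<close> and
  \<open>j \<le> n\<close>; for other arguments the value is left unspecified.\<close>

definition sol :: "nat \<Rightarrow> real \<Rightarrow> real \<Rightarrow> complex" where
  "sol j x t = lim (\<lambda>m. approx (real m) j x t)"

lemma sol_uniform:
  assumes "0 < t1" "t1 \<le> t2" "0 < e"
  obtains m0 where "\<And>m j t x. \<lbrakk>m0 \<le> m; j \<le> n; t1 \<le> t; t \<le> t2; \<bar>x\<bar> \<le> X\<rbrakk> \<Longrightarrow>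
     (\<lambda>m. approx (real m) j x t) \<longlonglongrightarrow> sol j x t \<and> norm (approx (real m) j x t - sol j x t) \<le> e"
proof -
  have lim: "(\<lambda>m. approx (real m) j x t) \<longlonglongrightarrow> sol j x t"
    if *: "j \<le> n" "t1 \<le> t" "t \<le> t2" "\<bar>x\<bar> \<le> X" for j x t
  proof -
    have "Cauchy (\<lambda>m. approx (real m) j x t)"
    proof (rule metric_CauchyI)
      fix e :: real assume "0 < e"
      then have "0 < e / 2" by simp
      obtain R0 where R0: "\<And>R R' j t x. \<lbrakk>R0 \<le> R; R0 \<le> R'; j \<le> n; t1 \<le> t; t \<le> t2; \<bar>x\<bar> \<le> X\<rbrakk> \<Longrightarrow>
          norm (approx R j x t - approx R' j x t) \<le> e / 2"
        by (rule approx_cauchy[OF assms(1,2) \<open>0 < e / 2\<close>, where X = X]) (rule that)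
      obtain N where N: "R0 \<le> real N" using real_arch_simple by blast
      show "\<exists>M. \<forall>m\<ge>M. \<forall>m'\<ge>M. dist (approx (real m) j x t) (approx (real m') j x t) < e"
      proof (intro exI allI impI)
        fix m m' assume "N \<le> m" "N \<le> m'"
        then have "norm (approx (real m) j x t - approx (real m') j x t) \<le> e / 2"
          using N * by (intro R0) auto
        then show "dist (approx (real m) j x t) (approx (real m') j x t) < e"
          using \<open>0 < e\<close> by (simp add: dist_norm)
      qed
    qed
    then show ?thesis
      unfolding sol_def by (simp add: Cauchy_convergent_iff convergent_LIMSEQ_iff)
  qed
  obtain R0 where R0: "\<And>R R' j t x. \<lbrakk>R0 \<le> R; R0 \<le> R'; j \<le> n; t1 \<le> t; t \<le> t2; \<bar>x\<bar> \<le> X\<rbrakk> \<Longrightarrow>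
      norm (approx R j x t - approx R' j x t) \<le> e"
    by (rule approx_cauchy[OF assms, where X = X]) (rule that)
  obtain N where N: "R0 \<le> real N" using real_arch_simple by blast
  show ?thesis
  proof (rule that[of "Suc N"])
    fix m j t x assume *: "Suc N \<le> m" "j \<le> n" "t1 \<le> t" "t \<le> t2" "\<bar>x\<bar> \<le> X"
    have "norm (approx (real m) j x t - sol j x t) \<le> e"
    proof (rule Lim_norm_ubound[OF _ tendsto_diff[OF tendsto_const lim[OF *(2-)]]])
      show "\<forall>\<^sub>F m' in sequentially. norm (approx (real m) j x t - approx (real m') j x t) \<le> e"
        using N * by (intro eventually_sequentiallyI[of N] R0) auto
    qed simp
    with lim[OF *(2-)] show "(\<lambda>m. approx (real m) j x t) \<longlonglongrightarrow> sol j x t \<and>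
      norm (approx (real m) j x t - sol j x t) \<le> e" by simp
  qed
qed

lemma sol_limit:
  assumes "0 < t" "j \<le> n"
  shows "(\<lambda>m. approx (real m) j x t) \<longlonglongrightarrow> sol j x t"
proof (rule sol_uniform[OF assms(1) order_refl zero_less_one, where X = "\<bar>x\<bar>"])
  fix m0
  assume "\<And>m j t' x'. \<lbrakk>m0 \<le> m; j \<le> n; t \<le> t'; t' \<le> t; \<bar>x'\<bar> \<le> \<bar>x\<bar>\<rbrakk> \<Longrightarrow>
     (\<lambda>m. approx (real m) j x' t') \<longlonglongrightarrow> sol j x' t' \<and> norm (approx (real m) j x' t' - sol j x' t') \<le> 1"
  from this[OF order_refl assms(2) order_refl order_refl order_refl] show ?thesis ..
qed

text \<open>Differentiation under the integral sign produces the factor \<open>\<i> * k\<close>, and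
  \<open>k * cutoff R j k = cutoff R (Suc j) k\<close>. This is why the power of k is built into
  \<open>cutoff\<close>.\<close>

lemma approx_deriv_x:
  "((\<lambda>x. approx R j x t) has_vector_derivative approx R (Suc j) x t) (at x)"
proof -
  let ?F = "\<lambda>x k. of_real (cutoff R j k) * cis (k * x - poly p k * t) * fourier_borel h k"
  let ?F' = "\<lambda>x k. \<i> * (of_real (cutoff R (Suc j) k) * cis (k * x - poly p k * t) * fourier_borel h k)"
  note cont = continuous_on_compose2[OF continuous_on_fourier_borel[OF h_integrable, of UNIV]]
  have 1: "((\<lambda>x. integral (cbox (- R) R) (?F x)) has_vector_derivative integral (cbox (- R) R) (?F' x)) (at x within UNIV)"
  proof (rule leibniz_rule_vector_derivative)
    fix x k
    have "((\<lambda>x. k * x - poly p k * t) has_real_derivative k) (at x)"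
      by (auto intro!: derivative_eq_intros)
    from has_vector_derivative_mult_left[OF has_vector_derivative_mult_right[OF has_vector_derivative_cis[OF this]], of "complex_of_real (cutoff R j k)" "fourier_borel h k"]
    show "((\<lambda>x. ?F x k) has_vector_derivative ?F' x k) (at x within UNIV)"
      by (simp add: cutoff_def mult_ac)
  next
    show "?F x integrable_on cbox (- R) R" for x
      by (intro integrable_continuous continuous_on_mult osc_integrand_continuous continuous_intros
          continuous_on_fourier_borel h_integrable)
    show "continuous_on (UNIV \<times> cbox (- R) R) (\<lambda>(x, k). ?F' x k)"
      unfolding split_beta
      by (intro continuous_on_mult osc_integrand_continuous continuous_intros cont) auto
  qed auto
  have 2: "integral {- R..R} (?F' x)
      = \<i> * integral {- R..R} (\<lambda>k. of_real (cutoff R (Suc j) k) * cis (k * x - poly p k * t) * fourier_borel h k)"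
    by (rule integral_mult_right)
  have 3: "\<i> ^ j / (2 * complex_of_real pi) * (\<i> * X) = \<i> ^ Suc j / (2 * complex_of_real pi) * X" for X
    by simp
  show ?thesis
    unfolding approx_def 3[symmetric]
    by (rule has_vector_derivative_mult_right) (rule 1[unfolded cbox_interval 2])
qed

end

lemma uniform_limit_sum:
  fixes f :: "'i \<Rightarrow> 'a \<Rightarrow> 'b \<Rightarrow> 'c::real_normed_vector"
  assumes "\<And>i. i \<in> I \<Longrightarrow> uniform_limit S (f i) (g i) F"
  shows "uniform_limit S (\<lambda>m x. \<Sum>i\<in>I. f i m x) (\<lambda>x. \<Sum>i\<in>I. g i x) F"
  using assms
  by (induction I rule: infinite_finite_induct) (auto intro!: uniform_limit_add uniform_limit_const)

context dispersive_datum
begin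

text \<open>The cutoff multiplies by a function of k alone and thus commutes with the evolution:
  every cut-off solution satisfies the equation exactly. The factors \<open>(- \<i>) ^ j\<close>
  cancel the \<open>\<i> ^ j\<close> in \<open>approx\<close>.\<close>

lemma approx_deriv_t:
  "((\<lambda>t. approx R 0 x t) has_vector_derivative
     - \<i> * (\<Sum>j\<le>n. of_real (coeff p j) * (- \<i>) ^ j * approx R j x t)) (at t)"
proof -
  define F where "F j t k = of_real (cutoff R j k) * cis (k * x - poly p k * t) * fourier_borel h k" for j t k
  let ?F' = "\<lambda>t k. - \<i> * (\<Sum>j\<le>n. of_real (coeff p j) * F j t k)"
  note cont = continuous_on_compose2[OF continuous_on_fourier_borel[OF h_integrable, of UNIV]]
  have F_cont: "continuous_on (S :: real set) (F j t)" for S j t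
    unfolding F_def by (intro continuous_on_mult osc_integrand_continuous continuous_intros
        continuous_on_fourier_borel h_integrable)
  have 1: "((\<lambda>t. integral (cbox (- R) R) (F 0 t)) has_vector_derivative integral (cbox (- R) R) (?F' t)) (at t within UNIV)"
  proof (rule leibniz_rule_vector_derivative)
    fix t k
    have "((\<lambda>t. k * x - poly p k * t) has_real_derivative - poly p k) (at t)"
      by (auto intro!: derivative_eq_intros)
    from has_vector_derivative_mult_left[OF has_vector_derivative_mult_right[OF has_vector_derivative_cis[OF this]],
        of "complex_of_real (cutoff R 0 k)" "fourier_borel h k"]
    have "((\<lambda>t. F 0 t k) has_vector_derivative - \<i> * of_real (poly p k) * F 0 t k) (at t)"
      unfolding F_def by (simp add: mult_ac)
    moreover have "of_real (poly p k) * F 0 t k = (\<Sum>j\<le>n. of_real (coeff p j) * F j t k)"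
      unfolding poly_altdef deg F_def cutoff_def by (simp add: sum_distrib_left sum_distrib_right mult_ac)
    ultimately show "((\<lambda>t. F 0 t k) has_vector_derivative ?F' t k) (at t within UNIV)"
      by (simp add: mult.assoc)
  next
    show "F 0 t integrable_on cbox (- R) R" for t
      by (intro integrable_continuous F_cont)
    show "continuous_on (UNIV \<times> cbox (- R) R) (\<lambda>(t, k). ?F' t k)"
      unfolding split_beta F_def
      by (intro continuous_on_mult osc_integrand_continuous continuous_intros cont) auto
  qed auto
  have int: "F j t integrable_on {- R..R}" for j t
    by (intro integrable_continuous_real F_cont)
  have 2: "integral {- R..R} (?F' t) = - \<i> * (\<Sum>j\<le>n. of_real (coeff p j) * integral {- R..R} (F j t))"
    using int by (simp add: Henstock_Kurzweil_Integration.integral_sum integrable_on_mult_right)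
  have 3: "(- \<i>) ^ j * approx R j x t = 1 / (2 * complex_of_real pi) * integral {- R..R} (F j t)" for j
  proof -
    have "(- \<i>) ^ j * \<i> ^ j = (1 :: complex)" by (simp flip: power_mult_distrib)
    then show ?thesis by (simp add: approx_def F_def[abs_def])
  qed
  have "(\<lambda>t. approx R 0 x t) = (\<lambda>t. 1 / (2 * complex_of_real pi) * integral {- R..R} (F 0 t))"
    by (simp add: approx_def F_def[abs_def])
  moreover have "- \<i> * (\<Sum>j\<le>n. of_real (coeff p j) * (- \<i>) ^ j * approx R j x t)
     = 1 / (2 * complex_of_real pi) * integral {- R..R} (?F' t)"
    unfolding 2 mult.assoc 3 by (simp add: sum_distrib_left mult_ac)
  ultimately show ?thesis
    using has_vector_derivative_mult_right[OF 1[unfolded cbox_interval], of "1 / (2 * complex_of_real pi)"]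
    by simp
qed

lemma sol_uniform_limit:
  assumes "0 < t1" "t1 \<le> t2" "j \<le> n"
  shows "uniform_limit ({- X..X} \<times> {t1..t2}) (\<lambda>m (x, t). approx (real m) j x t) (\<lambda>(x, t). sol j x t) sequentially"
proof (rule uniform_limitI)
  fix e :: real assume "0 < e"
  then have "0 < e / 2" by simp
  show "\<forall>\<^sub>F m in sequentially. \<forall>z\<in>{- X..X} \<times> {t1..t2}.
      dist (case z of (x, t) \<Rightarrow> approx (real m) j x t) (case z of (x, t) \<Rightarrow> sol j x t) < e"
  proof (rule sol_uniform[OF assms(1,2) \<open>0 < e / 2\<close>, where X = X])
    fix m0
    assume H: "\<And>m j t x. \<lbrakk>m0 \<le> m; j \<le> n; t1 \<le> t; t \<le> t2; \<bar>x\<bar> \<le> X\<rbrakk> \<Longrightarrow>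
     (\<lambda>m. approx (real m) j x t) \<longlonglongrightarrow> sol j x t \<and> norm (approx (real m) j x t - sol j x t) \<le> e / 2"
    show ?thesis
    proof (intro eventually_sequentiallyI[of m0] ballI)
      fix m z assume *: "m0 \<le> m" "z \<in> {- X..X} \<times> {t1..t2}"
      obtain x t where z: "z = (x, t)" "\<bar>x\<bar> \<le> X" "t1 \<le> t" "t \<le> t2" using * by force
      from H[OF *(1) assms(3) z(3,4,2)] \<open>0 < e\<close>
      show "dist (case z of (x, t) \<Rightarrow> approx (real m) j x t) (case z of (x, t) \<Rightarrow> sol j x t) < e"
        by (simp add: z dist_norm)
    qed
  qed
qed

lemma sol_deriv_x:
  assumes "0 < t" "j < n"
  shows "((\<lambda>x. sol j x t) has_vector_derivative sol (Suc j) x t) (at x)"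
proof (rule has_vector_derivative_uniform_limit[where S = "{x - 1<..<x + 1}" and f = "\<lambda>m x. approx (real m) j x t"
      and f' = "\<lambda>m x. approx (real m) (Suc j) x t"])
  show "(\<lambda>m. approx (real m) j y t) \<longlonglongrightarrow> sol j y t" for y
    using assms by (intro sol_limit) auto
  have "uniform_limit {x - 1<..<x + 1} (\<lambda>m y. (case (y, t) of (x, t) \<Rightarrow> approx (real m) (Suc j) x t))
      (\<lambda>y. case (y, t) of (x, t) \<Rightarrow> sol (Suc j) x t) sequentially"
    by (rule uniform_limit_compose'[OF sol_uniform_limit[of t t "Suc j" "\<bar>x\<bar> + 1"]]) (use assms in auto)
  then show "uniform_limit {x - 1<..<x + 1} (\<lambda>m x. approx (real m) (Suc j) x t) (\<lambda>x. sol (Suc j) x t) sequentially"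
    by simp
qed (auto intro: approx_deriv_x)

lemma sol_deriv_t:
  assumes "0 < t"
  shows "((\<lambda>t. sol 0 x t) has_vector_derivative
     - \<i> * (\<Sum>j\<le>n. of_real (coeff p j) * (- \<i>) ^ j * sol j x t)) (at t)"
\<comment> \<open>The neighbourhood lies in the compact interval from \<open>t / 2\<close> to
  \<open>2 * t\<close>, away from time 0, where the kernel constants blow up.\<close>
proof (rule has_vector_derivative_uniform_limit[where S = "{t / 2<..<2 * t}" and f = "\<lambda>m t. approx (real m) 0 x t"
      and f' = "\<lambda>m t. - \<i> * (\<Sum>j\<le>n. of_real (coeff p j) * (- \<i>) ^ j * approx (real m) j x t)"])
  show "(\<lambda>m. approx (real m) 0 x t') \<longlonglongrightarrow> sol 0 x t'" if "t' \<in> {t / 2<..<2 * t}" for t'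
    using that assms by (intro sol_limit) auto
  have lim: "uniform_limit {t / 2<..<2 * t} (\<lambda>m t. approx (real m) j x t) (\<lambda>t. sol j x t) sequentially"
    if "j \<le> n" for j
  proof -
    have "uniform_limit {t / 2<..<2 * t} (\<lambda>m t. (case (x, t) of (x, t) \<Rightarrow> approx (real m) j x t))
        (\<lambda>t. case (x, t) of (x, t) \<Rightarrow> sol j x t) sequentially"
      by (rule uniform_limit_compose'[OF sol_uniform_limit[of "t / 2" "2 * t" j "\<bar>x\<bar>"]]) (use assms that in auto)
    then show ?thesis by simp
  qed
  show "uniform_limit {t / 2<..<2 * t}
      (\<lambda>m t. - \<i> * (\<Sum>j\<le>n. of_real (coeff p j) * (- \<i>) ^ j * approx (real m) j x t))
      (\<lambda>t. - \<i> * (\<Sum>j\<le>n. of_real (coeff p j) * (- \<i>) ^ j * sol j x t)) sequentially"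
    by (intro bounded_linear.uniform_limit[OF bounded_linear_mult_right] uniform_limit_sum lim) auto
  show "((\<lambda>t. approx (real m) 0 x t) has_vector_derivative
     - \<i> * (\<Sum>j\<le>n. of_real (coeff p j) * (- \<i>) ^ j * approx (real m) j x t')) (at t')" for m t'
    by (rule approx_deriv_t)
qed (use assms in auto)

lemma classical_solution_sol:
  assumes q: "\<And>x t. 0 < t \<Longrightarrow> q x t = sol 0 x t"
  shows "classical_solution p q (UNIV \<times> {0<..})"
proof -
  have dxq: "(dx ^^ j) q x t = sol j x t" if "0 < t" "j \<le> n" for j x t
    using that(2)
  proof (induction j arbitrary: x)
    case 0
    then show ?case using q that by simp
  next
    case (Suc j)
    then have "(dx ^^ Suc j) q x t = vector_derivative (\<lambda>y. sol j y t) (at x)"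
      by (simp add: dx_def[of "(dx ^^ j) q"])
    also have "\<dots> = sol (Suc j) x t"
      using Suc.prems that by (intro vector_derivative_at sol_deriv_x) auto
    finally show ?case .
  qed
  \<comment> \<open>The time derivative needs agreement of \<open>q\<close> with
    \<open>sol 0\<close> at neighbouring times, which the openness of \<open>{0<..}\<close>
    provides; x-derivatives are taken at a fixed time.\<close>
  have dtq: "((\<lambda>s. q x s) has_vector_derivative
     - \<i> * (\<Sum>j\<le>n. of_real (coeff p j) * (- \<i>) ^ j * sol j x t)) (at t)" if "0 < t" for x t
    by (rule has_vector_derivative_transform_within_open[OF sol_deriv_t[OF that], where S = "{0<..}"])
      (use that q in auto)
  show ?thesis
    unfolding classical_solution_def
  proof (intro conjI ballI)
    show "open (UNIV \<times> {0::real<..} :: (real \<times> real) set)" by (intro open_Times) auto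
    fix z :: "real \<times> real" assume z: "z \<in> UNIV \<times> {0<..}"
    obtain x t where zx: "z = (x, t)" by (cases z)
    with z have t: "0 < t" by simp
    have "(\<lambda>s. q x s) differentiable (at t)"
      using dtq[OF t] by (rule differentiableI_vector)
    moreover have "(\<lambda>y. (dx ^^ j) q y t) differentiable (at x)" if "j < degree p" for j
    proof -
      have "(\<lambda>y. (dx ^^ j) q y t) = (\<lambda>y. sol j y t)" using dxq[OF t] that deg by simp
      then show ?thesis using sol_deriv_x[OF t] that deg by (auto intro: differentiableI_vector)
    qed
    moreover have "\<i> * dt q x t - dispersion_op p q x t = 0"
    proof -
      have "dt q x t = - \<i> * (\<Sum>j\<le>n. of_real (coeff p j) * (- \<i>) ^ j * sol j x t)"
        unfolding dt_def by (rule vector_derivative_at[OF dtq[OF t]])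
      moreover have "dispersion_op p q x t = (\<Sum>j\<le>n. of_real (coeff p j) * (- \<i>) ^ j * sol j x t)"
        unfolding dispersion_op_def deg using dxq[OF t] by (intro sum.cong) auto
      ultimately show ?thesis by simp
    qed
    ultimately show "case z of (x, t) \<Rightarrow> (\<lambda>s. q x s) differentiable (at t) \<and>
        (\<forall>j<degree p. (\<lambda>y. (dx ^^ j) q y t) differentiable (at x)) \<and>
        \<i> * dt q x t - dispersion_op p q x t = 0"
      by (simp add: zx)
  qed
qed

end

section \<open>Plancherel's inequality\<close>

lemma cnj_borel_measurable [measurable]:
  "f \<in> borel_measurable M \<Longrightarrow> (\<lambda>x. cnj (f x)) \<in> borel_measurable M"
  by (rule borel_measurable_continuous_on[of cnj]) (auto intro: continuous_intros)

lemma gaussian_integrable: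
  assumes "\<sigma> > 0"
  shows "integrable lborel (\<lambda>k. exp (- (\<sigma> * k)\<^sup>2 / 2) :: real)"
proof -
  have "exp (- (\<sigma> * k)\<^sup>2 / 2) = sqrt (2 * pi * (1 / \<sigma>)\<^sup>2) * normal_density 0 (1 / \<sigma>) k" for k
    using assms by (simp add: normal_density_def power_mult_distrib power_divide mult.commute)
  then show ?thesis using assms by simp
qed

text \<open>Up to the substitution \<open>v = \<sigma> * k\<close> this is the characteristic
  function of the standard normal distribution.\<close>

lemma gaussian_fourier:
  assumes "\<sigma> > 0"
  shows "(LINT k|lborel. complex_of_real (exp (- (\<sigma> * k)\<^sup>2 / 2)) * cis (k * u)) = of_real (2 * pi * normal_density 0 \<sigma> u)"
proof -
  have "(LINT v|lborel. std_normal_density v *\<^sub>R iexp ((u / \<sigma>) * v)) = char std_normal_distribution (u / \<sigma>)"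
    unfolding char_def by (rule integral_density[symmetric]) auto
  also have "\<dots> = of_real (exp (- (u / \<sigma>)\<^sup>2 / 2))"
    by (simp add: char_std_normal_distribution)
  finally have 1: "(LINT v|lborel. std_normal_density v *\<^sub>R iexp ((u / \<sigma>) * v)) = of_real (exp (- (u / \<sigma>)\<^sup>2 / 2))" .
  have "(LINT v|lborel. std_normal_density v *\<^sub>R iexp ((u / \<sigma>) * v))
      = \<bar>\<sigma>\<bar> *\<^sub>R (LINT k|lborel. std_normal_density (0 + \<sigma> * k) *\<^sub>R iexp ((u / \<sigma>) * (0 + \<sigma> * k)))"
    using assms by (intro lborel_integral_real_affine) auto
  also have "(\<lambda>k. std_normal_density (0 + \<sigma> * k) *\<^sub>R iexp ((u / \<sigma>) * (0 + \<sigma> * k)))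
      = (\<lambda>k. (1 / sqrt (2 * pi)) *\<^sub>R (complex_of_real (exp (- (\<sigma> * k)\<^sup>2 / 2)) * cis (k * u)))"
    using assms by (simp add: std_normal_density_def cis_conv_exp scaleR_conv_of_real mult_ac)
  also have "(LINT k|lborel. (1 / sqrt (2 * pi)) *\<^sub>R (complex_of_real (exp (- (\<sigma> * k)\<^sup>2 / 2)) * cis (k * u)))
      = (1 / sqrt (2 * pi)) *\<^sub>R (LINT k|lborel. complex_of_real (exp (- (\<sigma> * k)\<^sup>2 / 2)) * cis (k * u))"
    by (rule integral_scaleR_right)
  finally have "of_real (exp (- (u / \<sigma>)\<^sup>2 / 2)) = \<bar>\<sigma>\<bar> *\<^sub>R ((1 / sqrt (2 * pi)) *\<^sub>R
      (LINT k|lborel. complex_of_real (exp (- (\<sigma> * k)\<^sup>2 / 2)) * cis (k * u)))"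
    unfolding 1 .
  then have "(LINT k|lborel. complex_of_real (exp (- (\<sigma> * k)\<^sup>2 / 2)) * cis (k * u))
      = of_real (sqrt (2 * pi) / \<sigma> * exp (- (u / \<sigma>)\<^sup>2 / 2))"
    using assms by (simp add: scaleR_conv_of_real field_simps)
  also have "sqrt (2 * pi) / \<sigma> * exp (- (u / \<sigma>)\<^sup>2 / 2) = 2 * pi * normal_density 0 \<sigma> u"
  proof -
    have "sqrt (2 * pi * \<sigma>\<^sup>2) = sqrt (2 * pi) * \<sigma>" using assms by (simp add: real_sqrt_mult)
    moreover have "2 * pi = sqrt (2 * pi) * sqrt (2 * pi)" by simp
    ultimately show ?thesis using assms
      by (simp add: normal_density_def power_divide field_simps)
  qed
  finally show ?thesis .
qed

lemma nn_integral_normal_density: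
  assumes "\<sigma> > 0"
  shows "(\<integral>\<^sup>+ x. ennreal (normal_density \<mu> \<sigma> x) \<partial>lborel) = 1"
  using assms by (simp add: nn_integral_eq_integral)

text \<open>The Gaussian weight makes all double integrals absolutely convergent. Expanding the
  squared transform turns the weight into a normal density in \<open>x - y\<close>, which has total
  mass 1 in either variable. The integrals are extended real because \<open>g\<close> is only
  assumed integrable, so the right-hand side may be infinite.\<close>

lemma Plancherel_le_gaussian:
  fixes g :: "real \<Rightarrow> complex"
  assumes g: "integrable lborel g" and \<sigma>: "\<sigma> > 0"
  shows "(\<integral>\<^sup>+ k. ennreal (exp (- (\<sigma> * k)\<^sup>2 / 2) * (norm (fourier_borel g k))\<^sup>2) \<partial>lborel)
    \<le> ennreal (2 * pi) * (\<integral>\<^sup>+ x. ennreal ((norm (g x))\<^sup>2) \<partial>lborel)"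
proof -
  have [measurable]: "g \<in> borel_measurable borel" using g by auto
  let ?w = "\<lambda>k::real. exp (- (\<sigma> * k)\<^sup>2 / 2)"
  let ?G = "fourier_borel g"
  let ?N = "\<lambda>x y. normal_density y \<sigma> x"
  have [measurable]: "?G \<in> borel_measurable borel"
    by (intro borel_measurable_continuous_onI continuous_on_fourier_borel g)
  define C where "C = (LINT y|lborel. norm (g y))"
  have C: "norm (?G k) \<le> C" for k unfolding C_def by (rule norm_fourier_borel_le[OF g])
  have C0: "C \<ge> 0" unfolding C_def by simp
  note w_int = gaussian_integrable[OF \<sigma>]
  have ng_int: "integrable lborel (\<lambda>y. norm (g y))" using g by simp

  \<comment> \<open>The weighted inversion integral is, up to \<open>2 * pi\<close>, the convolution
    of \<open>g\<close> with a normal density.\<close>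
  have inner: "(LINT k|lborel. of_real (?w k) * cis (k * y) * ?G k) = (LINT x|lborel. of_real (2 * pi * ?N x y) * g x)" for y
  proof -
    define F where "F k x = (of_real (?w k) * cis (k * y)) * (cis (- (k * x)) * g x)" for k x
    have "integrable (lborel \<Otimes>\<^sub>M lborel) (\<lambda>(k, x). F k x)"
    proof (rule Bochner_Integration.integrable_bound[OF integrable_prod_mult[OF w_int ng_int]])
      show "(\<lambda>(k, x). F k x) \<in> borel_measurable (lborel \<Otimes>\<^sub>M lborel)"
        unfolding F_def by measurable
    qed (auto simp: F_def norm_mult)
    from lborel_pair.Fubini_integral[OF this]
    have "(LINT k|lborel. LINT x|lborel. F k x) = (LINT x|lborel. LINT k|lborel. F k x)" by simp
    moreover have "(LINT x|lborel. F k x) = of_real (?w k) * cis (k * y) * ?G k" for k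
      unfolding F_def fourier_borel_def by (rule integral_mult_right_zero)
    moreover have "(LINT k|lborel. F k x) = of_real (2 * pi * ?N x y) * g x" for x
    proof -
      have "F k x = (of_real (?w k) * cis (k * (y - x))) * g x" for k
        by (simp add: F_def cis_mult algebra_simps)
      then have "(LINT k|lborel. F k x) = (LINT k|lborel. of_real (?w k) * cis (k * (y - x))) * g x"
        by (simp only: integral_mult_left_zero)
      also have "(LINT k|lborel. of_real (?w k) * cis (k * (y - x))) = of_real (2 * pi * normal_density 0 \<sigma> (y - x))"
        by (rule gaussian_fourier[OF \<sigma>])
      also have "normal_density 0 \<sigma> (y - x) = ?N x y"
        by (simp add: normal_density_def power2_commute)
      finally show ?thesis .
    qed
    ultimately show ?thesis by simp
  qed

  have wG_int: "integrable lborel (\<lambda>k. ?w k * norm (?G k))"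
    by (rule Bochner_Integration.integrable_bound[OF integrable_mult_right[OF w_int, of C]])
      (auto simp: abs_mult mult.commute intro!: mult_right_mono order_trans[OF C abs_ge_self])
  \<comment> \<open>Integrated in y, this gives the weighted squared transform; integrated in k, it
    gives the convolution \<Phi> times the conjugate of \<open>g\<close>.\<close>
  define F where "F k y = (of_real (?w k) * cis (k * y) * ?G k) * cnj (g y)" for k y
  have F_int: "integrable (lborel \<Otimes>\<^sub>M lborel) (\<lambda>(k, y). F k y)"
  proof (rule Bochner_Integration.integrable_bound[OF integrable_prod_mult[OF wG_int ng_int]])
    show "(\<lambda>(k, y). F k y) \<in> borel_measurable (lborel \<Otimes>\<^sub>M lborel)"
      unfolding F_def by measurable
  qed (auto simp: F_def norm_mult)
  have F1: "(LINT y|lborel. F k y) = of_real (?w k * (norm (?G k))\<^sup>2)" for k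
  proof -
    have "(LINT y|lborel. F k y) = (LINT y|lborel. (of_real (?w k) * ?G k) * cnj (cis (- (k * y)) * g y))"
      by (simp add: F_def cis_cnj mult_ac)
    also have "\<dots> = of_real (?w k) * ?G k * cnj (?G k)"
      unfolding fourier_borel_def by (simp only: integral_mult_right_zero Bochner_Integration.integral_cnj)
    finally show ?thesis by (simp add: complex_norm_square mult.assoc del: of_real_power)
  qed
  define \<Phi> where "\<Phi> y = (LINT x|lborel. of_real (2 * pi * ?N x y) * g x)" for y
  have F2: "(LINT k|lborel. F k y) = \<Phi> y * cnj (g y)" for y
    unfolding F_def \<Phi>_def inner[symmetric] by (rule integral_mult_left_zero)
  have "integrable lborel (\<lambda>k. ?w k * (norm (?G k))\<^sup>2)"
    by (rule Bochner_Integration.integrable_bound[OF integrable_mult_right[OF w_int, of "C\<^sup>2"]])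
      (auto simp: abs_mult mult.commute intro!: mult_right_mono power_mono C)
  then have "(\<integral>\<^sup>+ k. ennreal (?w k * (norm (?G k))\<^sup>2) \<partial>lborel) = ennreal (LINT k|lborel. ?w k * (norm (?G k))\<^sup>2)"
    by (intro nn_integral_eq_integral) auto
  also have "(LINT k|lborel. ?w k * (norm (?G k))\<^sup>2) = norm (LINT k|lborel. LINT y|lborel. F k y)"
    unfolding F1 by (simp del: of_real_mult)
  also have "(LINT k|lborel. LINT y|lborel. F k y) = (LINT y|lborel. \<Phi> y * cnj (g y))"
    using lborel_pair.Fubini_integral[OF F_int] by (simp add: F2)
  also have "ennreal (norm (LINT y|lborel. \<Phi> y * cnj (g y))) \<le> (\<integral>\<^sup>+ y. norm (\<Phi> y * cnj (g y)) \<partial>lborel)"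
    using lborel_pair.integrable_snd[OF F_int] by (intro integral_norm_bound_ennreal) (simp add: F2)
  also have "\<dots> \<le> (\<integral>\<^sup>+ y. (\<integral>\<^sup>+ x. ennreal (2 * pi * ?N x y * norm (g x) * norm (g y)) \<partial>lborel) \<partial>lborel)"
  proof (rule nn_integral_mono)
    fix y
    have int: "integrable lborel (\<lambda>x. of_real (2 * pi * ?N x y) * g x)"
    proof (rule Bochner_Integration.integrable_bound[OF integrable_mult_right[OF g, of "of_real (2 * pi / sqrt (2 * pi * \<sigma>\<^sup>2))"]])
      have "?N x y \<le> 1 / sqrt (2 * pi * \<sigma>\<^sup>2)" for x
        unfolding normal_density_def using \<sigma> by (intro mult_left_le) auto
      then have "2 * pi * ?N x y * norm (g x) \<le> 2 * pi * (1 / sqrt (2 * pi * \<sigma>\<^sup>2)) * norm (g x)" for x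
        by (intro mult_right_mono mult_left_mono) auto
      then show "AE x in lborel. norm (of_real (2 * pi * ?N x y) * g x) \<le> norm (of_real (2 * pi / sqrt (2 * pi * \<sigma>\<^sup>2)) * g x)"
        by (simp add: norm_mult abs_mult norm_divide)
    qed simp
    have "ennreal (norm (\<Phi> y)) \<le> (\<integral>\<^sup>+ x. norm (of_real (2 * pi * ?N x y) * g x) \<partial>lborel)"
      unfolding \<Phi>_def by (rule integral_norm_bound_ennreal[OF int])
    then have "ennreal (norm (\<Phi> y)) * ennreal (norm (g y))
        \<le> (\<integral>\<^sup>+ x. norm (of_real (2 * pi * ?N x y) * g x) \<partial>lborel) * ennreal (norm (g y))"
      by (rule mult_right_mono) simp
    also have "\<dots> = (\<integral>\<^sup>+ x. ennreal (2 * pi * ?N x y * norm (g x)) * ennreal (norm (g y)) \<partial>lborel)"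
      by (subst nn_integral_multc) (auto simp: norm_mult abs_mult)
    finally show "ennreal (norm (\<Phi> y * cnj (g y))) \<le> (\<integral>\<^sup>+ x. ennreal (2 * pi * ?N x y * norm (g x) * norm (g y)) \<partial>lborel)"
      by (simp add: norm_mult ennreal_mult)
  qed
  also have "\<dots> \<le> (\<integral>\<^sup>+ y. (\<integral>\<^sup>+ x. ennreal (pi * ?N x y * (norm (g x))\<^sup>2) + ennreal (pi * ?N x y * (norm (g y))\<^sup>2) \<partial>lborel) \<partial>lborel)"
  proof (intro nn_integral_mono)
    fix y x
    \<comment> \<open>The inequality between arithmetic and geometric mean separates
      \<open>g x\<close> from \<open>g y\<close>; in each half the density is then integrated out
      over the other variable, using its symmetry.\<close>
    have "0 \<le> pi * ?N x y * (norm (g x) - norm (g y))\<^sup>2" by simp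
    then have "2 * pi * ?N x y * norm (g x) * norm (g y) \<le> pi * ?N x y * (norm (g x))\<^sup>2 + pi * ?N x y * (norm (g y))\<^sup>2"
      by (simp add: power2_diff algebra_simps)
    then show "ennreal (2 * pi * ?N x y * norm (g x) * norm (g y))
        \<le> ennreal (pi * ?N x y * (norm (g x))\<^sup>2) + ennreal (pi * ?N x y * (norm (g y))\<^sup>2)"
      by (simp add: ennreal_leI flip: ennreal_plus)
  qed
  also have "\<dots> = (\<integral>\<^sup>+ y. (\<integral>\<^sup>+ x. ennreal (pi * ?N x y * (norm (g x))\<^sup>2) \<partial>lborel) \<partial>lborel)
      + (\<integral>\<^sup>+ y. (\<integral>\<^sup>+ x. ennreal (pi * ?N x y * (norm (g y))\<^sup>2) \<partial>lborel) \<partial>lborel)"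
    unfolding normal_density_def by (subst nn_integral_add[symmetric]) (auto simp: nn_integral_add)
  also have "(\<integral>\<^sup>+ y. (\<integral>\<^sup>+ x. ennreal (pi * ?N x y * (norm (g x))\<^sup>2) \<partial>lborel) \<partial>lborel)
      = (\<integral>\<^sup>+ x. (\<integral>\<^sup>+ y. ennreal (pi * ?N x y * (norm (g x))\<^sup>2) \<partial>lborel) \<partial>lborel)"
    unfolding normal_density_def by (rule lborel_pair.Fubini') measurable
  also have "\<dots> = (\<integral>\<^sup>+ x. (\<integral>\<^sup>+ y. ennreal (pi * (norm (g x))\<^sup>2) * ennreal (normal_density x \<sigma> y) \<partial>lborel) \<partial>lborel)"
    by (intro nn_integral_cong) (simp add: normal_density_def power2_commute mult_ac flip: ennreal_mult)
  also have "\<dots> = (\<integral>\<^sup>+ x. ennreal (pi * (norm (g x))\<^sup>2) \<partial>lborel)"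
    by (simp add: nn_integral_cmult nn_integral_normal_density[OF \<sigma>])
  also have "(\<integral>\<^sup>+ y. (\<integral>\<^sup>+ x. ennreal (pi * ?N x y * (norm (g y))\<^sup>2) \<partial>lborel) \<partial>lborel)
      = (\<integral>\<^sup>+ y. (\<integral>\<^sup>+ x. ennreal (pi * (norm (g y))\<^sup>2) * ennreal (?N x y) \<partial>lborel) \<partial>lborel)"
    by (intro nn_integral_cong) (simp add: mult_ac flip: ennreal_mult)
  also have "\<dots> = (\<integral>\<^sup>+ x. ennreal (pi * (norm (g x))\<^sup>2) \<partial>lborel)"
    by (simp add: nn_integral_cmult nn_integral_normal_density[OF \<sigma>])
  also have "(\<integral>\<^sup>+ x. ennreal (pi * (norm (g x))\<^sup>2) \<partial>lborel) + (\<integral>\<^sup>+ x. ennreal (pi * (norm (g x))\<^sup>2) \<partial>lborel)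
      = (\<integral>\<^sup>+ x. ennreal (2 * pi) * ennreal ((norm (g x))\<^sup>2) \<partial>lborel)"
    by (subst nn_integral_add[symmetric]) (auto intro!: nn_integral_cong simp flip: ennreal_plus ennreal_mult)
  also have "\<dots> = ennreal (2 * pi) * (\<integral>\<^sup>+ x. ennreal ((norm (g x))\<^sup>2) \<partial>lborel)"
    by (rule nn_integral_cmult) measurable
  finally show ?thesis .
qed

text \<open>The Gaussian weight tends to 1 as \<sigma> tends to 0, and Fatou's lemma carries the
  bound, which does not depend on \<sigma>, to the limit.\<close>

lemma Plancherel_le:
  fixes g :: "real \<Rightarrow> complex"
  assumes g: "integrable lborel g"
  shows "(\<integral>\<^sup>+ k. ennreal ((norm (fourier_borel g k))\<^sup>2) \<partial>lborel)
    \<le> ennreal (2 * pi) * (\<integral>\<^sup>+ x. ennreal ((norm (g x))\<^sup>2) \<partial>lborel)"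
proof -
  let ?G = "fourier_borel g"
  have [measurable]: "?G \<in> borel_measurable borel"
    by (intro borel_measurable_continuous_onI continuous_on_fourier_borel g)
  let ?u = "\<lambda>m k. ennreal (exp (- (1 / real (Suc m) * k)\<^sup>2 / 2) * (norm (?G k))\<^sup>2)"
  have "(\<lambda>m. ?u m k) \<longlonglongrightarrow> ennreal ((norm (?G k))\<^sup>2)" for k
  proof (rule tendsto_ennrealI)
    have "(\<lambda>m. exp (- (1 / real (Suc m) * k)\<^sup>2 / 2) * (norm (?G k))\<^sup>2) \<longlonglongrightarrow> exp (- (0 * k)\<^sup>2 / 2) * (norm (?G k))\<^sup>2"
      by (intro tendsto_intros LIMSEQ_inverse_real_of_nat[unfolded inverse_eq_divide]) auto
    then show "(\<lambda>m. exp (- (1 / real (Suc m) * k)\<^sup>2 / 2) * (norm (?G k))\<^sup>2) \<longlonglongrightarrow> (norm (?G k))\<^sup>2" by simp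
  qed
  then have "(\<integral>\<^sup>+ k. ennreal ((norm (?G k))\<^sup>2) \<partial>lborel) = (\<integral>\<^sup>+ k. liminf (\<lambda>m. ?u m k) \<partial>lborel)"
    by (intro nn_integral_cong) (metis lim_imp_Liminf sequentially_bot)
  also have "\<dots> \<le> liminf (\<lambda>m. \<integral>\<^sup>+ k. ?u m k \<partial>lborel)"
    by (rule nn_integral_liminf) measurable
  also have "\<dots> \<le> liminf (\<lambda>m. ennreal (2 * pi) * (\<integral>\<^sup>+ x. ennreal ((norm (g x))\<^sup>2) \<partial>lborel))"
    by (intro Liminf_mono always_eventually allI Plancherel_le_gaussian[OF g]) auto
  also have "\<dots> = ennreal (2 * pi) * (\<integral>\<^sup>+ x. ennreal ((norm (g x))\<^sup>2) \<partial>lborel)"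
    by (rule Liminf_const) simp
  finally show ?thesis .
qed

section \<open>The inverse Fourier transform in the \<open>L\<^sup>2\<close> sense\<close>

text \<open>Sharp truncation and smooth cutoff are both of this form, and so is their difference.
  Writing it as a forward transform at \<open>- x\<close> makes continuity and Plancherel's
  inequality directly applicable.\<close>

definition multiplier_inverse :: "(real \<Rightarrow> complex) \<Rightarrow> (real \<Rightarrow> real) \<Rightarrow> real \<Rightarrow> complex" where
  "multiplier_inverse g \<psi> x = 1 / (2 * of_real pi) * fourier_borel (\<lambda>k. of_real (\<psi> k) * g k) (- x)"

definition tail_energy :: "(real \<Rightarrow> complex) \<Rightarrow> real \<Rightarrow> ennreal" where
  "tail_energy g R = (\<integral>\<^sup>+ k. indicator {k. \<bar>k\<bar> > R} k * ennreal ((norm (g k))\<^sup>2) \<partial>lborel)"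

text \<open>The weights force the increments to decay geometrically with ratio
  \<open>1 / sqrt 2\<close>, hence to be absolutely summable. Applied at almost every point, this
  turns mean square estimates into pointwise convergence.\<close>

lemma convergent_of_weighted_square_increments:
  fixes a :: "nat \<Rightarrow> complex"
  assumes "(\<Sum>m. ennreal (2 ^ m * (norm (a (Suc m) - a m))\<^sup>2)) \<noteq> \<infinity>"
  shows "convergent a"
proof -
  define b where "b m = 2 ^ m * (norm (a (Suc m) - a m))\<^sup>2" for m
  have b: "b m \<ge> 0" for m by (simp add: b_def)
  have sb: "summable b"
    using assms unfolding b_def[symmetric] by (intro summable_suminf_not_top b) auto
  define c where "c = suminf b"
  have le: "norm (a (Suc m) - a m) \<le> sqrt c * (1 / sqrt 2) ^ m" for m
  proof -
    have "b m \<le> c"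
      unfolding c_def using sum_le_suminf[OF sb, of "{m}"] b by simp
    then have "(norm (a (Suc m) - a m))\<^sup>2 \<le> c * (1 / 2) ^ m"
      by (simp add: b_def field_simps power_one_over)
    then have "norm (a (Suc m) - a m) \<le> sqrt (c * (1 / 2) ^ m)" by (rule real_le_rsqrt)
    then show ?thesis by (simp add: real_sqrt_mult real_sqrt_power real_sqrt_divide)
  qed
  have "summable (\<lambda>m. sqrt c * (1 / sqrt 2) ^ m)"
    by (intro summable_mult summable_geometric) simp
  then have "summable (\<lambda>m. a (Suc m) - a m)"
    by (rule summable_comparison_test'[OF _ le])
  then have "convergent (\<lambda>m. \<Sum>i<m. a (Suc i) - a i)" by (simp add: summable_iff_convergent)
  then have "convergent (\<lambda>m. (a m - a 0) + a 0)"
    unfolding sum_lessThan_telescope by (intro convergent_add convergent_const)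
  then show ?thesis by simp
qed

text \<open>Continuity makes \<open>g\<close> bounded on compact intervals, so that truncated
  inversion integrals exist for every radius.\<close>

locale L2_symbol =
  fixes g :: "real \<Rightarrow> complex"
  assumes cont: "continuous_on UNIV g"
    and L2: "(\<integral>\<^sup>+ k. ennreal ((norm (g k))\<^sup>2) \<partial>lborel) < \<infinity>"
begin

lemma g_borel [measurable]: "g \<in> borel_measurable borel"
  by (rule borel_measurable_continuous_onI[OF cont])

lemma multiplier_integrable:
  assumes [measurable]: "\<psi> \<in> borel_measurable borel"
    and le: "\<And>k. \<bar>\<psi> k\<bar> \<le> 1" and supp: "\<And>k. \<bar>k\<bar> > R \<Longrightarrow> \<psi> k = 0"
  shows "integrable lborel (\<lambda>k. of_real (\<psi> k) * g k)"
proof (rule Bochner_Integration.integrable_bound)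
  show "integrable lborel (\<lambda>k. indicator {- R..R} k *\<^sub>R g k)"
    using borel_integrable_atLeastAtMost'[OF continuous_on_subset[OF cont, of "{- R..R}"]]
    unfolding set_integrable_def by simp
  have "norm (of_real (\<psi> k) * g k) \<le> norm (indicator {- R..R} k *\<^sub>R g k)" for k
    using le[of k] supp[of k] by (auto simp: norm_mult indicator_def mult_left_le_one_le)
  then show "AE k in lborel. norm (of_real (\<psi> k) * g k) \<le> norm (indicator {- R..R} k *\<^sub>R g k)" by simp
qed measurable

lemma multiplier_inverse_borel [measurable]:
  assumes "\<psi> \<in> borel_measurable borel" "\<And>k. \<bar>\<psi> k\<bar> \<le> 1" "\<And>k. \<bar>k\<bar> > R \<Longrightarrow> \<psi> k = 0"
  shows "multiplier_inverse g \<psi> \<in> borel_measurable borel"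
  unfolding multiplier_inverse_def
  by (intro borel_measurable_continuous_onI continuous_intros
      continuous_on_compose2[OF continuous_on_fourier_borel[OF multiplier_integrable[OF assms], where S = UNIV]]) auto

lemma multiplier_inverse_le:
  assumes [measurable]: "\<psi> \<in> borel_measurable borel"
    and le: "\<And>k. \<bar>\<psi> k\<bar> \<le> 1" and supp: "\<And>k. \<bar>k\<bar> > R \<Longrightarrow> \<psi> k = 0"
  shows "(\<integral>\<^sup>+ x. ennreal ((norm (multiplier_inverse g \<psi> x))\<^sup>2) \<partial>lborel)
    \<le> (\<integral>\<^sup>+ k. ennreal ((\<psi> k)\<^sup>2 * (norm (g k))\<^sup>2) \<partial>lborel)"
proof -
  let ?f = "\<lambda>k. of_real (\<psi> k) * g k"
  have int: "integrable lborel ?f" by (rule multiplier_integrable[OF assms])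
  have [measurable]: "fourier_borel ?f \<in> borel_measurable borel"
    by (intro borel_measurable_continuous_onI continuous_on_fourier_borel int)
  have "(\<integral>\<^sup>+ x. ennreal ((norm (multiplier_inverse g \<psi> x))\<^sup>2) \<partial>lborel)
      = (\<integral>\<^sup>+ x. ennreal (1 / (2 * pi)\<^sup>2) * ennreal ((norm (fourier_borel ?f (0 + (-1) * x)))\<^sup>2) \<partial>lborel)"
    by (intro nn_integral_cong)
      (simp add: multiplier_inverse_def norm_mult norm_divide power_divide power_mult_distrib flip: ennreal_mult)
  also have "\<dots> = ennreal (1 / (2 * pi)\<^sup>2) * (\<integral>\<^sup>+ x. ennreal ((norm (fourier_borel ?f (0 + (-1) * x)))\<^sup>2) \<partial>lborel)"
    by (rule nn_integral_cmult) measurable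
  also have "(\<integral>\<^sup>+ x. ennreal ((norm (fourier_borel ?f (0 + (-1) * x)))\<^sup>2) \<partial>lborel)
      = (\<integral>\<^sup>+ x. ennreal ((norm (fourier_borel ?f x))\<^sup>2) \<partial>lborel)"
    using nn_integral_real_affine[of "\<lambda>x. ennreal ((norm (fourier_borel ?f x))\<^sup>2)" "-1" 0] by simp
  also have "\<dots> \<le> ennreal (2 * pi) * (\<integral>\<^sup>+ k. ennreal ((norm (?f k))\<^sup>2) \<partial>lborel)"
    by (rule Plancherel_le[OF int])
  finally have "(\<integral>\<^sup>+ x. ennreal ((norm (multiplier_inverse g \<psi> x))\<^sup>2) \<partial>lborel)
     \<le> ennreal (1 / (2 * pi)\<^sup>2) * (ennreal (2 * pi) * (\<integral>\<^sup>+ k. ennreal ((norm (?f k))\<^sup>2) \<partial>lborel))"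
    by (simp add: mult_left_mono)
  also have "\<dots> = ennreal (1 / (2 * pi)) * (\<integral>\<^sup>+ k. ennreal ((norm (?f k))\<^sup>2) \<partial>lborel)"
    by (simp add: mult.assoc[symmetric] power2_eq_square flip: ennreal_mult)
  \<comment> \<open>The factor \<open>1 / (2 * pi)\<close> is given away, since only convergence to
    0 and finiteness are derived from this bound.\<close>
  also have "\<dots> \<le> 1 * (\<integral>\<^sup>+ k. ennreal ((norm (?f k))\<^sup>2) \<partial>lborel)"
    using pi_gt3 by (intro mult_right_mono) (auto simp: ennreal_le_1)
  finally show ?thesis by (simp add: norm_mult power_mult_distrib)
qed

lemma multiplier_inverse_diff:
  assumes "\<psi> \<in> borel_measurable borel" "\<And>k. \<bar>\<psi> k\<bar> \<le> 1" "\<And>k. \<bar>k\<bar> > R \<Longrightarrow> \<psi> k = 0"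
    and "\<psi>' \<in> borel_measurable borel" "\<And>k. \<bar>\<psi>' k\<bar> \<le> 1" "\<And>k. \<bar>k\<bar> > R' \<Longrightarrow> \<psi>' k = 0"
  shows "multiplier_inverse g \<psi> x - multiplier_inverse g \<psi>' x = multiplier_inverse g (\<lambda>k. \<psi> k - \<psi>' k) x"
proof -
  have cis: "integrable lborel (\<lambda>k. cis (- (- x * k)) * f k)" if "integrable lborel f" for f
    by (rule Bochner_Integration.integrable_bound[OF that])
      (use borel_measurable_integrable[OF that] in \<open>auto simp: norm_mult\<close>)
  show ?thesis
    using cis[OF multiplier_integrable[OF assms(1-3)]] cis[OF multiplier_integrable[OF assms(4-6)]]
    unfolding multiplier_inverse_def fourier_borel_def
    by (simp add: left_diff_distrib right_diff_distrib Bochner_Integration.integral_diff flip: right_diff_distrib[of "1 / _"])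
qed

lemma truncated_inverse_fourier_eq:
  "truncated_inverse_fourier R g x = multiplier_inverse g (indicator {- R..R}) x"
proof -
  have "(LINT k:{- R..R}|lebesgue. exp (\<i> * of_real (k * x)) * g k)
      = (LINT k|lborel. indicator {- R..R} k *\<^sub>R (cis (k * x) * g k))"
    unfolding set_lebesgue_integral_def cis_conv_exp[symmetric]
    by (rule integral_completion) measurable
  also have "\<dots> = fourier_borel (\<lambda>k. of_real (indicator {- R..R} k) * g k) (- x)"
    unfolding fourier_borel_def
    by (intro Bochner_Integration.integral_cong) (simp_all add: indicator_def mult.commute)
  finally show ?thesis by (simp add: truncated_inverse_fourier_def multiplier_inverse_def)
qed

lemma tail_energy_to_0:
  assumes "0 < e"
  obtains N where "\<And>R. R \<ge> N \<Longrightarrow> tail_energy g R < e"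
proof -
  have "(\<lambda>m. \<integral>\<^sup>+ k. indicator {k. \<bar>k\<bar> > real m} k * ennreal ((norm (g k))\<^sup>2) \<partial>lborel)
      \<longlonglongrightarrow> (\<integral>\<^sup>+ k. (\<lambda>_::real. 0) k \<partial>lborel)"
  proof (rule nn_integral_dominated_convergence[where w = "\<lambda>k. ennreal ((norm (g k))\<^sup>2)"])
    have "(\<lambda>m. indicator {k. \<bar>k\<bar> > real m} k * ennreal ((norm (g k))\<^sup>2)) \<longlonglongrightarrow> 0" for k
    proof (rule tendsto_eventually)
      obtain N where "\<bar>k\<bar> \<le> real N" using real_arch_simple by blast
      then show "\<forall>\<^sub>F m in sequentially. indicator {k. \<bar>k\<bar> > real m} k * ennreal ((norm (g k))\<^sup>2) = 0"
        by (intro eventually_sequentiallyI[of N]) (auto simp: indicator_def)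
    qed
    then show "AE k in lborel. (\<lambda>m. indicator {k. \<bar>k\<bar> > real m} k * ennreal ((norm (g k))\<^sup>2)) \<longlonglongrightarrow> 0" by simp
  qed (use L2 in \<open>auto simp: indicator_def\<close>)
  then have "(\<lambda>m. tail_energy g (real m)) \<longlonglongrightarrow> 0" by (simp add: tail_energy_def)
  then have "\<forall>\<^sub>F m in sequentially. tail_energy g (real m) < e"
    using assms by (rule order_tendstoD)
  then obtain N where N: "tail_energy g (real N) < e"
    unfolding eventually_sequentially by blast
  have "tail_energy g R < e" if "R \<ge> real N" for R
  proof -
    have "tail_energy g R \<le> tail_energy g (real N)"
      unfolding tail_energy_def using that
      by (intro nn_integral_mono mult_right_mono) (auto simp: indicator_def)
    also note N
    finally show ?thesis .
  qed
  then show ?thesis by (rule that)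
qed

text \<open>By Fatou's lemma the squared distance of \<open>u\<close> to the sharply truncated integral at \<open>R\<close> is
  bounded by the energy of \<open>g\<close> outside \<open>{- R..R}\<close>, whatever the multipliers \<open>\<psi>\<close> are.\<close>

lemma L2_inverse_fourier_limit:
  assumes [measurable]: "u \<in> borel_measurable borel" "\<And>m. \<psi> m \<in> borel_measurable borel"
    and \<psi>: "\<And>m k. 0 \<le> \<psi> m k" "\<And>m k. \<psi> m k \<le> 1" "\<And>m k. \<bar>k\<bar> > r m \<Longrightarrow> \<psi> m k = 0"
    and \<psi>_lim: "\<And>k. (\<lambda>m. \<psi> m k) \<longlonglongrightarrow> 1"
    and u: "AE x in lborel. (\<lambda>m. multiplier_inverse g (\<psi> m) x) \<longlonglongrightarrow> u x"
  shows "L2_inverse_fourier g u"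
proof -
  let ?I = "\<lambda>R. indicator {- R..R} :: real \<Rightarrow> real"
  let ?T = "\<lambda>R. truncated_inverse_fourier R g"
  have mI [measurable]: "?T R \<in> borel_measurable borel" for R
    unfolding truncated_inverse_fourier_eq[abs_def]
    by (rule multiplier_inverse_borel[of _ R]) (auto simp: indicator_def)
  have m\<psi> [measurable]: "multiplier_inverse g (\<psi> m) \<in> borel_measurable borel" for m
    by (rule multiplier_inverse_borel[of _ "r m"]) (use \<psi> in auto)
  have dist: "(\<integral>\<^sup>+ x. ennreal ((norm (?T R x - u x))\<^sup>2) \<partial>lborel) \<le> tail_energy g R" for R
  proof -
    let ?v = "\<lambda>m x. ennreal ((norm (?T R x - multiplier_inverse g (\<psi> m) x))\<^sup>2)"
    have "AE x in lborel. ennreal ((norm (?T R x - u x))\<^sup>2) = liminf (\<lambda>m. ?v m x)"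
      using u
    proof eventually_elim
      case (elim x)
      then have "(\<lambda>m. ?v m x) \<longlonglongrightarrow> ennreal ((norm (?T R x - u x))\<^sup>2)"
        by (intro tendsto_ennrealI tendsto_intros)
      then show ?case by (rule lim_imp_Liminf[OF sequentially_bot, symmetric])
    qed
    then have "(\<integral>\<^sup>+ x. ennreal ((norm (?T R x - u x))\<^sup>2) \<partial>lborel) = (\<integral>\<^sup>+ x. liminf (\<lambda>m. ?v m x) \<partial>lborel)"
      by (rule nn_integral_cong_AE)
    also have "\<dots> \<le> liminf (\<lambda>m. \<integral>\<^sup>+ x. ?v m x \<partial>lborel)"
      by (rule nn_integral_liminf) measurable
    \<comment> \<open>By linearity the difference is again a multiplier integral, with a multiplier
      between -1 and 1.\<close>
    also have "\<dots> \<le> liminf (\<lambda>m. \<integral>\<^sup>+ k. ennreal ((?I R k - \<psi> m k)\<^sup>2 * (norm (g k))\<^sup>2) \<partial>lborel)"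
    proof (intro Liminf_mono always_eventually allI)
      fix m
      have "?T R x - multiplier_inverse g (\<psi> m) x = multiplier_inverse g (\<lambda>k. ?I R k - \<psi> m k) x" for x
        unfolding truncated_inverse_fourier_eq
        by (rule multiplier_inverse_diff[of _ R _ "r m"]) (use \<psi> in \<open>auto simp: indicator_def\<close>)
      moreover have "(\<integral>\<^sup>+ x. ennreal ((norm (multiplier_inverse g (\<lambda>k. ?I R k - \<psi> m k) x))\<^sup>2) \<partial>lborel)
          \<le> (\<integral>\<^sup>+ k. ennreal ((?I R k - \<psi> m k)\<^sup>2 * (norm (g k))\<^sup>2) \<partial>lborel)"
      proof (rule multiplier_inverse_le[of _ "max R (r m)"])
        show "\<bar>?I R k - \<psi> m k\<bar> \<le> 1" for k
          using \<psi>(1,2)[of m k] by (simp add: indicator_def)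
      qed (use \<psi>(3) in \<open>auto simp: indicator_def\<close>)
      ultimately show "(\<integral>\<^sup>+ x. ?v m x \<partial>lborel) \<le> (\<integral>\<^sup>+ k. ennreal ((?I R k - \<psi> m k)\<^sup>2 * (norm (g k))\<^sup>2) \<partial>lborel)"
        by simp
    qed
    also have "\<dots> = (\<integral>\<^sup>+ k. ennreal ((?I R k - 1)\<^sup>2 * (norm (g k))\<^sup>2) \<partial>lborel)"
    proof (rule lim_imp_Liminf[OF sequentially_bot], rule nn_integral_dominated_convergence[where w = "\<lambda>k. ennreal ((norm (g k))\<^sup>2)"])
      have "(?I R k - \<psi> m k)\<^sup>2 \<le> 1" for m k
        using \<psi>(1,2)[of m k] by (auto simp: indicator_def abs_square_le_1 abs_le_iff)
      then show "AE k in lborel. ennreal ((?I R k - \<psi> m k)\<^sup>2 * (norm (g k))\<^sup>2) \<le> ennreal ((norm (g k))\<^sup>2)" for m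
        by (auto intro!: ennreal_leI mult_left_le_one_le)
      show "AE k in lborel. (\<lambda>m. ennreal ((?I R k - \<psi> m k)\<^sup>2 * (norm (g k))\<^sup>2)) \<longlonglongrightarrow> ennreal ((?I R k - 1)\<^sup>2 * (norm (g k))\<^sup>2)"
        by (intro AE_I2 tendsto_ennrealI tendsto_intros \<psi>_lim)
    qed (use L2 in auto)
    also have "\<dots> = tail_energy g R"
      unfolding tail_energy_def by (intro nn_integral_cong) (auto simp: indicator_def)
    finally show ?thesis .
  qed
  have lim: "((\<lambda>R. \<integral>\<^sup>+ x. ennreal ((norm (?T R x - u x))\<^sup>2) \<partial>lebesgue) \<longlongrightarrow> 0) at_top"
    unfolding nn_integral_completion
  proof (rule order_tendstoI)
    fix e :: ennreal assume "0 < e"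
    then obtain N where "\<And>R. R \<ge> N \<Longrightarrow> tail_energy g R < e"
      using tail_energy_to_0 by blast
    then show "\<forall>\<^sub>F R in at_top. (\<integral>\<^sup>+ x. ennreal ((norm (?T R x - u x))\<^sup>2) \<partial>lborel) < e"
      using dist by (intro eventually_at_top_linorderI[of N]) (meson order.strict_trans1)
  qed simp
  have sq: "square_integrable f" if [measurable]: "f \<in> borel_measurable borel"
    and "(\<integral>\<^sup>+ x. ennreal ((norm (f x))\<^sup>2) \<partial>lborel) < \<infinity>" for f
  proof -
    have "integrable lborel (\<lambda>x. (norm (f x))\<^sup>2)"
      using that(2) by (intro integrableI_bounded) auto
    then show ?thesis
      by (auto simp: square_integrable_def integrable_completion intro!: measurable_completion)
  qed
  \<comment> \<open>At radius 0 the integral runs over a single point. The distance estimate at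
    \<open>R = 0\<close> therefore bounds the \<open>L\<^sup>2\<close> norm of \<open>u\<close>
    itself.\<close>
  have "?T 0 x = 0" for x
  proof -
    have "AE k in lborel. cis (- (- x * k)) * (of_real (?I 0 k) * g k) = 0"
      using AE_lborel_singleton[of "0::real"] by eventually_elim (simp add: indicator_def)
    then have "(LINT k|lborel. cis (- (- x * k)) * (of_real (?I 0 k) * g k)) = 0"
      by (rule integral_eq_zero_AE)
    then show ?thesis
      by (simp add: truncated_inverse_fourier_eq multiplier_inverse_def fourier_borel_def)
  qed
  then have "(\<integral>\<^sup>+ x. ennreal ((norm (u x))\<^sup>2) \<partial>lborel) \<le> tail_energy g 0"
    using dist[of 0] by simp
  also have "\<dots> \<le> (\<integral>\<^sup>+ k. ennreal ((norm (g k))\<^sup>2) \<partial>lborel)"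
    unfolding tail_energy_def by (intro nn_integral_mono) (auto simp: indicator_def)
  also note L2
  finally have "(\<integral>\<^sup>+ x. ennreal ((norm (u x))\<^sup>2) \<partial>lborel) < \<infinity>" .
  then show ?thesis
    unfolding L2_inverse_fourier_def using lim sq[OF assms(1)] sq[OF g_borel L2] by blast
qed

text \<open>The Riesz-Fischer argument: along radii that grow fast enough, the sharply truncated
  integrals converge almost everywhere, and \<open>L2_inverse_fourier_limit\<close> applies with
  indicators as multipliers. It is used for times at which no pointwise limit has been
  constructed.\<close>

lemma L2_inverse_fourier_exists: "\<exists>u. L2_inverse_fourier g u"
proof -
  let ?I = "\<lambda>R. indicator {- R..R} :: real \<Rightarrow> real"
  \<comment> \<open>Energies below \<open>(1 / 4) ^ m\<close> leave a summable
    \<open>(1 / 2) ^ m\<close> after multiplication by the weights \<open>2 ^ m\<close>.\<close>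
  have "\<exists>R. real m \<le> R \<and> tail_energy g R < ennreal ((1 / 4) ^ m)" for m
  proof -
    have "0 < ennreal ((1 / 4) ^ m)" by simp
    then obtain N where "\<And>R. R \<ge> N \<Longrightarrow> tail_energy g R < ennreal ((1 / 4) ^ m)"
      using tail_energy_to_0 by blast
    then show ?thesis by (intro exI[of _ "max N (real m)"]) auto
  qed
  then obtain r where r: "\<And>m. real m \<le> r m" "\<And>m. tail_energy g (r m) < ennreal ((1 / 4) ^ m)"
    by metis
  define f where "f m = multiplier_inverse g (?I (r m))" for m
  have [measurable]: "f m \<in> borel_measurable borel" for m
    unfolding f_def by (rule multiplier_inverse_borel[of _ "r m"]) (auto simp: indicator_def)
  define d where "d m x = f (Suc m) x - f m x" for m x
  have [measurable]: "d m \<in> borel_measurable borel" for m unfolding d_def by measurable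
  have d_le: "(\<integral>\<^sup>+ x. ennreal ((norm (d m x))\<^sup>2) \<partial>lborel) \<le> ennreal (2 * (1 / 4) ^ m)" for m
  proof -
    have eq: "d m x = multiplier_inverse g (\<lambda>k. ?I (r (Suc m)) k - ?I (r m) k) x" for x
      unfolding d_def f_def
      by (rule multiplier_inverse_diff[of _ "r (Suc m)" _ "r m"]) (auto simp: indicator_def)
    have "(\<integral>\<^sup>+ x. ennreal ((norm (d m x))\<^sup>2) \<partial>lborel)
       \<le> (\<integral>\<^sup>+ k. ennreal ((?I (r (Suc m)) k - ?I (r m) k)\<^sup>2 * (norm (g k))\<^sup>2) \<partial>lborel)"
      unfolding eq
    proof (rule multiplier_inverse_le[of _ "max (r (Suc m)) (r m)"])
      show "(\<lambda>k. ?I (r (Suc m)) k - ?I (r m) k) \<in> borel_measurable borel" by measurable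
    qed (auto simp: indicator_def)
    \<comment> \<open>The radii are not known to be increasing, so the difference of indicators is
      bounded by both tails together.\<close>
    also have "\<dots> \<le> (\<integral>\<^sup>+ k. indicator {k. \<bar>k\<bar> > r (Suc m)} k * ennreal ((norm (g k))\<^sup>2)
        + indicator {k. \<bar>k\<bar> > r m} k * ennreal ((norm (g k))\<^sup>2) \<partial>lborel)"
      by (intro nn_integral_mono) (auto simp: indicator_def)
    also have "\<dots> = tail_energy g (r (Suc m)) + tail_energy g (r m)"
      unfolding tail_energy_def by (rule nn_integral_add) measurable
    also have "\<dots> \<le> ennreal ((1 / 4) ^ Suc m) + ennreal ((1 / 4) ^ m)"
      using r(2) by (intro add_mono less_imp_le)
    also have "\<dots> \<le> ennreal (2 * (1 / 4) ^ m)"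
      by (simp flip: ennreal_plus)
    finally show ?thesis .
  qed
  have "(\<integral>\<^sup>+ x. (\<Sum>m. ennreal (2 ^ m * (norm (d m x))\<^sup>2)) \<partial>lborel)
      = (\<Sum>m. \<integral>\<^sup>+ x. ennreal (2 ^ m * (norm (d m x))\<^sup>2) \<partial>lborel)"
    by (rule nn_integral_suminf) measurable
  also have "\<dots> \<le> (\<Sum>m. ennreal (2 * (1 / 2) ^ m))"
  proof (rule suminf_le)
    fix m
    have "(\<integral>\<^sup>+ x. ennreal (2 ^ m * (norm (d m x))\<^sup>2) \<partial>lborel) = ennreal (2 ^ m) * (\<integral>\<^sup>+ x. ennreal ((norm (d m x))\<^sup>2) \<partial>lborel)"
      by (subst nn_integral_cmult[symmetric]) (auto simp: ennreal_mult)
    also have "\<dots> \<le> ennreal (2 ^ m) * ennreal (2 * (1 / 4) ^ m)"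
      by (intro mult_left_mono d_le) auto
    also have "\<dots> = ennreal (2 * (1 / 2) ^ m)"
    proof -
      have "(2 * (1 / 4)) ^ m = (2::real) ^ m * (1 / 4) ^ m" by (rule power_mult_distrib)
      then show ?thesis by (simp flip: ennreal_mult)
    qed
    finally show "(\<integral>\<^sup>+ x. ennreal (2 ^ m * (norm (d m x))\<^sup>2) \<partial>lborel) \<le> ennreal (2 * (1 / 2) ^ m)" .
  qed auto
  also have "\<dots> = ennreal (\<Sum>m. 2 * (1 / 2) ^ m)"
    by (rule suminf_ennreal2) (auto intro!: summable_mult summable_geometric)
  also have "\<dots> < \<infinity>" by simp
  finally have "(\<integral>\<^sup>+ x. (\<Sum>m. ennreal (2 ^ m * (norm (d m x))\<^sup>2)) \<partial>lborel) \<noteq> \<infinity>"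
    by (rule less_imp_neq)
  then have "AE x in lborel. (\<Sum>m. ennreal (2 ^ m * (norm (d m x))\<^sup>2)) \<noteq> \<infinity>"
    by (rule nn_integral_PInf_AE[rotated]) measurable
  then have conv: "AE x in lborel. (\<lambda>m. f m x) \<longlonglongrightarrow> lim (\<lambda>m. f m x)"
  proof eventually_elim
    case (elim x)
    then have "convergent (\<lambda>m. f m x)"
      unfolding d_def by (rule convergent_of_weighted_square_increments)
    then show ?case by (simp add: convergent_LIMSEQ_iff)
  qed
  have "L2_inverse_fourier g (\<lambda>x. lim (\<lambda>m. f m x))"
  proof (rule L2_inverse_fourier_limit[where \<psi> = "\<lambda>m. ?I (r m)" and r = r])
    show "(\<lambda>m. ?I (r m) k) \<longlonglongrightarrow> 1" for k
    proof (rule tendsto_eventually)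
      obtain N where "\<bar>k\<bar> \<le> real N" using real_arch_simple by blast
      then have "?I (r m) k = 1" if "m \<ge> N" for m
        using r(1)[of m] that by (auto simp: indicator_def)
      then show "\<forall>\<^sub>F m in sequentially. ?I (r m) k = 1" by (rule eventually_sequentiallyI)
    qed
    show "AE x in lborel. (\<lambda>m. multiplier_inverse g (?I (r m)) x) \<longlonglongrightarrow> lim (\<lambda>m. f m x)"
      using conv unfolding f_def .
  qed (auto simp: indicator_def)
  then show ?thesis by (rule exI[of "L2_inverse_fourier g"])
qed

end

section \<open>The initial value problem\<close>

lemma borel_representative:
  fixes f :: "real \<Rightarrow> complex"
  assumes "f \<in> borel_measurable lebesgue"
  obtains h where "h \<in> borel_measurable borel" "AE x in lebesgue. f x = h x"
proof -
  have m: "(\<lambda>x. Re (f x)) \<in> borel_measurable lebesgue" "(\<lambda>x. Im (f x)) \<in> borel_measurable lebesgue"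
    using assms by simp_all
  obtain a b where ab [measurable]: "a \<in> borel_measurable lborel" "b \<in> borel_measurable lborel"
    and ae: "AE x in lborel. Re (f x) = a x" "AE x in lborel. Im (f x) = b x"
    using m[THEN completion_ex_borel_measurable_real] by blast
  have [measurable]: "a \<in> borel_measurable borel" "b \<in> borel_measurable borel"
    using ab by simp_all
  show ?thesis
  proof
    have "(\<lambda>x. complex_of_real (a x) + \<i> * complex_of_real (b x)) \<in> borel_measurable borel"
      by measurable
    then show "(\<lambda>x. Complex (a x) (b x)) \<in> borel_measurable borel" by (simp add: Complex_eq)
    have "AE x in lborel. f x = Complex (a x) (b x)"
      using ae by eventually_elim (simp add: complex_eq_iff)
    then show "AE x in lebesgue. f x = Complex (a x) (b x)" by (rule AE_completion)
  qed
qed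

lemma fourier_eq_fourier_borel:
  assumes [measurable]: "f \<in> borel_measurable lebesgue" "h \<in> borel_measurable borel"
    and ae: "AE x in lebesgue. f x = h x"
  shows "fourier f k = fourier_borel h k"
proof -
  have h [measurable]: "h \<in> borel_measurable lebesgue" by (rule measurable_completion) simp
  have c: "(\<lambda>x. cis (- (k * x))) \<in> borel_measurable lebesgue" by (rule measurable_completion) simp
  have "fourier f k = (LINT x|lebesgue. cis (- (k * x)) * f x)"
    by (simp add: fourier_def cis_conv_exp)
  also have "\<dots> = (LINT x|lebesgue. cis (- (k * x)) * h x)"
  proof (rule integral_cong_AE)
    show "AE x in lebesgue. cis (- (k * x)) * f x = cis (- (k * x)) * h x"
      using ae by eventually_elim simp
  qed (use c in measurable)
  also have "\<dots> = (LINT x|lborel. cis (- (k * x)) * h x)"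
    by (rule integral_completion) measurable
  finally show ?thesis by (simp add: fourier_borel_def)
qed

lemma integrable_lborel_representative:
  fixes \<psi> :: "real \<Rightarrow> real \<Rightarrow> real"
  assumes f: "integrable lebesgue (\<lambda>x. \<psi> x (norm (f x)))" and h: "(\<lambda>x. \<psi> x (norm (h x))) \<in> borel_measurable borel"
    and ae: "AE x in lebesgue. f x = h x"
  shows "integrable lborel (\<lambda>x. \<psi> x (norm (h x)))"
proof -
  have "integrable lebesgue (\<lambda>x. \<psi> x (norm (h x)))"
  proof (rule integrable_cong_AE_imp[OF f])
    show "(\<lambda>x. \<psi> x (norm (h x))) \<in> borel_measurable lebesgue"
      by (rule measurable_completion) (use h in simp)
    show "AE x in lebesgue. \<psi> x (norm (f x)) = \<psi> x (norm (h x))"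
      using ae by eventually_elim simp
  qed
  then show ?thesis using h by (simp add: integrable_completion)
qed

section \<open>Identification of the pointwise limit with the \<open>L\<^sup>2\<close>
  solution\<close>

context dispersive_datum
begin

definition symbol :: "real \<Rightarrow> real \<Rightarrow> complex" where
  "symbol t k = cis (- (poly p k * t)) * fourier_borel h k"

lemma symbol_L2:
  assumes "integrable lborel (\<lambda>x. (norm (h x))\<^sup>2)"
  shows "L2_symbol (symbol t)"
proof
  show "continuous_on UNIV (symbol t)"
    unfolding symbol_def
    by (intro continuous_on_mult continuous_intros continuous_on_fourier_borel h_integrable)
  have "(\<integral>\<^sup>+ k. ennreal ((norm (symbol t k))\<^sup>2) \<partial>lborel) = (\<integral>\<^sup>+ k. ennreal ((norm (fourier_borel h k))\<^sup>2) \<partial>lborel)"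
    by (simp add: symbol_def norm_mult)
  also have "\<dots> \<le> ennreal (2 * pi) * (\<integral>\<^sup>+ x. ennreal ((norm (h x))\<^sup>2) \<partial>lborel)"
    by (rule Plancherel_le[OF h_integrable])
  also have "(\<integral>\<^sup>+ x. ennreal ((norm (h x))\<^sup>2) \<partial>lborel) = ennreal (LINT x|lborel. (norm (h x))\<^sup>2)"
    by (rule nn_integral_eq_integral[OF assms]) simp
  also have "ennreal (2 * pi) * ennreal (LINT x|lborel. (norm (h x))\<^sup>2) < \<infinity>"
    by (simp add: ennreal_mult_less_top)
  finally show "(\<integral>\<^sup>+ k. ennreal ((norm (symbol t k))\<^sup>2) \<partial>lborel) < \<infinity>" .
qed

text \<open>The indicator is part of the multiplier because the polynomial \<open>cutoff R 0\<close>
  does not vanish beyond R. The product is supported in \<open>{- R..R}\<close> and bounded by 1, as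
  the multiplier lemmas require.\<close>

lemma approx_eq_multiplier_inverse:
  "approx R 0 x t = multiplier_inverse (symbol t) (\<lambda>k. indicator {- R..R} k * cutoff R 0 k) x"
proof -
  let ?F = "\<lambda>k. of_real (cutoff R 0 k) * cis (k * x - poly p k * t) * fourier_borel h k"
  have c: "continuous_on {- R..R} ?F"
    by (intro continuous_on_mult osc_integrand_continuous continuous_intros continuous_on_fourier_borel h_integrable)
  have "integral {- R..R} ?F = (LINT k:{- R..R}|lborel. ?F k)"
    by (rule set_borel_integral_eq_integral(2)[OF borel_integrable_atLeastAtMost'[OF c], symmetric])
  also have "\<dots> = fourier_borel (\<lambda>k. of_real (indicator {- R..R} k * cutoff R 0 k) * symbol t k) (- x)"
    unfolding set_lebesgue_integral_def fourier_borel_def[of "\<lambda>k. of_real (indicator {- R..R} k * cutoff R 0 k) * symbol t k"]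
  proof (rule Bochner_Integration.integral_cong[OF refl])
    fix k
    have "cis (k * x - poly p k * t) = cis (- (- x * k)) * cis (- (poly p k * t))"
      by (simp add: cis_mult mult.commute)
    then show "indicator {- R..R} k *\<^sub>R ?F k
       = cis (- (- x * k)) * (of_real (indicator {- R..R} k * cutoff R 0 k) * symbol t k)"
      by (simp add: symbol_def indicator_def)
  qed
  finally show ?thesis by (simp add: approx_def multiplier_inverse_def)
qed

lemma sol_borel:
  assumes "0 < t"
  shows "(\<lambda>x. sol 0 x t) \<in> borel_measurable borel"
proof (rule borel_measurable_LIMSEQ_metric)
  show "(\<lambda>x. approx (real m) 0 x t) \<in> borel_measurable borel" for m
    by (intro borel_measurable_continuous_onI continuous_at_imp_continuous_on ballI
        has_vector_derivative_continuous[OF approx_deriv_x])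
  show "(\<lambda>m. approx (real m) 0 x t) \<longlonglongrightarrow> sol 0 x t" for x
    by (rule sol_limit[OF assms]) simp
qed

text \<open>The smooth multipliers tend to 1 pointwise and the cut-off solutions converge everywhere
  to \<open>sol 0\<close>, so the pointwise limit must agree with the limit of the sharp truncations
  in mean square.\<close>

lemma L2_inverse_fourier_sol:
  assumes "integrable lborel (\<lambda>x. (norm (h x))\<^sup>2)" "0 < t"
  shows "L2_inverse_fourier (symbol t) (\<lambda>x. sol 0 x t)"
proof -
  interpret L2_symbol "symbol t" by (rule symbol_L2[OF assms(1)])
  let ?\<psi> = "\<lambda>m k. indicator {- real m..real m} k * cutoff (real m) 0 k"
  have cut: "0 \<le> cutoff (real m) 0 k" "cutoff (real m) 0 k \<le> 1" if "\<bar>k\<bar> \<le> real m" for m k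
  proof -
    \<comment> \<open>At \<open>m = 0\<close> division by zero yields 0 and the factor is 1.\<close>
    have "(1 - (k / real m)\<^sup>2)\<^sup>2 \<le> 1"
      using cutoff_factor_bounds[OF that] by (cases "m = 0") (auto intro: power_le_one)
    then show "0 \<le> cutoff (real m) 0 k" "cutoff (real m) 0 k \<le> 1" by (simp_all add: cutoff_def)
  qed
  show ?thesis
  proof (rule L2_inverse_fourier_limit[where \<psi> = ?\<psi> and r = real])
    show "(\<lambda>x. sol 0 x t) \<in> borel_measurable borel" by (rule sol_borel[OF assms(2)])
    show "?\<psi> m \<in> borel_measurable borel" for m unfolding cutoff_def by measurable
    show "0 \<le> ?\<psi> m k" "?\<psi> m k \<le> 1" "\<bar>k\<bar> > real m \<Longrightarrow> ?\<psi> m k = 0" for m k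
      using cut[of k m] by (auto simp: indicator_def)
    show "(\<lambda>m. ?\<psi> m k) \<longlonglongrightarrow> 1" for k
    proof (rule Lim_transform_eventually)
      have "(\<lambda>m. (1 - (k / real m)\<^sup>2)\<^sup>2) \<longlonglongrightarrow> (1 - 0\<^sup>2)\<^sup>2"
        by (intro tendsto_intros tendsto_divide_0[OF tendsto_const] filterlim_at_top_imp_at_infinity filterlim_real_sequentially)
      then show "(\<lambda>m. (1 - (k / real m)\<^sup>2)\<^sup>2) \<longlonglongrightarrow> 1" by simp
      obtain N where "\<bar>k\<bar> \<le> real N" using real_arch_simple by blast
      then show "\<forall>\<^sub>F m in sequentially. (1 - (k / real m)\<^sup>2)\<^sup>2 = ?\<psi> m k"
        by (intro eventually_sequentiallyI[of N]) (auto simp: indicator_def cutoff_def)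
    qed
    show "AE x in lborel. (\<lambda>m. multiplier_inverse (symbol t) (?\<psi> m) x) \<longlonglongrightarrow> sol 0 x t"
      unfolding approx_eq_multiplier_inverse[symmetric]
      by (intro AE_I2 sol_limit[OF assms(2)]) simp
  qed
qed

end

theorem mainTheorem2:
  fixes n :: nat and w :: "nat \<Rightarrow> real" and \<omega> :: "real poly"
    and q\<^sub>o :: "real \<Rightarrow> complex" and l :: real
  assumes "n \<ge> 2"
    and "\<omega> = (\<Sum>j=2..n. monom (w j) j)"
    and "w n \<noteq> 0"
    and "square_integrable q\<^sub>o"
    and "weighted_integrable l q\<^sub>o"
    and "l \<ge> (real n + 2) / (2 * (real n - 1))"
  shows "\<exists>q. L2_solution \<omega> q\<^sub>o q \<and> classical_solution \<omega> q (UNIV \<times> {0<..})"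
proof -
  have coeff: "coeff \<omega> i = (if i \<in> {2..n} then w i else 0)" for i
    by (simp add: assms(2) coeff_sum coeff_monom)
  have deg: "degree \<omega> = n"
  proof (rule antisym)
    show "degree \<omega> \<le> n" by (rule degree_le) (simp add: coeff)
    show "n \<le> degree \<omega>" by (rule le_degree) (use assms(1,3) in \<open>simp add: coeff\<close>)
  qed
  define s where "s = (real n + 2) / (2 * (real n - 1))"
  have q_meas: "q\<^sub>o \<in> borel_measurable lebesgue"
    and q_sq: "integrable lebesgue (\<lambda>x. (norm (q\<^sub>o x))\<^sup>2)"
    and q_w: "integrable lebesgue (\<lambda>x. (1 + \<bar>x\<bar>) powr l * norm (q\<^sub>o x))"
    using assms(4,5) by (auto simp: square_integrable_def weighted_integrable_def)
  obtain h where h [measurable]: "h \<in> borel_measurable borel" and ae: "AE x in lebesgue. q\<^sub>o x = h x"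
    using borel_representative[OF q_meas] by blast
  have h_sq: "integrable lborel (\<lambda>x. (norm (h x))\<^sup>2)"
    by (rule integrable_lborel_representative[where \<psi> = "\<lambda>x y. y\<^sup>2", OF q_sq _ ae]) measurable
  have h_w: "integrable lborel (\<lambda>x. (1 + \<bar>x\<bar>) powr l * norm (h x))"
    by (rule integrable_lborel_representative[where \<psi> = "\<lambda>x y. (1 + \<bar>x\<bar>) powr l * y", OF q_w _ ae]) measurable
  \<comment> \<open>Since the base \<open>1 + \<bar>y\<bar>\<close> is at least 1, the weight with
    the given exponent \<open>l\<close> dominates the critical one.\<close>
  interpret dispersive_datum \<omega> n h s
  proof
    show "integrable lborel (\<lambda>y. (1 + \<bar>y\<bar>) powr s * norm (h y))"
    proof (rule Bochner_Integration.integrable_bound[OF h_w])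
      have "(1 + \<bar>y\<bar>) powr s * norm (h y) \<le> (1 + \<bar>y\<bar>) powr l * norm (h y)" for y
        using assms(6) by (intro mult_right_mono powr_mono) (auto simp: s_def)
      then show "AE y in lborel. norm ((1 + \<bar>y\<bar>) powr s * norm (h y)) \<le> norm ((1 + \<bar>y\<bar>) powr l * norm (h y))"
        by simp
    qed measurable
  qed (fact deg assms(1) s_def h)+
  have symbol: "(\<lambda>k. exp (- \<i> * of_real (poly \<omega> k * t)) * fourier q\<^sub>o k) = symbol t" for t
    unfolding symbol_def fourier_eq_fourier_borel[OF q_meas h ae] by (simp add: cis_conv_exp)
  \<comment> \<open>\<open>L2_solution\<close> quantifies over all times, so an arbitrary
    representative is chosen to fill in \<open>q\<close> for t \<le> 0; the classical claim concerns
    only positive times.\<close>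
  define v where "v t = (SOME u. L2_inverse_fourier (symbol t) u)" for t
  have v: "L2_inverse_fourier (symbol t) (v t)" for t
    unfolding v_def
    by (rule someI_ex[OF L2_symbol.L2_inverse_fourier_exists[OF symbol_L2[OF h_sq]]])
  define q where "q x t = (if 0 < t then sol 0 x t else v t x)" for x t
  have "L2_solution \<omega> q\<^sub>o q"
    unfolding L2_solution_def symbol
  proof
    fix t
    show "L2_inverse_fourier (symbol t) (\<lambda>x. q x t)"
      using L2_inverse_fourier_sol[OF h_sq] v[of t] by (cases "0 < t") (simp_all add: q_def)
  qed
  moreover have "classical_solution \<omega> q (UNIV \<times> {0<..})"
    by (rule classical_solution_sol) (simp add: q_def)
  ultimately show ?thesis by blast
qed

end
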